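(* Let $0<\theta<2$ and $\mu>0$, and let $x^\delta(t)$ denote the FAR solution of order $\theta$ with noisy data $y^\delta$ and noise level $\delta>0$. If $x^\dagger\in\mathcal{R}(\varphi_\mu(A^*A))$, then $$\|x^\delta(T_* )-x^\dagger\|=\mathcal{O}\big(\log^{-\mu}(\delta^{-1})\big)\quad\text{as }\delta\to0,$$ whenever the terminating time $T_*$ is chosen according to $T_*(\delta)\sim\delta^{-\kappa/\theta}$ for some $0<\kappa<2$.
   Context: $A:\mathcal{X}\to\mathcal{Y}$ is a compact linear operator between infinite-dimensional Hilbert spaces with infinite-dimensional range, $A^*$ is its adjoint, $y\in\mathcal{R}(A)$, and $x^\dagger=A^\dagger y$ is the minimum-norm solution of $Ax=y$. Noisy data $y^\delta\in\mathcal{Y}$ satisfy $\|y^\delta-y\|\le\delta$. FAR (fractional asymptotical regularization) of order $\theta\in(0,2)$: $x^\delta(t)$ is the solution of $({}^CD^\theta_{0+}x^\delta)(t)+A^*Ax^\delta(t)=A^*y^\delta$, $t>0$, with vanishing initial data ($x^\delta(0)=0$, and also $\dot x^\delta(0)=0$ if $\theta>1$), where ${}^CD^\theta_{0+}$ is the left-sided Caputo derivative of order $\theta$ (the ordinary first derivative if $\theta=1$). It is given by $x^\delta(t)=g^\theta(t,A^*A)A^*y^\delta$ with $g^\theta(t,\lambda)=t^\theta E_{\theta,\theta+1}(-\lambda t^\theta)$, where $E_{\theta_1,\theta_2}(z)=\sum_{k=0}^\infty\frac{z^k}{\Gamma(\theta_1k+\theta_2)}$ is the Mittag-Leffler function.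 An index function is a continuous, strictly increasing function $\varphi:\mathbb{R}_+\to\mathbb{R}_+$ with $\lim_{\lambda\to0+}\varphi(\lambda)=0$. For $\mu>0$, $\varphi_\mu$ is the index function with $\varphi_\mu(\lambda)=\log^{-\mu}(1/\lambda)=(\log(1/\lambda))^{-\mu}$ for $0<\lambda\le e^{-\mu-1}$, extended arbitrarily as an index function for $\lambda>e^{-\mu-1}$. $T_*(\delta)\sim h(\delta)$ means that $T_*(\delta)/h(\delta)$ is bounded above and below by positive constants. *)

theory Defs
  imports "HOL-Analysis.Analysis" "HOL-Library.Landau_Symbols"
begin

text \<open>
  A Hilbert space is a type of sort \<open>{real_inner, complete_space}\<close>. On such types the library
  constant \<^const>\<open>adjoint\<close> is the Hilbert space adjoint of every bounded linear operator: the
  function chosen by its definition exists by the Riesz theorem, and it is unique.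
\<close>

section \<open>Operators\<close>

definition finite_dim :: "'a::real_vector set \<Rightarrow> bool" where
  "finite_dim V \<longleftrightarrow> (\<exists>B. finite B \<and> span B = V)"

definition compact_operator :: "('a::real_normed_vector \<Rightarrow> 'b::real_normed_vector) \<Rightarrow> bool" where
  "compact_operator A \<longleftrightarrow> bounded_linear A \<and> (\<forall>S. bounded S \<longrightarrow> compact (closure (A ` S)))"

definition min_norm_solution ::
    "('a::real_normed_vector \<Rightarrow> 'b::real_normed_vector) \<Rightarrow> 'b \<Rightarrow> 'a \<Rightarrow> bool" where
  "min_norm_solution A y x \<longleftrightarrow> A x = y \<and> (\<forall>z. A z = y \<longrightarrow> norm x \<le> norm z)"


section \<open>Functions of a compact selfadjoint operator\<close>

definition eigenspace :: "('a::real_vector \<Rightarrow> 'a) \<Rightarrow> real \<Rightarrow> 'a set" where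
  "eigenspace T \<alpha> = {v. T v = \<alpha> *\<^sub>R v}"

definition eigenvalues :: "('a::real_vector \<Rightarrow> 'a) \<Rightarrow> real set" where
  "eigenvalues T = {\<alpha>. \<exists>v. v \<noteq> 0 \<and> v \<in> eigenspace T \<alpha>}"

definition orth_projection :: "'a::real_inner set \<Rightarrow> 'a \<Rightarrow> 'a" where
  "orth_projection S x = (THE p. p \<in> S \<and> (\<forall>s\<in>S. (x - p) \<bullet> s = 0))"

text \<open>
  By the spectral theorem the spectral measure of a compact selfadjoint \<open>T\<close> consists of the
  orthogonal projections onto its eigenspaces, so that
  \<open>\<phi>(T) x = (\<Sum>\<alpha>. \<phi>(\<alpha>) P\<^sub>\<alpha> x)\<close>, an orthogonal series over the eigenvalues
  (including \<open>0\<close> if \<open>T\<close> is not injective).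
\<close>

definition operator_fun :: "(real \<Rightarrow> real) \<Rightarrow> ('a::real_inner \<Rightarrow> 'a) \<Rightarrow> 'a \<Rightarrow> 'a" where
  "operator_fun \<phi> T x =
     (\<Sum>\<^sub>\<infinity>\<alpha>\<in>eigenvalues T. \<phi> \<alpha> *\<^sub>R orth_projection (eigenspace T \<alpha>) x)"


section \<open>Index functions\<close>

text \<open>
  Here the half-line includes \<open>0\<close>; continuity and the limit at \<open>0\<close> then give \<open>\<phi> 0 = 0\<close>. The
  values of \<open>\<phi>\<close> at negative arguments are irrelevant.
\<close>

definition index_function :: "(real \<Rightarrow> real) \<Rightarrow> bool" where
  "index_function \<phi> \<longleftrightarrow> (\<forall>\<alpha>\<ge>0. \<phi> \<alpha> \<ge> 0) \<and> continuous_on {0..} \<phi> \<and>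
     strict_mono_on {0..} \<phi> \<and> (\<phi> \<longlongrightarrow> 0) (at_right 0)"

definition log_index_function :: "real \<Rightarrow> (real \<Rightarrow> real) \<Rightarrow> bool" where
  "log_index_function \<mu> \<phi> \<longleftrightarrow> index_function \<phi> \<and>
     (\<forall>\<alpha>. 0 < \<alpha> \<and> \<alpha> \<le> exp (- \<mu> - 1) \<longrightarrow> \<phi> \<alpha> = ln (1 / \<alpha>) powr (- \<mu>))"


section \<open>Fractional asymptotical regularization\<close>

definition vderiv :: "nat \<Rightarrow> (real \<Rightarrow> 'a::real_normed_vector) \<Rightarrow> real \<Rightarrow> 'a" where
  "vderiv n x = ((\<lambda>f t. vector_derivative f (at t)) ^^ n) x"

text \<open>
  The left-sided Caputo derivative of order \<open>\<theta>\<close> at \<open>t\<close> is the fractional integral of order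
  \<open>n - \<theta>\<close> of the \<open>n\<close>-th derivative, \<open>n = \<lceil>\<theta>\<rceil>\<close>, i.e.
  \<open>1 / \<Gamma>(n - \<theta>) * (\<integral>\<^sub>0\<^sup>t (t - s)\<^bsup>n - \<theta> - 1\<^esup> x\<^bsup>(n)\<^esup>(s) ds)\<close>, and it is the ordinary
  derivative for integer orders. The values at the endpoints, where kernel and derivative may be
  singular, do not affect the integral.
\<close>

definition has_caputo_derivative ::
    "real \<Rightarrow> (real \<Rightarrow> 'a::real_normed_vector) \<Rightarrow> 'a \<Rightarrow> real \<Rightarrow> bool" where
  "has_caputo_derivative \<theta> x d t \<longleftrightarrow>
     (let n = nat \<lceil>\<theta>\<rceil> in
        if \<theta> = real n then (vderiv (n - 1) x has_vector_derivative d) (at t)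
        else ((\<lambda>s. ((t - s) powr (real n - \<theta> - 1) / Gamma (real n - \<theta>)) *\<^sub>R vderiv n x s)
                has_integral d) {0..t})"

text \<open>
  The function class in which solutions are sought: \<open>n\<close> times continuously differentiable on
  \<open>t > 0\<close> with \<open>x\<^bsup>(n)\<^esup>\<close> absolutely integrable up to \<open>t = 0\<close> (where it may be unbounded; the
  solution behaves like \<open>t\<^bsup>\<theta>\<^esup>\<close> there), which is what the Caputo integral needs.
\<close>

definition caputo_regular :: "nat \<Rightarrow> (real \<Rightarrow> 'a::real_normed_vector) \<Rightarrow> bool" where
  "caputo_regular n x \<longleftrightarrow>
     (\<forall>k<n. \<forall>t>0. vderiv k x differentiable (at t)) \<and>
     continuous_on {0<..} (vderiv n x) \<and>
     (\<forall>t>0. (\<lambda>s. norm (vderiv n x s)) integrable_on {0..t})"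

text \<open>
  At \<open>t = 0\<close> the initial data are attained continuously from the right; \<open>x\<close> at negative times is
  irrelevant.
\<close>

definition FAR_solution ::
    "real \<Rightarrow> ('a::real_inner \<Rightarrow> 'b::real_inner) \<Rightarrow> 'b \<Rightarrow> (real \<Rightarrow> 'a) \<Rightarrow> bool" where
  "FAR_solution \<theta> A z x \<longleftrightarrow>
     caputo_regular (nat \<lceil>\<theta>\<rceil>) x \<and>
     x 0 = 0 \<and> (x \<longlongrightarrow> 0) (at_right 0) \<and>
     (\<theta> > 1 \<longrightarrow> (x has_vector_derivative 0) (at 0 within {0..}) \<and>
        (vderiv 1 x \<longlongrightarrow> 0) (at_right 0)) \<and>
     (\<forall>t>0. \<exists>d. has_caputo_derivative \<theta> x d t \<and> d + adjoint A (A (x t)) = adjoint A z)"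


section \<open>Choice of the terminating time\<close>

definition same_order_at_0 :: "(real \<Rightarrow> real) \<Rightarrow> (real \<Rightarrow> real) \<Rightarrow> bool" where
  "same_order_at_0 f h \<longleftrightarrow>
     (\<exists>c>0. \<exists>C>0. \<forall>\<^sub>F \<delta> in at_right 0. c \<le> f \<delta> / h \<delta> \<and> f \<delta> / h \<delta> \<le> C)"

end

theory Submission
  imports Defs "HOL-Complex_Analysis.Complex_Analysis" "HOL-Real_Asymp.Real_Asymp"
begin

text \<open>
  Along an eigenvector \<open>v\<close> of \<open>A\<^sup>*A\<close> with eigenvalue \<open>\<alpha>\<close> the equation is scalar, and in its Volterra
  form it forces \<open>\<alpha> (x(t) \<bullet> v) = (1 - E\<^sub>\<theta>(-\<alpha> t\<^sup>\<theta>)) (y\<^sup>\<delta> \<bullet> A v)\<close>. Everything then rests on the bound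
  \<open>E\<^sub>\<theta>(-\<lambda>) = O(1/\<lambda>)\<close> for \<open>0 < \<theta> < 2\<close>, read off Hankel's contour integral after moving the contour
  into the origin. Since the eigenvectors span a dense subspace, the error is at most a constant
  times \<open>\<delta> t\<^bsup>\<theta>/2\<^esup>\<close> (noise) plus \<open>sup\<^sub>\<alpha> \<bar>E\<^sub>\<theta>(-\<alpha> t\<^sup>\<theta>)\<bar> \<phi>(\<alpha>)\<close> (bias). For \<open>t \<sim> \<delta>\<^bsup>-\<kappa>/\<theta>\<^esup>\<close> the former
  is \<open>O(\<delta>\<^bsup>1-\<kappa>/2\<^esup>)\<close> and the latter is logarithmic.
\<close>

section \<open>Compact operators on Hilbert spaces\<close>

text \<open>The trajectory is known only through its equation, so no filter formula can be inserted:
  every eigencomponent has to be pinned down by uniqueness. A component in the kernel of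
  \<open>A\<close> needs its own argument, because there the scalar identity is void. The power
  series of the Mittag-Leffler function is useless for estimates at large arguments, since its terms
  cancel; the contour integral yields convergence of the series and its decay together. The
  substitution z = log s makes powers of s single-valued and turns contour integrals into increments
  of a primitive. Only the upper half of a contour is kept: the lower half is its mirror image, so
  an imaginary part divided by pi replaces the factor 1/(2 pi i). The rate does not depend on
  \<theta> or \<kappa>, because replacing \<delta> by a fixed positive power of \<delta> changes
  ln(1/\<delta>) only by a constant factor. Of the two bounds on the terminating time, the upper one
  controls the noise and the lower one the bias.\<close>

lemma orthogonal_of_minimal:
  fixes r s :: "'a::real_inner"
  assumes "\<And>c. norm r \<le> norm (r - c *\<^sub>R s)"
  shows "r \<bullet> s = 0"
proof (rule ccontr)
  assume rs: "r \<bullet> s \<noteq> 0"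
  then have s: "0 < s \<bullet> s" by auto
  define c where "c = (r \<bullet> s) / (s \<bullet> s)"
  have "r \<bullet> r \<le> (r - c *\<^sub>R s) \<bullet> (r - c *\<^sub>R s)"
    using assms[of c] by (simp add: norm_le)
  also have "\<dots> = r \<bullet> r - (r \<bullet> s)\<^sup>2 / (s \<bullet> s)"
    using s by (simp add: c_def inner_diff_left inner_diff_right inner_commute[of s r] power2_eq_square field_simps)
  finally show False
    using rs s by (simp add: divide_le_0_iff)
qed

text \<open>A sequence in \<open>S\<close> minimizing the distance to \<open>x\<close> is Cauchy:
  midpoints of its members stay in \<open>S\<close>, hence at distance at least \<open>d\<close>,
  and the parallelogram identity turns this into a bound for \<open>q n - q m\<close>.\<close>

lemma closed_subspace_projection:
  fixes S :: "'a::{real_inner, complete_space} set"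
  assumes S: "closed S" "subspace S"
  shows "\<exists>p\<in>S. \<forall>s\<in>S. (x - p) \<bullet> s = 0"
proof -
  define d where "d = infdist x S"
  have S0: "S \<noteq> {}" using subspace_0[OF S(2)] by auto
  have d0: "0 \<le> d" by (simp add: d_def infdist_nonneg)
  have d_le: "d \<le> norm (x - s)" if "s \<in> S" for s
    using infdist_le[OF that, of x] by (simp add: d_def dist_norm)
  have "\<exists>s\<in>S. norm (x - s) < d + 1 / real (Suc n)" for n
  proof -
    have "(INF a\<in>S. dist x a) < d + 1 / real (Suc n)"
      using S0 by (simp add: d_def infdist_def)
    then show ?thesis
      using S0 by (subst (asm) cINF_less_iff) (auto simp: dist_norm intro: bdd_belowI[of _ 0])
  qed
  then obtain q where q: "\<And>n. q n \<in> S" "\<And>n. norm (x - q n) < d + 1 / real (Suc n)"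
    by metis
  have lim: "(\<lambda>n. norm (x - q n)) \<longlonglongrightarrow> d"
  proof (rule tendsto_sandwich[of "\<lambda>n. d" _ _ "\<lambda>n. d + 1 / real (Suc n)"])
    have "(\<lambda>n. d + 1 / real (Suc n)) \<longlonglongrightarrow> d + 0"
      by (intro tendsto_intros LIMSEQ_Suc[OF lim_1_over_n])
    then show "(\<lambda>n. d + 1 / real (Suc n)) \<longlonglongrightarrow> d" by simp
  qed (use q d_le in \<open>auto intro!: always_eventually less_imp_le\<close>)
  have par: "(norm (q n - q m))\<^sup>2 \<le> 2 * ((norm (x - q n))\<^sup>2 - d\<^sup>2) + 2 * ((norm (x - q m))\<^sup>2 - d\<^sup>2)" for n m
  proof -
    have "(1/2) *\<^sub>R (q n + q m) \<in> S"
      using S(2) q(1) by (intro subspace_scale subspace_add)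
    from d_le[OF this] d0 have "d\<^sup>2 \<le> (norm (x - (1/2) *\<^sub>R (q n + q m)))\<^sup>2"
      by (intro power_mono)
    moreover have "(norm (q n - q m))\<^sup>2 + 4 * (norm (x - (1/2) *\<^sub>R (q n + q m)))\<^sup>2 =
        2 * (norm (x - q n))\<^sup>2 + 2 * (norm (x - q m))\<^sup>2"
      by (simp add: power2_norm_eq_inner inner_diff_left inner_diff_right inner_add_left inner_add_right
          inner_commute algebra_simps)
    moreover have "Y \<le> 2 * (a - D) + 2 * (b - D)" if "D \<le> X" "Y + 4 * X = 2 * a + 2 * b" for a b D X Y :: real
      using that by simp
    ultimately show ?thesis by blast
  qed
  have "Cauchy q"
  proof (rule CauchyI)
    fix e :: real assume e: "0 < e"
    have "(\<lambda>n. (norm (x - q n))\<^sup>2) \<longlonglongrightarrow> d\<^sup>2"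
      by (intro tendsto_intros lim)
    from LIMSEQ_D[OF this, of "e\<^sup>2 / 4"]
    obtain N where N: "\<And>n. N \<le> n \<Longrightarrow> \<bar>(norm (x - q n))\<^sup>2 - d\<^sup>2\<bar> < e\<^sup>2 / 4"
      using e by auto
    show "\<exists>N. \<forall>m\<ge>N. \<forall>n\<ge>N. norm (q m - q n) < e"
    proof (intro exI allI impI)
      fix m n assume mn: "N \<le> m" "N \<le> n"
      have "(norm (q m - q n))\<^sup>2 < e\<^sup>2"
        using par[of m n] le_less_trans[OF abs_ge_self N[OF mn(1)]] le_less_trans[OF abs_ge_self N[OF mn(2)]]
        by simp
      then show "norm (q m - q n) < e"
        using e by (intro power2_less_imp_less[of _ e]) auto
    qed
  qed
  then obtain p where p: "q \<longlonglongrightarrow> p"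
    using Cauchy_convergent_iff convergent_def by blast
  have pS: "p \<in> S"
    using closed_sequentially[OF S(1)] q(1) p by blast
  have "(\<lambda>n. norm (x - q n)) \<longlonglongrightarrow> norm (x - p)"
    by (intro tendsto_intros p)
  with lim have np: "norm (x - p) = d"
    by (rule LIMSEQ_unique[symmetric])
  have "(x - p) \<bullet> s = 0" if "s \<in> S" for s
  proof (rule orthogonal_of_minimal)
    fix c
    have "p + c *\<^sub>R s \<in> S"
      using S(2) pS that by (intro subspace_add subspace_scale)
    from d_le[OF this] show "norm (x - p) \<le> norm (x - p - c *\<^sub>R s)"
      by (simp add: np diff_diff_eq)
  qed
  with pS show ?thesis by blast
qed

text \<open>Unless f vanishes, its kernel has codimension one: for \<open>e\<close> orthogonal to
  the kernel, \<open>x - (f x / f e) *\<^sub>R e\<close> lies in it, so pairing \<open>x\<close>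
  with \<open>e\<close> recovers \<open>f x\<close> up to a fixed factor.\<close>

lemma riesz_representation:
  fixes f :: "'a::{real_inner, complete_space} \<Rightarrow> real"
  assumes "bounded_linear f"
  shows "\<exists>w. \<forall>x. f x = x \<bullet> w"
proof (cases "\<forall>x. f x = 0")
  case True
  then show ?thesis by (intro exI[of _ 0]) simp
next
  case False
  interpret bounded_linear f by fact
  define K where "K = {x. f x = 0}"
  have "closed K"
    unfolding K_def by (rule closed_Collect_eq[OF linear_continuous_on[OF assms] continuous_on_const])
  moreover have "subspace K"
    by (auto simp: K_def subspace_def zero add scale)
  moreover obtain x0 where x0: "f x0 \<noteq> 0" using False by blast
  ultimately obtain p where p: "p \<in> K" "\<And>s. s \<in> K \<Longrightarrow> (x0 - p) \<bullet> s = 0"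
    using closed_subspace_projection[of K x0] by blast
  define e where "e = x0 - p"
  have fe: "f e \<noteq> 0" using p(1) x0 by (simp add: e_def diff K_def)
  then have ee: "e \<bullet> e \<noteq> 0" using zero by auto
  show ?thesis
  proof (intro exI allI)
    fix x
    have "x - (f x / f e) *\<^sub>R e \<in> K"
      using fe by (simp add: K_def diff scale)
    from p(2)[OF this] have "e \<bullet> x = f x / f e * (e \<bullet> e)"
      by (simp add: e_def[symmetric] inner_diff_right)
    then show "f x = x \<bullet> ((f e / (e \<bullet> e)) *\<^sub>R e)"
      using fe ee by (simp add: inner_commute[of x e])
  qed
qed

text \<open>\<open>adjoint\<close> is a choice among the functions satisfying the adjoint relation,
  so the relation is available only after one such function has been produced; Riesz supplies its
  values pointwise.\<close>

lemma inner_adjoint: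
  fixes A :: "'a::{real_inner, complete_space} \<Rightarrow> 'b::real_inner"
  assumes "bounded_linear A"
  shows "adjoint A y \<bullet> x = y \<bullet> A x"
proof -
  have "\<exists>w. \<forall>x. A x \<bullet> y = x \<bullet> w" for y
    by (rule riesz_representation)
      (rule bounded_linear_compose[OF bounded_linear_inner_left assms, unfolded o_def])
  then have "\<forall>y. \<exists>w. \<forall>x. A x \<bullet> y = x \<bullet> w" ..
  from choice[OF this] obtain g where g: "\<forall>y x. A x \<bullet> y = x \<bullet> g y" ..
  have "\<exists>g. \<forall>x y. A x \<bullet> y = x \<bullet> g y"
    by (rule exI[of _ g]) (use g in blast)
  from someI_ex[OF this] have "A x \<bullet> y = x \<bullet> adjoint A y"
    unfolding adjoint_def by blast
  then show ?thesis
    by (simp only: inner_commute[of "adjoint A y"] inner_commute[of y])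
qed

lemma bounded_linear_adjoint:
  fixes A :: "'a::{real_inner, complete_space} \<Rightarrow> 'b::real_inner"
  assumes "bounded_linear A"
  shows "bounded_linear (adjoint A)"
proof -
  note adj = inner_adjoint[OF assms]
  obtain K where K: "0 < K" "\<And>x. norm (A x) \<le> norm x * K"
    using bounded_linear.pos_bounded[OF assms] by blast
  show ?thesis
  proof (rule bounded_linear_intro)
    show "adjoint A (x + y) = adjoint A x + adjoint A y" for x y
    proof -
      have "\<forall>z. adjoint A (x + y) \<bullet> z = (adjoint A x + adjoint A y) \<bullet> z"
        by (simp add: adj inner_add_left)
      then show ?thesis by (simp only: vector_eq_rdot)
    qed
    show "adjoint A (r *\<^sub>R x) = r *\<^sub>R adjoint A x" for r x
    proof -
      have "\<forall>z. adjoint A (r *\<^sub>R x) \<bullet> z = (r *\<^sub>R adjoint A x) \<bullet> z"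
        by (simp add: adj)
      then show ?thesis by (simp only: vector_eq_rdot)
    qed
    fix y
    have "norm (adjoint A y) * norm (adjoint A y) = y \<bullet> A (adjoint A y)"
      by (simp add: adj[symmetric] power2_norm_eq_inner[symmetric] power2_eq_square)
    also have "\<dots> \<le> norm y * norm (A (adjoint A y))"
      by (rule norm_cauchy_schwarz)
    also have "\<dots> \<le> norm y * (norm (adjoint A y) * K)"
      by (intro mult_left_mono K) auto
    finally have "norm (adjoint A y) * norm (adjoint A y) \<le> norm (adjoint A y) * (norm y * K)"
      by (simp add: mult_ac)
    then show "norm (adjoint A y) \<le> norm y * K"
      using K(1) by (cases "adjoint A y = 0") auto
  qed
qed

lemma orth_projection:
  fixes S :: "'a::{real_inner, complete_space} set"
  assumes "closed S" "subspace S"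
  shows "orth_projection S x \<in> S" and "s \<in> S \<Longrightarrow> orth_projection S x \<bullet> s = x \<bullet> s"
proof -
  have "\<exists>!p. p \<in> S \<and> (\<forall>s\<in>S. (x - p) \<bullet> s = 0)"
  proof (rule ex_ex1I)
    fix p q
    assume p: "p \<in> S \<and> (\<forall>s\<in>S. (x - p) \<bullet> s = 0)" and q: "q \<in> S \<and> (\<forall>s\<in>S. (x - q) \<bullet> s = 0)"
    then have "p - q \<in> S" using assms by (simp add: subspace_diff)
    then have "(x - p) \<bullet> (p - q) = 0" "(x - q) \<bullet> (p - q) = 0" using p q by auto
    then have "(p - q) \<bullet> (p - q) = 0" by (simp add: inner_diff_left)
    then show "p = q" by simp
  qed (use closed_subspace_projection[OF assms, of x] in blast)
  from theI'[OF this] have "orth_projection S x \<in> S" "\<forall>s\<in>S. (x - orth_projection S x) \<bullet> s = 0"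
    by (simp_all add: orth_projection_def)
  then show "orth_projection S x \<in> S" and "s \<in> S \<Longrightarrow> orth_projection S x \<bullet> s = x \<bullet> s"
    by (auto simp: inner_diff_left)
qed


section \<open>Eigenspaces of a compact selfadjoint operator\<close>

lemma closed_subspace_eigenspace:
  assumes "bounded_linear T"
  shows "closed (eigenspace T \<alpha>)" and "subspace (eigenspace T \<alpha>)"
proof -
  interpret bounded_linear T by fact
  show "closed (eigenspace T \<alpha>)"
    unfolding eigenspace_def
    by (rule closed_Collect_eq[OF linear_continuous_on[OF assms] linear_continuous_on[OF bounded_linear_scaleR_right]])
  show "subspace (eigenspace T \<alpha>)"
    by (auto simp: eigenspace_def subspace_def zero add scale algebra_simps)
qed

lemma eigenspaces_orthogonal:
  assumes "\<And>x y. T x \<bullet> y = x \<bullet> T y" "v \<in> eigenspace T \<alpha>" "w \<in> eigenspace T \<beta>" "\<alpha> \<noteq> \<beta>"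
  shows "v \<bullet> w = 0"
  using assms(1)[of v w] assms(2-4) by (auto simp: eigenspace_def)

text \<open>
  A maximizing sequence of \<open>\<parallel>A v\<parallel>\<close> on the unit sphere of \<open>W\<close> is almost an eigenvector sequence, and
  compactness makes it converge along a subsequence.
\<close>

lemma compact_operator_eigenvector:
  fixes A :: "'a::{real_inner, complete_space} \<Rightarrow> 'b::real_inner"
  assumes A: "compact_operator A"
    and W: "closed W" "subspace W" "\<And>w. w \<in> W \<Longrightarrow> adjoint A (A w) \<in> W" and w0: "w0 \<in> W" "w0 \<noteq> 0"
  shows "\<exists>v\<in>W. v \<noteq> 0 \<and> (\<exists>\<alpha>. adjoint A (A v) = \<alpha> *\<^sub>R v)"
proof -
  have bl: "bounded_linear A" using A by (simp add: compact_operator_def)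
  interpret A: bounded_linear A by (rule bl)
  interpret A': bounded_linear "adjoint A" by (rule bounded_linear_adjoint[OF bl])
  note adj = inner_adjoint[OF bl]
  obtain K where K: "0 < K" "\<And>x. norm (A x) \<le> norm x * K"
    using A.pos_bounded by blast
  define X where "X = (\<lambda>v. (norm (A v))\<^sup>2) ` {v \<in> W. norm v = 1}"
  define M where "M = Sup X"
  have unit: "(1 / norm w) *\<^sub>R w \<in> {v \<in> W. norm v = 1}" if "w \<in> W" "w \<noteq> 0" for w
    using that W(2) by (simp add: subspace_scale)
  have X0: "X \<noteq> {}" using unit[OF w0] by (auto simp: X_def)
  have "x \<le> K\<^sup>2" if x: "x \<in> X" for x
  proof -
    obtain v where v: "x = (norm (A v))\<^sup>2" "norm v = 1" using x unfolding X_def by blast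
    then show ?thesis using K(2)[of v] by (auto intro: power_mono)
  qed
  then have bdd: "bdd_above X" by (auto simp: bdd_above_def)
  have le: "(norm (A w))\<^sup>2 \<le> M * (norm w)\<^sup>2" if "w \<in> W" for w
  proof (cases "w = 0")
    case False
    have "(norm (A ((1 / norm w) *\<^sub>R w)))\<^sup>2 \<le> M"
      unfolding M_def using unit[OF that False] by (intro cSup_upper bdd) (auto simp: X_def)
    then show ?thesis
      using False by (simp add: A.scale power_mult_distrib power_divide field_simps)
  qed (simp add: A.zero)
  have M0: "0 \<le> M"
    using le[OF w0(1)] w0(2) by (meson order_trans zero_le_mult_iff zero_le_power2 zero_less_norm_iff zero_less_power not_less)
  show ?thesis
  proof (cases "M = 0")
    \<comment> \<open>Here \<open>A\<close> vanishes on \<open>W\<close>, so \<open>w0\<close>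
      itself is an eigenvector, with eigenvalue 0.\<close>
    case True
    then have "A w0 = 0" using le[OF w0(1)] by simp
    then show ?thesis
      using w0 by (intro bexI[of _ w0] conjI exI[of _ 0]) (simp_all add: A'.zero)
  next
    case False
    with M0 have M: "0 < M" by simp
    \<comment> \<open>Cauchy-Schwarz for \<open>A v\<close> and \<open>A ?T\<close>, where
      invariance of \<open>W\<close> allows \<open>le\<close> to be applied to \<open>?T\<close>; a
      factor \<open>(norm ?T)^2\<close> then cancels.\<close>
    have T_le: "(norm (adjoint A (A v)))\<^sup>2 \<le> M * (norm (A v))\<^sup>2" if "v \<in> W" for v
    proof -
      let ?T = "adjoint A (A v)"
      have "(norm ?T)\<^sup>2 = A v \<bullet> A ?T"
        by (simp add: power2_norm_eq_inner adj)
      also have "\<dots> \<le> norm (A v) * norm (A ?T)"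
        by (rule norm_cauchy_schwarz)
      finally have "((norm ?T)\<^sup>2)\<^sup>2 \<le> (norm (A v))\<^sup>2 * (norm (A ?T))\<^sup>2"
        by (metis power_mono power_mult_distrib zero_le_power2)
      also have "\<dots> \<le> (norm (A v))\<^sup>2 * (M * (norm ?T)\<^sup>2)"
        by (intro mult_left_mono le W that) auto
      finally have le4: "(norm ?T)\<^sup>2 * (norm ?T)\<^sup>2 \<le> (norm ?T)\<^sup>2 * (M * (norm (A v))\<^sup>2)"
        by (simp add: power2_eq_square mult_ac)
      show ?thesis
      proof (cases "?T = 0")
        case False
        then have "0 < (norm ?T)\<^sup>2" by simp
        from mult_le_cancel_left_pos[OF this] le4 show ?thesis by blast
      qed (use M0 in simp)
    qed
    have "\<exists>v. v \<in> W \<and> norm v = 1 \<and> M - 1 / real (Suc n) < (norm (A v))\<^sup>2" for n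
    proof -
      have "M - 1 / real (Suc n) < Sup X" by (simp add: M_def)
      from less_cSupD[OF X0 this] show ?thesis unfolding X_def by blast
    qed
    then obtain v where v: "\<And>n. v n \<in> W" "\<And>n. norm (v n) = 1" "\<And>n. M - 1 / real (Suc n) < (norm (A (v n)))\<^sup>2"
      by metis
    have "bounded (range v)" using v(2) by (auto simp: bounded_iff)
    then have "compact (closure (A ` range v))"
      using A by (simp add: compact_operator_def)
    then have sc: "seq_compact (closure (A ` range v))"
      by (simp add: compact_eq_seq_compact_metric)
    have "\<forall>n. A (v n) \<in> closure (A ` range v)"
      by (intro allI subsetD[OF closure_subset]) auto
    with sc obtain y r where r: "strict_mono r" "((\<lambda>n. A (v n)) \<circ> r) \<longlonglongrightarrow> y"
      unfolding seq_compact_def by meson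
    define p where "p = adjoint A y"
    have Tp: "(\<lambda>n. adjoint A (A (v (r n)))) \<longlonglongrightarrow> p"
      using A'.tendsto[OF r(2)] by (simp add: p_def o_def)
    \<comment> \<open>After expanding the square, \<open>T_le\<close> leaves
      \<open>M * (M - (norm (A (v n)))^2)\<close>, which the choice of \<open>v n\<close> makes
      small.\<close>
    have diff: "(norm (adjoint A (A (v n)) - M *\<^sub>R v n))\<^sup>2 \<le> M * (1 / real (Suc n))" for n
    proof -
      have "(norm (adjoint A (A (v n)) - M *\<^sub>R v n))\<^sup>2 =
          (norm (adjoint A (A (v n))))\<^sup>2 - 2 * M * (norm (A (v n)))\<^sup>2 + M * M * (v n \<bullet> v n)"
      proof -
        have Tv: "adjoint A (A (v n)) \<bullet> v n = A (v n) \<bullet> A (v n)" by (rule adj)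
        then have "v n \<bullet> adjoint A (A (v n)) = A (v n) \<bullet> A (v n)" by (subst inner_commute)
        with Tv show ?thesis
          by (simp add: power2_norm_eq_inner inner_diff_left inner_diff_right algebra_simps)
      qed
      also have "v n \<bullet> v n = 1"
        using v(2)[of n] by (simp add: norm_eq_1)
      also have "(norm (adjoint A (A (v n))))\<^sup>2 - 2 * M * (norm (A (v n)))\<^sup>2 + M * M * 1
          \<le> M * (M - (norm (A (v n)))\<^sup>2)"
        using T_le[OF v(1)[of n]] by (simp add: algebra_simps)
      also have "\<dots> \<le> M * (1 / real (Suc n))"
        using v(3)[of n] M0 by (intro mult_left_mono) auto
      finally show ?thesis .
    qed
    have "(\<lambda>n. M * (1 / real (Suc n))) \<longlonglongrightarrow> M * 0"
      by (intro tendsto_intros LIMSEQ_Suc[OF lim_1_over_n])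
    then have "(\<lambda>n. M * (1 / real (Suc n))) \<longlonglongrightarrow> 0" by simp
    then have "(\<lambda>n. (norm (adjoint A (A (v n)) - M *\<^sub>R v n))\<^sup>2) \<longlonglongrightarrow> 0"
      by (rule Lim_null_comparison[rotated]) (use diff in auto)
    from tendsto_real_sqrt[OF this]
    have "(\<lambda>n. adjoint A (A (v n)) - M *\<^sub>R v n) \<longlonglongrightarrow> 0"
      by (simp add: tendsto_norm_zero_iff)
    \<comment> \<open>Compactness gives convergence only of the images; since the scaled vectors
      \<open>M *\<^sub>R v (r n)\<close> differ from \<open>adjoint A (A (v (r n)))\<close> by a
      null sequence, the vectors converge as well.\<close>
    from tendsto_diff[OF Tp LIMSEQ_subseq_LIMSEQ[OF this r(1)]]
    have "(\<lambda>n. M *\<^sub>R v (r n)) \<longlonglongrightarrow> p" by (simp add: o_def)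
    from tendsto_scaleR[OF tendsto_const this, of "1 / M"]
    have vr: "(\<lambda>n. v (r n)) \<longlonglongrightarrow> (1 / M) *\<^sub>R p" using M by simp
    have "(1 / M) *\<^sub>R p \<in> W"
      using closed_sequentially[OF W(1) _ vr] v(1) by blast
    moreover have "norm ((1 / M) *\<^sub>R p) = 1"
    proof -
      have "(\<lambda>n. 1) \<longlonglongrightarrow> norm ((1 / M) *\<^sub>R p)"
        using tendsto_norm[OF vr] unfolding v(2) .
      then show ?thesis by (simp only: LIMSEQ_const_iff)
    qed
    moreover have "adjoint A (A ((1 / M) *\<^sub>R p)) = M *\<^sub>R ((1 / M) *\<^sub>R p)"
      using LIMSEQ_unique[OF A'.tendsto[OF A.tendsto[OF vr]] Tp] M by simp
    ultimately show ?thesis by (metis norm_zero zero_neq_one)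
  qed
qed

text \<open>The orthogonal complement of all eigenvectors is closed and, by symmetry, invariant
  under \<open>adjoint A \<circ> A\<close>. If it were nonzero it would contain an eigenvector,
  which would be orthogonal to itself.\<close>

lemma eigenvectors_dense:
  fixes A :: "'a::{real_inner, complete_space} \<Rightarrow> 'b::real_inner"
  assumes A: "compact_operator A"
  shows "closure (span (\<Union>\<alpha>. eigenspace (adjoint A \<circ> A) \<alpha>)) = UNIV"
proof (rule ccontr)
  define U where "U = (\<Union>\<alpha>. eigenspace (adjoint A \<circ> A) \<alpha>)"
  assume "closure (span (\<Union>\<alpha>. eigenspace (adjoint A \<circ> A) \<alpha>)) \<noteq> UNIV"
  then obtain x where x: "x \<notin> closure (span U)" by (auto simp: U_def)
  have bl: "bounded_linear A" using A by (simp add: compact_operator_def)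
  note adj = inner_adjoint[OF bl]
  have "subspace (closure (span U))"
    unfolding subspace_def
  proof (intro conjI ballI allI)
    show "0 \<in> closure (span U)" using closure_subset span_zero by blast
    fix a b assume "a \<in> closure (span U)" "b \<in> closure (span U)"
    then obtain f g where "\<And>n. f n \<in> span U" "f \<longlonglongrightarrow> a" "\<And>n. g n \<in> span U" "g \<longlonglongrightarrow> b"
      by (auto simp: closure_sequential)
    then show "a + b \<in> closure (span U)"
      unfolding closure_sequential by (intro exI[of _ "\<lambda>n. f n + g n"]) (auto intro: span_add tendsto_add)
  next
    fix c a assume "a \<in> closure (span U)"
    then obtain f where "\<And>n. f n \<in> span U" "f \<longlonglongrightarrow> a"
      by (auto simp: closure_sequential)
    then show "c *\<^sub>R a \<in> closure (span U)"
      unfolding closure_sequential by (intro exI[of _ "\<lambda>n. c *\<^sub>R f n"]) (auto intro: span_scale tendsto_scaleR)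
  qed
  from closed_subspace_projection[OF closed_closure this, of x]
  obtain p where p: "p \<in> closure (span U)" "\<And>s. s \<in> closure (span U) \<Longrightarrow> (x - p) \<bullet> s = 0"
    by blast
  define W where "W = {w. \<forall>u\<in>U. w \<bullet> u = 0}"
  have "\<exists>v\<in>W. v \<noteq> 0 \<and> (\<exists>\<alpha>. adjoint A (A v) = \<alpha> *\<^sub>R v)"
  proof (rule compact_operator_eigenvector[OF A, of W "x - p"])
    have "W = (\<Inter>u\<in>U. {w. w \<bullet> u = 0})" by (auto simp: W_def)
    then show "closed W"
      by (auto intro!: closed_Collect_eq continuous_intros)
    show "subspace W"
      by (auto simp: W_def subspace_def inner_add_left)
    show "adjoint A (A w) \<in> W" if "w \<in> W" for w
      unfolding W_def
    proof (intro CollectI ballI)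
      fix u assume "u \<in> U"
      then obtain \<alpha> where "adjoint A (A u) = \<alpha> *\<^sub>R u" by (auto simp: U_def eigenspace_def)
      then have "adjoint A (A w) \<bullet> u = \<alpha> * (w \<bullet> u)"
        using adj[of "A w" u] adj[of "A u" w] by (simp add: inner_commute)
      then show "adjoint A (A w) \<bullet> u = 0"
        using that \<open>u \<in> U\<close> by (simp add: W_def)
    qed
    show "x - p \<in> W"
      using p(2) closure_subset[of "span U"] span_base[of _ U] by (auto simp: W_def)
    show "x - p \<noteq> 0" using p(1) x by auto
  qed
  then obtain v \<alpha> where v: "v \<in> W" "v \<noteq> 0" "adjoint A (A v) = \<alpha> *\<^sub>R v" by blast
  then have "v \<in> U" by (auto simp: U_def eigenspace_def)
  with v(1,2) show False by (auto simp: W_def)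
qed

text \<open>Collecting a linear combination by subspace gives one summand per eigenvalue, so that
  the summands become pairwise orthogonal in the application.\<close>

lemma span_Union_subspaces:
  fixes E :: "'i \<Rightarrow> 'a::real_vector set"
  assumes E: "\<And>i. subspace (E i)" and x: "x \<in> span (\<Union>i. E i)"
  shows "\<exists>F s. finite F \<and> (\<forall>i. s i \<in> E i) \<and> x = (\<Sum>i\<in>F. s i)"
proof -
  \<comment> \<open>With \<open>s\<close> vanishing outside \<open>F\<close>, an index can be
    inserted into \<open>F\<close> without asking whether it is already there.\<close>
  have "\<exists>F s. finite F \<and> (\<forall>i. s i \<in> E i) \<and> (\<forall>i. i \<notin> F \<longrightarrow> s i = 0) \<and> x = (\<Sum>i\<in>F. s i)"
    using x
  proof (induction rule: span_induct_alt)
    case base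
    show ?case
      using E by (intro exI[of _ "{}"] exI[of _ "\<lambda>i. 0"]) (auto intro: subspace_0)
  next
    case (step c a b)
    then obtain i F s where i: "a \<in> E i" and F: "finite F" "\<And>i. s i \<in> E i" "\<And>i. i \<notin> F \<Longrightarrow> s i = 0" "b = (\<Sum>i\<in>F. s i)"
      by blast
    have b: "b = (\<Sum>j\<in>insert i F. s j)"
      using F by (cases "i \<in> F") (auto simp: insert_absorb)
    have "c *\<^sub>R a + b = (\<Sum>j\<in>insert i F. (s(i := c *\<^sub>R a + s i)) j)"
      unfolding b using F(1) by (subst (1 2) sum.remove[of _ i]) auto
    then show ?case
      using F i subspace_add[OF E subspace_scale[OF E i] F(2)]
      by (intro exI[of _ "insert i F"] exI[of _ "s(i := c *\<^sub>R a + s i)"]) auto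
  qed
  then show ?thesis by blast
qed

text \<open>By orthogonality of eigenspaces only one term of the series survives. The witness is
  \<open>w\<close> itself if the family is summable; otherwise the infinite sum has the default
  value 0, and the witness is 0.\<close>

lemma inner_operator_fun:
  fixes T :: "'a::{real_inner, complete_space} \<Rightarrow> 'a"
  assumes T: "bounded_linear T" and sym: "\<And>x y. T x \<bullet> y = x \<bullet> T y"
  shows "\<exists>w'. \<forall>\<beta>. \<forall>v\<in>eigenspace T \<beta>. operator_fun \<phi> T w \<bullet> v = \<phi> \<beta> * (w' \<bullet> v)"
proof (cases "(\<lambda>\<alpha>. \<phi> \<alpha> *\<^sub>R orth_projection (eigenspace T \<alpha>) w) summable_on eigenvalues T")
  case False
  then show ?thesis
    by (intro exI[of _ 0]) (simp add: operator_fun_def infsum_not_exists)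
next
  case True
  show ?thesis
  proof (intro exI allI ballI)
    fix \<beta> v assume v: "v \<in> eigenspace T \<beta>"
    note proj = orth_projection[OF closed_subspace_eigenspace[OF T]]
    show "operator_fun \<phi> T w \<bullet> v = \<phi> \<beta> * (w \<bullet> v)"
    proof (cases "v = 0")
      case False
      then have \<beta>: "\<beta> \<in> eigenvalues T" using v by (auto simp: eigenvalues_def)
      have "operator_fun \<phi> T w \<bullet> v = (\<Sum>\<^sub>\<infinity>\<alpha>\<in>eigenvalues T. (\<phi> \<alpha> *\<^sub>R orth_projection (eigenspace T \<alpha>) w) \<bullet> v)"
        unfolding operator_fun_def
        by (rule infsumI[symmetric])
          (rule has_sum_bounded_linear[OF bounded_linear_inner_left has_sum_infsum[OF True]])
      also have "\<dots> = (\<Sum>\<^sub>\<infinity>\<alpha>\<in>{\<beta>}. (\<phi> \<alpha> *\<^sub>R orth_projection (eigenspace T \<alpha>) w) \<bullet> v)"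
        by (rule infsum_cong_neutral)
          (use \<beta> eigenspaces_orthogonal[OF sym proj(1) v] in auto)
      also have "\<dots> = \<phi> \<beta> * (w \<bullet> v)"
        using proj(2)[OF v] by simp
      finally show ?thesis .
    qed simp
  qed
qed

section \<open>Hankel's integral and the Mittag-Leffler function\<close>

text \<open>Horizontal pieces of a contour get arbitrarily long, so the bound must be an increment
  of an antiderivative; for the vertical pieces, whose length stays bounded, a supremum
  suffices.\<close>

lemma horizontal_increment_bound:
  fixes P G :: "complex \<Rightarrow> complex" and \<phi> \<phi>' :: "real \<Rightarrow> real"
  assumes "a \<le> b"
    and P: "\<And>x. a \<le> x \<Longrightarrow> x \<le> b \<Longrightarrow> (P has_field_derivative G (Complex x v)) (at (Complex x v))"
    and \<phi>: "\<And>x. a \<le> x \<Longrightarrow> x \<le> b \<Longrightarrow> (\<phi> has_real_derivative \<phi>' x) (at x)"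
    and le: "\<And>x. a \<le> x \<Longrightarrow> x \<le> b \<Longrightarrow> cmod (G (Complex x v)) \<le> \<phi>' x"
  shows "cmod (P (Complex b v) - P (Complex a v)) \<le> \<phi> b - \<phi> a"
proof (cases "a = b")
  case False
  have d: "((\<lambda>x. P (Complex x v)) has_vector_derivative G (Complex x v)) (at x)"
    if "a \<le> x" "x \<le> b" for x
  proof -
    have "((\<lambda>x. Complex x v) has_vector_derivative 1) (at x)"
      unfolding Complex_eq by (auto intro!: derivative_eq_intros has_vector_derivative_of_real)
    from field_vector_diff_chain_at[OF this P[OF that]] show ?thesis
      by (simp add: o_def)
  qed
  show ?thesis
  proof (rule differentiable_bound_general[where f' = "\<lambda>x. G (Complex x v)" and \<phi>' = \<phi>'])
    show "continuous_on {a..b} (\<lambda>x. P (Complex x v))"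
      by (intro continuous_at_imp_continuous_on ballI has_vector_derivative_continuous[OF d]) auto
    show "continuous_on {a..b} \<phi>"
      by (intro continuous_at_imp_continuous_on ballI DERIV_isCont[OF \<phi>]) auto
  qed (use False assms d in \<open>auto simp: has_real_derivative_iff_has_vector_derivative\<close>)
qed simp

lemma vertical_increment_bound:
  fixes P G :: "complex \<Rightarrow> complex"
  assumes "u \<le> v"
    and P: "\<And>y. u \<le> y \<Longrightarrow> y \<le> v \<Longrightarrow> (P has_field_derivative G (Complex x y)) (at (Complex x y))"
    and le: "\<And>y. u \<le> y \<Longrightarrow> y \<le> v \<Longrightarrow> cmod (G (Complex x y)) \<le> B"
  shows "cmod (P (Complex x v) - P (Complex x u)) \<le> B * (v - u)"
proof -
  have on_seg: "\<exists>y. z = Complex x y \<and> u \<le> y \<and> y \<le> v"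
    if "z \<in> closed_segment (Complex x u) (Complex x v)" for z
  proof -
    have "Re z = x" "Im z \<in> {u..v}"
      using that \<open>u \<le> v\<close> by (simp_all add: closed_segment_same_Re closed_segment_eq_real_ivl)
    then show ?thesis
      by (metis atLeastAtMost_iff complex.collapse)
  qed
  have "cmod (P (Complex x v) - P (Complex x u)) \<le> B * cmod (Complex x v - Complex x u)"
  proof (rule field_differentiable_bound)
    fix z assume "z \<in> closed_segment (Complex x u) (Complex x v)"
    then obtain y where "z = Complex x y" "u \<le> y" "y \<le> v"
      using on_seg by blast
    then show "(P has_field_derivative G z) (at z within closed_segment (Complex x u) (Complex x v))"
      and "cmod (G z) \<le> B"
      using P le by (auto intro: has_field_derivative_at_within)
  qed auto
  also have "cmod (Complex x v - Complex x u) = v - u"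
    using \<open>u \<le> v\<close> by (simp add: cmod_def)
  finally show ?thesis .
qed

text \<open>This makes the real axis, where the integrands are real, free of cost: the starting
  abscissa of a contour can be moved at will.\<close>

lemma horizontal_Im_const:
  fixes P G :: "complex \<Rightarrow> complex"
  assumes P: "\<And>x. (P has_field_derivative G (Complex x v)) (at (Complex x v))"
    and G: "\<And>x. Im (G (Complex x v)) = 0"
  shows "Im (P (Complex a v)) = Im (P (Complex b v))"
proof -
  have "((\<lambda>x. Im (P (Complex x v))) has_real_derivative 0) (at x)" for x
  proof -
    have "((\<lambda>x. Complex x v) has_vector_derivative 1) (at x)"
      unfolding Complex_eq by (auto intro!: derivative_eq_intros has_vector_derivative_of_real)
    from field_vector_diff_chain_at[OF this P[of x]]
    have "((\<lambda>x. P (Complex x v)) has_vector_derivative G (Complex x v)) (at x)"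
      by (simp add: o_def)
    from has_field_derivative_Im[OF this] show ?thesis by (simp add: G)
  qed
  then show ?thesis
    using DERIV_isconst_all by blast
qed

text \<open>
  In the variable \<open>z = log s\<close> the integrand \<open>e\<^sup>s s\<^bsup>-\<beta>\<^esup> ds\<close> of Hankel's integral becomes the entire
  function below, and the integral is an increment of its primitive.
\<close>

definition hankel_fun :: "real \<Rightarrow> complex \<Rightarrow> complex" where
  "hankel_fun \<beta> z = exp (exp z + of_real (1 - \<beta>) * z)"

definition hankel_prim :: "real \<Rightarrow> complex \<Rightarrow> complex" where
  "hankel_prim \<beta> = (SOME P. \<forall>z. (P has_field_derivative hankel_fun \<beta> z) (at z))"

lemma hankel_prim_deriv: "(hankel_prim \<beta> has_field_derivative hankel_fun \<beta> z) (at z)"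
proof -
  have "hankel_fun \<beta> holomorphic_on UNIV"
    unfolding hankel_fun_def by (intro holomorphic_intros)
  from holomorphic_convex_primitive'[OF convex_UNIV open_UNIV this]
  have "\<exists>P. \<forall>z. (P has_field_derivative hankel_fun \<beta> z) (at z)"
    by auto
  then show ?thesis
    unfolding hankel_prim_def by (rule someI_ex[THEN spec])
qed

lemma norm_hankel_fun:
  "cmod (hankel_fun \<beta> (Complex x v)) = exp (exp x * cos v + (1 - \<beta>) * x)"
  by (simp add: hankel_fun_def Re_exp)

lemma hankel_fun_real: "Im (hankel_fun \<beta> (Complex x 0)) = 0"
  by (simp add: hankel_fun_def Im_exp)

lemma hankel_prim_real: "Im (hankel_prim \<beta> (Complex a 0)) = Im (hankel_prim \<beta> (Complex b 0))"
  by (rule horizontal_Im_const[of _ "hankel_fun \<beta>"]) (rule hankel_prim_deriv hankel_fun_real)+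

section \<open>Hankel's formula for the reciprocal Gamma function\<close>

lemma exp_decay_tendsto:
  fixes k :: real
  assumes "0 < k"
  shows "(\<lambda>n. exp (b * real n - k * exp (real n))) \<longlonglongrightarrow> 0"
  using assms by real_asymp

text \<open>On the joining segment \<open>cos y\<close> is at most \<open>cos \<psi>\<close>, which
  is negative, so the integrand decays doubly exponentially in \<open>n\<close> over a fixed length.
  The far end of the contour can thus be turned from the negative axis to any ray in the left
  half-plane.\<close>

lemma hankel_shift:
  assumes "pi / 2 < \<psi>" "\<psi> < pi"
  shows "(\<lambda>n. hankel_prim \<beta> (Complex (real n) \<psi>) - hankel_prim \<beta> (Complex (real n) pi)) \<longlonglongrightarrow> 0"
proof (rule Lim_null_comparison)
  let ?b = "\<lambda>n. exp ((1 - \<beta>) * real n - (- cos \<psi>) * exp (real n)) * (pi - \<psi>)"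
  show "\<forall>\<^sub>F n in sequentially. cmod (hankel_prim \<beta> (Complex (real n) \<psi>) - hankel_prim \<beta> (Complex (real n) pi)) \<le> ?b n"
  proof (intro always_eventually allI)
    fix n
    have "cmod (hankel_prim \<beta> (Complex (real n) pi) - hankel_prim \<beta> (Complex (real n) \<psi>)) \<le> ?b n"
    proof (rule vertical_increment_bound[where G = "hankel_fun \<beta>"])
      fix y assume "\<psi> \<le> y" "y \<le> pi"
      then have "cos y \<le> cos \<psi>"
        using assms by (intro cos_monotone_0_pi_le) auto
      then show "cmod (hankel_fun \<beta> (Complex (real n) y)) \<le> exp ((1 - \<beta>) * real n - (- cos \<psi>) * exp (real n))"
        by (simp add: norm_hankel_fun mult.commute)
    qed (use assms hankel_prim_deriv in auto)
    then show "cmod (hankel_prim \<beta> (Complex (real n) \<psi>) - hankel_prim \<beta> (Complex (real n) pi)) \<le> ?b n"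
      by (simp add: norm_minus_commute)
  qed
  have "cos \<psi> < 0"
    using assms cos_monotone_0_pi[of "pi/2" \<psi>] by simp
  then show "?b \<longlonglongrightarrow> 0"
    using tendsto_mult_left_zero[OF exp_decay_tendsto[of "- cos \<psi>" "1 - \<beta>"]] by simp
qed


text \<open>The bounds are the images under \<open>exp\<close> of the abscissas \<open>- n\<close>
  and \<open>n\<close> at which the contour is cut.\<close>

lemma Gamma_truncated_tendsto:
  fixes a :: real
  assumes "0 < a"
  shows "(\<lambda>n. integral {exp (- real n)..exp (real n)} (\<lambda>t. t powr (a - 1) / exp t)) \<longlonglongrightarrow> Gamma a"
proof -
  let ?f = "\<lambda>t::real. t powr (a - 1) / exp t"
  let ?A = "\<lambda>n. {exp (- real n)..exp (real n)}"
  have hi: "(?f has_integral Gamma a) {0..}"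
    by (rule Gamma_integral_real[OF assms])
  have "?f absolutely_integrable_on {0..}"
    using hi by (intro nonnegative_absolutely_integrable_1) auto
  then have abs0: "set_integrable lebesgue {0<..} ?f"
    by (rule set_integrable_subset) auto
  have un: "(\<Union>n. ?A n) = {0<..}"
  proof safe
    fix t :: real assume "0 < t"
    obtain n where "\<bar>ln t\<bar> < real n"
      using reals_Archimedean2 by blast
    then have "exp (- real n) \<le> t \<and> t \<le> exp (real n)"
      using \<open>0 < t\<close> by (metis abs_le_iff exp_le_cancel_iff exp_ln less_imp_le minus_le_iff)
    then show "t \<in> (\<Union>n. ?A n)" by auto
  next
    fix t :: real and n :: nat assume "t \<in> ?A n"
    then show "0 < t" by (metis atLeastAtMost_iff exp_gt_zero less_le_trans)
  qed
  have "(\<lambda>n. LINT x:?A n|lebesgue. ?f x) \<longlonglongrightarrow> (LINT x:(\<Union>n. ?A n)|lebesgue. ?f x)"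
  proof (rule set_integral_cont_up)
    show "incseq ?A" by (auto simp: incseq_def intro: order_trans)
  qed (use abs0 un in auto)
  moreover have "(LINT x:?A n|lebesgue. ?f x) = integral (?A n) ?f" for n
    by (rule set_lebesgue_integral_eq_integral)
      (rule set_integrable_subset[OF abs0], use un in auto)
  moreover have "(LINT x:{0<..}|lebesgue. ?f x) = Gamma a"
  proof -
    have "(LINT x:{0<..}|lebesgue. ?f x) = integral {0<..} ?f"
      by (rule set_lebesgue_integral_eq_integral[OF abs0])
    also have "(?f has_integral Gamma a) {0<..}"
      by (subst has_integral_spike_set_eq[of _ "{0..}"]) (use hi in \<open>auto intro: negligible_subset[of "{0}"]\<close>)
    then have "integral {0<..} ?f = Gamma a" by (rule integral_unique)
    finally show ?thesis .
  qed
  ultimately show ?thesis by (simp add: un)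
qed

text \<open>For \<beta> < 1 the integrand is integrable at s = 0, so the left end of the contour can
  go to minus infinity. What remains is the edge with argument pi, whose imaginary part is
  \<open>sin ((1 - \<beta>) * pi)\<close> times a truncated integral for
  \<open>Gamma (1 - \<beta>)\<close>; the reflection formula finishes.\<close>

lemma hankel_limit_less_1:
  assumes "0 < \<beta>" "\<beta> < 1"
  shows "(\<lambda>n. Im (hankel_prim \<beta> (Complex (real n) pi) - hankel_prim \<beta> (Complex 0 0))) \<longlonglongrightarrow> pi / Gamma \<beta>"
proof -
  let ?P = "hankel_prim \<beta>"
  let ?s = "sin ((1 - \<beta>) * pi)"
  let ?f = "\<lambda>t::real. t powr (1 - \<beta> - 1) / exp t"
  have top: "Im (?P (Complex (real n) pi) - ?P (Complex (- real n) pi)) =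
      ?s * integral {exp (- real n)..exp (real n)} ?f" for n
  proof -
    have "((\<lambda>t. Im (?P (Complex (ln t) pi))) has_vector_derivative ?s * ?f t)
        (at t within {exp (- real n)..exp (real n)})"
      if "t \<in> {exp (- real n)..exp (real n)}" for t
    proof -
      have "0 < t" using that by (metis atLeastAtMost_iff exp_gt_zero less_le_trans)
      have "((\<lambda>x. Complex (ln x) pi) has_vector_derivative of_real (1 / t)) (at t)"
        unfolding Complex_eq using \<open>0 < t\<close>
        by (auto intro!: derivative_eq_intros has_vector_derivative_of_real
            simp: has_real_derivative_iff_has_vector_derivative[symmetric])
      from field_vector_diff_chain_at[OF this hankel_prim_deriv[of \<beta>]]
      have "((\<lambda>x. ?P (Complex (ln x) pi)) has_vector_derivative
          of_real (1 / t) * hankel_fun \<beta> (Complex (ln t) pi)) (at t)"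
        by (simp add: o_def)
      from has_field_derivative_Im[OF this]
      have "((\<lambda>x. Im (?P (Complex (ln x) pi))) has_real_derivative
          Im (of_real (1 / t) * hankel_fun \<beta> (Complex (ln t) pi))) (at t)" .
      moreover have "Im (of_real (1 / t) * hankel_fun \<beta> (Complex (ln t) pi)) = ?s * ?f t"
      proof -
        have "exp (Complex (ln t) pi) = - of_real t"
          using \<open>0 < t\<close> by (simp add: exp_eq_polar complex_eq_iff)
        then have "Im (hankel_fun \<beta> (Complex (ln t) pi)) = exp (- t + (1 - \<beta>) * ln t) * ?s"
          by (simp add: hankel_fun_def Im_exp)
        also have "exp (- t + (1 - \<beta>) * ln t) = t * ?f t"
          using \<open>0 < t\<close> by (simp add: powr_def exp_add exp_minus exp_diff field_simps)
        finally show ?thesis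
          using \<open>0 < t\<close> by (simp add: Im_divide_of_real)
      qed
      ultimately show ?thesis
        by (simp add: has_real_derivative_iff_has_vector_derivative has_vector_derivative_at_within)
    qed
    then have "((\<lambda>t. ?s * ?f t) has_integral
        (Im (?P (Complex (ln (exp (real n))) pi)) - Im (?P (Complex (ln (exp (- real n))) pi))))
        {exp (- real n)..exp (real n)}"
      by (intro fundamental_theorem_of_calculus) auto
    then have "Im (?P (Complex (real n) pi)) - Im (?P (Complex (- real n) pi)) =
        integral {exp (- real n)..exp (real n)} (\<lambda>t. ?s * ?f t)"
      by (simp add: integral_unique)
    also have "\<dots> = ?s * integral {exp (- real n)..exp (real n)} ?f"
      by (rule integral_mult_right)
    finally show ?thesis by simp
  qed
  \<comment> \<open>The left vertical edge, the image of a half circle about 0 with radius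
    \<open>exp (- n)\<close>. Its bound tends to 0 exactly because \<beta> < 1.\<close>
  have left: "(\<lambda>n. ?P (Complex (- real n) pi) - ?P (Complex (- real n) 0)) \<longlonglongrightarrow> 0"
  proof (rule Lim_null_comparison)
    show "\<forall>\<^sub>F n in sequentially. cmod (?P (Complex (- real n) pi) - ?P (Complex (- real n) 0))
        \<le> exp (1 - (1 - \<beta>) * real n) * (pi - 0)"
    proof (intro always_eventually allI vertical_increment_bound)
      fix n :: nat and y :: real
      have "exp (- real n) * cos y \<le> exp (- real n) * 1"
        by (intro mult_left_mono) auto
      also have "\<dots> \<le> 1" by simp
      finally have "exp (- real n) * cos y \<le> 1" .
      then show "cmod (hankel_fun \<beta> (Complex (- real n) y)) \<le> exp (1 - (1 - \<beta>) * real n)"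
        by (simp add: norm_hankel_fun)
    qed (auto intro: hankel_prim_deriv)
    show "(\<lambda>n. exp (1 - (1 - \<beta>) * real n) * (pi - 0)) \<longlonglongrightarrow> 0"
      using assms by real_asymp
  qed
  have "(\<lambda>n. ?s * integral {exp (- real n)..exp (real n)} ?f
      + Im (?P (Complex (- real n) pi) - ?P (Complex (- real n) 0))) \<longlonglongrightarrow> ?s * Gamma (1 - \<beta>) + Im 0"
    using assms by (intro tendsto_intros Gamma_truncated_tendsto left) auto
  also have "(\<lambda>n. ?s * integral {exp (- real n)..exp (real n)} ?f
      + Im (?P (Complex (- real n) pi) - ?P (Complex (- real n) 0))) =
      (\<lambda>n. Im (?P (Complex (real n) pi) - ?P (Complex 0 0)))"
    unfolding top[symmetric] using hankel_prim_real[of \<beta> _ 0] by auto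
  also have "?s * Gamma (1 - \<beta>) + Im 0 = pi / Gamma \<beta>"
  proof -
    have "complex_of_real (Gamma \<beta> * Gamma (1 - \<beta>)) = complex_of_real (pi / sin (pi * \<beta>))"
      using Gamma_reflection_complex[of "of_real \<beta>"]
      by (simp add: Gamma_complex_of_real[symmetric] sin_of_real[symmetric])
    then have "Gamma \<beta> * Gamma (1 - \<beta>) = pi / sin (pi * \<beta>)"
      by (simp only: of_real_eq_iff)
    moreover have "?s = sin (pi * \<beta>)"
      using sin_pi_minus[of "pi * \<beta>"] by (simp add: algebra_simps)
    moreover have "0 < sin (pi * \<beta>)"
      using assms by (intro sin_gt_zero) auto
    moreover have "0 < Gamma \<beta>"
      using assms by (intro Gamma_real_pos)
    ultimately show ?thesis
      by (simp add: field_simps)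
  qed
  finally show ?thesis .
qed


lemma norm_exp_minus_1_le:
  fixes w :: complex
  assumes "cmod w \<le> 1"
  shows "cmod (exp w - 1) \<le> exp 1 * cmod w"
proof -
  have "cmod (exp w - exp 0) \<le> exp 1 * cmod (w - 0)"
  proof (rule field_differentiable_bound[of "cball 0 1"])
    fix z :: complex assume z: "z \<in> cball 0 1"
    show "(exp has_field_derivative exp z) (at z within cball 0 1)"
      by (intro derivative_eq_intros) auto
    have "Re z \<le> cmod z" by (rule complex_Re_le_cmod)
    then show "cmod (exp z) \<le> exp 1"
      using z by simp
  qed (use assms in auto)
  then show ?thesis by simp
qed

text \<open>The integrand is real on both horizontal lines, so the value does not depend on
  \<open>a\<close>. At the left end it tends to 1 instead of 0, and the vertical edge of length pi
  contributes half a residue.\<close>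

lemma hankel_limit_1:
  "Im (hankel_prim 1 (Complex a pi) - hankel_prim 1 (Complex 0 0)) = pi"
proof -
  let ?P = "hankel_prim 1"
  have top: "Im (?P (Complex a pi)) = Im (?P (Complex (- real n) pi))" for n
  proof (rule horizontal_Im_const)
    fix x
    show "Im (hankel_fun 1 (Complex x pi)) = 0"
      by (simp add: hankel_fun_def Im_exp)
  qed (rule hankel_prim_deriv)
  \<comment> \<open>Subtracting \<open>z\<close> removes the limit 1 of the integrand; the increment
    of \<open>z\<close> along the edge is the imaginary part pi.\<close>
  define R where "R z = ?P z - z" for z
  have R: "(R has_field_derivative hankel_fun 1 z - 1) (at z)" for z
    unfolding R_def by (auto intro!: derivative_eq_intros hankel_prim_deriv)
  have "(\<lambda>n. R (Complex (- real n) pi) - R (Complex (- real n) 0)) \<longlonglongrightarrow> 0"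
  proof (rule Lim_null_comparison)
    show "\<forall>\<^sub>F n in sequentially. cmod (R (Complex (- real n) pi) - R (Complex (- real n) 0))
        \<le> exp 1 * exp (- real n) * (pi - 0)"
    proof (intro always_eventually allI vertical_increment_bound[where G = "\<lambda>z. hankel_fun 1 z - 1"] R)
      fix n :: nat and y :: real
      show "cmod (hankel_fun 1 (Complex (- real n) y) - 1) \<le> exp 1 * exp (- real n)"
        using norm_exp_minus_1_le[of "exp (Complex (- real n) y)"] by (simp add: hankel_fun_def)
    qed auto
    show "(\<lambda>n. exp 1 * exp (- real n) * (pi - 0)) \<longlonglongrightarrow> 0"
      by real_asymp
  qed
  then have "(\<lambda>n. Im (R (Complex (- real n) pi) - R (Complex (- real n) 0)) + pi) \<longlonglongrightarrow> Im 0 + pi"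
    by (intro tendsto_intros)
  moreover have "Im (R (Complex (- real n) pi) - R (Complex (- real n) 0)) + pi =
      Im (?P (Complex a pi) - ?P (Complex 0 0))" for n
    using top[of n] hankel_prim_real[of 1 "- real n" 0] by (simp add: R_def)
  ultimately show ?thesis
    by (simp add: LIMSEQ_const_iff)
qed

text \<open>Integration by parts: \<open>D\<close> has derivative
  \<open>hankel_fun \<beta> z - \<beta> * hankel_fun (\<beta> + 1) z\<close>, is real at 0 and
  vanishes at the far end. Dividing by \<beta> mirrors
  \<open>Gamma (\<beta> + 1) = \<beta> * Gamma \<beta>\<close>.\<close>

lemma hankel_limit_Suc:
  assumes "0 < \<beta>"
    and lim: "(\<lambda>n. Im (hankel_prim \<beta> (Complex (real n) pi) - hankel_prim \<beta> (Complex 0 0))) \<longlonglongrightarrow> pi / Gamma \<beta>"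
  shows "(\<lambda>n. Im (hankel_prim (\<beta> + 1) (Complex (real n) pi) - hankel_prim (\<beta> + 1) (Complex 0 0)))
    \<longlonglongrightarrow> pi / Gamma (\<beta> + 1)"
proof -
  define D where "D z = exp (exp z - of_real \<beta> * z)" for z :: complex
  have "((\<lambda>z. hankel_prim \<beta> z - of_real \<beta> * hankel_prim (\<beta> + 1) z - D z) has_field_derivative 0) (at z)" for z
  proof -
    have "(D has_field_derivative (exp z - of_real \<beta>) * D z) (at z)"
      unfolding D_def by (auto intro!: derivative_eq_intros)
    moreover have "hankel_fun \<beta> z - of_real \<beta> * hankel_fun (\<beta> + 1) z = (exp z - of_real \<beta>) * D z"
      by (simp add: hankel_fun_def D_def exp_add exp_diff exp_minus field_simps)
    moreover have "((\<lambda>z. hankel_prim \<beta> z - of_real \<beta> * hankel_prim (\<beta> + 1) z - D z) has_field_derivative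
        hankel_fun \<beta> z - of_real \<beta> * hankel_fun (\<beta> + 1) z - (exp z - of_real \<beta>) * D z) (at z)"
      by (intro DERIV_diff DERIV_cmult hankel_prim_deriv calculation(1))
    ultimately show ?thesis by simp
  qed
  then obtain c where c: "hankel_prim \<beta> z - of_real \<beta> * hankel_prim (\<beta> + 1) z - D z = c" for z
    using has_field_derivative_zero_constant[OF convex_UNIV,
        of "\<lambda>z. hankel_prim \<beta> z - of_real \<beta> * hankel_prim (\<beta> + 1) z - D z"] by auto
  have D0: "(\<lambda>n. D (Complex (real n) pi)) \<longlonglongrightarrow> 0"
  proof (rule Lim_null_comparison)
    show "\<forall>\<^sub>F n in sequentially. cmod (D (Complex (real n) pi)) \<le> exp ((- \<beta>) * real n - 1 * exp (real n))"
      by (simp add: D_def Re_exp)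
    show "(\<lambda>n. exp ((- \<beta>) * real n - 1 * exp (real n))) \<longlonglongrightarrow> 0"
      by (rule exp_decay_tendsto) simp
  qed
  have eq: "Im (hankel_prim (\<beta> + 1) (Complex (real n) pi) - hankel_prim (\<beta> + 1) (Complex 0 0)) =
      (Im (hankel_prim \<beta> (Complex (real n) pi) - hankel_prim \<beta> (Complex 0 0)) - Im (D (Complex (real n) pi))) / \<beta>"
    for n
  proof -
    have "Im (D (Complex 0 0)) = 0" by (simp add: D_def Im_exp)
    then show ?thesis
      using arg_cong[OF c[of "Complex (real n) pi"], of Im] arg_cong[OF c[of "Complex 0 0"], of Im] assms(1)
      by (simp add: field_simps)
  qed
  have "(\<lambda>n. (Im (hankel_prim \<beta> (Complex (real n) pi) - hankel_prim \<beta> (Complex 0 0)) - Im (D (Complex (real n) pi))) / \<beta>)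
      \<longlonglongrightarrow> (pi / Gamma \<beta> - Im 0) / \<beta>"
    using assms by (intro tendsto_intros D0) auto
  also have "(pi / Gamma \<beta> - Im 0) / \<beta> = pi / Gamma (\<beta> + 1)"
  proof -
    have "\<beta> \<notin> \<int>\<^sub>\<le>\<^sub>0" using assms by (auto elim!: nonpos_Ints_cases)
    then show ?thesis using Gamma_plus1[of \<beta>] by (simp add: field_simps)
  qed
  finally show ?thesis
    unfolding eq .
qed

lemma hankel_limit_pi:
  assumes "0 < \<beta>"
  shows "(\<lambda>n. Im (hankel_prim \<beta> (Complex (real n) pi) - hankel_prim \<beta> (Complex 0 0))) \<longlonglongrightarrow> pi / Gamma \<beta>"
proof -
  have "(\<lambda>n. Im (hankel_prim (b + real k) (Complex (real n) pi) - hankel_prim (b + real k) (Complex 0 0)))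
      \<longlonglongrightarrow> pi / Gamma (b + real k)" if "0 < b" "b \<le> 1" for b k
  proof (induction k)
    case 0
    show ?case
    proof (cases "b = 1")
      case True
      show ?thesis
        unfolding True of_nat_0 add_0_right hankel_limit_1 by simp
    next
      case False
      with that have "b < 1" by simp
      from hankel_limit_less_1[OF that(1) this] show ?thesis
        by (simp only: of_nat_0 add_0_right)
    qed
  next
    case (Suc k)
    then show ?case
      using hankel_limit_Suc[of "b + real k"] that by (simp only: of_nat_Suc add_ac)
  qed
  note * = this
  \<comment> \<open>Ceiling minus one, not the floor, keeps the fractional part positive when
    \<beta> is an integer; it then equals 1, the second base case.\<close>
  define k where "k = nat (\<lceil>\<beta>\<rceil> - 1)"
  have "1 \<le> \<lceil>\<beta>\<rceil>" using assms by linarith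
  then have "real k = of_int \<lceil>\<beta>\<rceil> - 1"
    unfolding k_def by simp
  then have "0 < \<beta> - real k" "\<beta> - real k \<le> 1"
    by linarith+
  from *[OF this, of k] show ?thesis by (simp only: diff_add_cancel)
qed

lemma hankel_limit:
  assumes "0 < \<beta>" "pi / 2 < \<psi>" "\<psi> < pi"
  shows "(\<lambda>n. Im (hankel_prim \<beta> (Complex (real n) \<psi>) - hankel_prim \<beta> (Complex a 0))) \<longlonglongrightarrow> pi / Gamma \<beta>"
proof -
  have "(\<lambda>n. Im (hankel_prim \<beta> (Complex (real n) \<psi>) - hankel_prim \<beta> (Complex (real n) pi))
      + Im (hankel_prim \<beta> (Complex (real n) pi) - hankel_prim \<beta> (Complex 0 0))) \<longlonglongrightarrow> Im 0 + pi / Gamma \<beta>"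
    by (intro tendsto_add tendsto_Im hankel_shift hankel_limit_pi assms)
  then show ?thesis
    using hankel_prim_real[of \<beta> a 0] by simp
qed

text \<open>
  The sums converge because all of them stay close to one limit point of the bounded sequence \<open>Y\<close>.
\<close>

lemma sums_of_uniform_approximation:
  fixes X :: "nat \<Rightarrow> nat \<Rightarrow> real"
  assumes X: "\<And>j. (\<lambda>n. X j n) \<longlonglongrightarrow> x j"
    and Y: "\<And>n. \<bar>Y n\<bar> \<le> B"
    and le: "\<And>m. \<forall>\<^sub>F n in sequentially. \<bar>Y n - (\<Sum>j<m. X j n)\<bar> \<le> K * (1/2) ^ m"
  shows "\<exists>s. x sums s \<and> \<bar>s\<bar> \<le> B"
proof -
  have "bounded (range Y)"
    using Y by (auto simp: bounded_iff)
  then obtain y r where r: "strict_mono r" "(Y \<circ> r) \<longlonglongrightarrow> y"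
    using bounded_imp_convergent_subsequence by blast
  have *: "\<bar>y - (\<Sum>j<m. x j)\<bar> \<le> K * (1/2) ^ m" for m
  proof (rule tendsto_upperbound)
    show "(\<lambda>n. \<bar>(Y \<circ> r) n - (\<Sum>j<m. X j (r n))\<bar>) \<longlonglongrightarrow> \<bar>y - (\<Sum>j<m. x j)\<bar>"
      using LIMSEQ_subseq_LIMSEQ[OF X r(1)] r(2) by (intro tendsto_intros) (auto simp: o_def)
    show "\<forall>\<^sub>F n in sequentially. \<bar>(Y \<circ> r) n - (\<Sum>j<m. X j (r n))\<bar> \<le> K * (1/2) ^ m"
      using eventually_subseq[OF r(1) le[of m]] by simp
  qed simp
  have "(\<lambda>m. y - (\<Sum>j<m. x j)) \<longlonglongrightarrow> 0"
  proof (rule Lim_null_comparison)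
    show "\<forall>\<^sub>F m in sequentially. norm (y - (\<Sum>j<m. x j)) \<le> K * (1/2) ^ m"
      using * by simp
    show "(\<lambda>m. K * (1/2) ^ m) \<longlonglongrightarrow> 0" by real_asymp
  qed
  then have "(\<lambda>m. y - (y - (\<Sum>j<m. x j))) \<longlonglongrightarrow> y - 0"
    by (intro tendsto_intros)
  then have "x sums y"
    by (simp add: sums_def)
  moreover have "\<bar>y\<bar> \<le> B"
    by (rule tendsto_upperbound[OF tendsto_rabs[OF r(2)]]) (use Y in auto)
  ultimately show ?thesis by blast
qed


section \<open>Decay of the Mittag-Leffler function on the negative axis\<close>

text \<open>Cubing y <= exp y at y = k exp x / 3 gives
  \<open>exp (- k * exp x) \<le> (3 / k)^3 * exp (- 3 * x)\<close>. The power 3 is enough because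
  \<open>\<theta> - 3 \<le> - 1\<close>.\<close>

lemma exp_power_le_exp_neg:
  fixes k \<theta> x :: real
  assumes "0 < k" "\<theta> < 2" "0 \<le> x"
  shows "exp (- k * exp x) * exp (\<theta> * x) \<le> (3 / k) ^ 3 * exp (- x)"
proof -
  have "k * exp x / 3 \<le> exp (k * exp x / 3)"
    using exp_ge_add_one_self[of "k * exp x / 3"] by linarith
  then have "(k * exp x / 3) ^ 3 \<le> exp (k * exp x / 3) ^ 3"
    using assms by (intro power_mono) auto
  also have "\<dots> = exp (k * exp x)"
    by (simp flip: exp_of_nat_mult)
  finally have "exp (- k * exp x) \<le> (3 / k) ^ 3 * exp (- 3 * x)"
    using assms by (simp add: exp_minus power_divide power_mult_distrib field_simps flip: exp_of_nat_mult)
  then have "exp (- k * exp x) * exp (\<theta> * x) \<le> ((3 / k) ^ 3 * exp (- 3 * x)) * exp (\<theta> * x)"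
    by (intro mult_right_mono) auto
  also have "\<dots> = (3 / k) ^ 3 * exp ((\<theta> - 3) * x)"
    by (simp add: exp_add[symmetric] algebra_simps)
  also have "\<dots> \<le> (3 / k) ^ 3 * exp (- x)"
    using assms mult_right_mono[of \<theta> 2 x] by (intro mult_left_mono) (auto simp: algebra_simps)
  finally show ?thesis .
qed

text \<open>The squared modulus is \<open>\<rho>^2 + 2 * \<rho> * l * cos v + l^2\<close>, and
  \<open>cos v \<ge> - k\<close> together with \<open>2 * \<rho> * l \<le> \<rho>^2 + l^2\<close>
  bounds it below by \<open>(1 - k) * (\<rho>^2 + l^2)\<close>. The angle stays away from pi, hence
  \<open>k < 1\<close>.\<close>

lemma norm_add_ge_sector:
  fixes \<rho> l v \<alpha> :: real
  assumes "0 \<le> v" "v \<le> \<alpha>" "\<alpha> < pi" "0 \<le> \<rho>" "0 < l" and k: "k = max 0 (- cos \<alpha>)"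
  shows "sqrt (1 - k) * l \<le> cmod (of_real \<rho> * cis v + of_real l)"
    and "sqrt (1 - k) * \<rho> \<le> cmod (of_real \<rho> * cis v + of_real l)"
    and "0 < sqrt (1 - k)"
proof -
  have "cos pi < cos \<alpha>"
    using assms by (intro cos_monotone_0_pi) auto
  then have k1: "k < 1" "0 \<le> k" using k by auto
  then show "0 < sqrt (1 - k)" by simp
  have "cos \<alpha> \<le> cos v"
    using assms by (intro cos_monotone_0_pi_le) auto
  then have "- k \<le> cos v" using k by auto
  then have "2 * \<rho> * l * (- k) \<le> 2 * \<rho> * l * cos v"
    using assms by (intro mult_left_mono) auto
  moreover have "k * (2 * \<rho> * l) \<le> k * (\<rho>\<^sup>2 + l\<^sup>2)"
    using k1 by (intro mult_left_mono) (auto simp: sum_squares_bound)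
  moreover have "(cmod (of_real \<rho> * cis v + of_real l))\<^sup>2 = \<rho>\<^sup>2 + 2 * \<rho> * l * cos v + l\<^sup>2"
  proof -
    have "(cmod (of_real \<rho> * cis v + of_real l))\<^sup>2 = (\<rho> * cos v + l)\<^sup>2 + (\<rho> * sin v)\<^sup>2"
      by (simp add: cmod_power2)
    also have "\<dots> = \<rho>\<^sup>2 * ((sin v)\<^sup>2 + (cos v)\<^sup>2) + 2 * \<rho> * l * cos v + l\<^sup>2"
      by (simp only: power_mult_distrib power2_sum distrib_left) simp
    finally show ?thesis by simp
  qed
  ultimately have ge: "(1 - k) * (\<rho>\<^sup>2 + l\<^sup>2) \<le> (cmod (of_real \<rho> * cis v + of_real l))\<^sup>2"
    by (simp add: algebra_simps)
  have sq: "(sqrt (1 - k) * l)\<^sup>2 \<le> (1 - k) * (\<rho>\<^sup>2 + l\<^sup>2)" "(sqrt (1 - k) * \<rho>)\<^sup>2 \<le> (1 - k) * (\<rho>\<^sup>2 + l\<^sup>2)"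
    using k1 by (simp_all add: power_mult_distrib)
  show "sqrt (1 - k) * l \<le> cmod (of_real \<rho> * cis v + of_real l)"
    by (rule power2_le_imp_le[OF order_trans[OF sq(1) ge]]) simp
  show "sqrt (1 - k) * \<rho> \<le> cmod (of_real \<rho> * cis v + of_real l)"
    by (rule power2_le_imp_le[OF order_trans[OF sq(2) ge]]) simp
qed

text \<open>
  The transform \<open>s\<^bsup>\<theta>-1\<^esup> / (s\<^sup>\<theta> + \<lambda>)\<close> has no singularity with \<open>\<bar>arg s\<bar> < \<pi> / \<theta>\<close>. As
  \<open>\<pi> / \<theta> > \<pi> / 2\<close>, the contour fits into the sector of decay of \<open>e\<^sup>s\<close> and can be pulled into \<open>0\<close>.
\<close>

lemma mittag_leffler_decay:
  fixes \<theta> :: real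
  assumes \<theta>: "0 < \<theta>" "\<theta> < 2"
  shows "\<exists>C. \<forall>l>0. \<exists>E. (\<lambda>j. (- l) ^ j / Gamma (\<theta> * real j + 1)) sums E \<and> \<bar>E\<bar> \<le> C / l"
proof -
  have "pi / 2 < min pi (pi / \<theta>)"
    using \<theta> by (simp add: field_simps)
  \<comment> \<open>Beyond pi/2 the exponential decays along the ray, below pi/\<theta> the
    denominator has no zero, and below pi the ray is admissible in
    \<open>hankel_limit\<close>.\<close>
  then obtain \<psi> where \<psi>: "pi / 2 < \<psi>" "\<psi> < pi" "\<psi> < pi / \<theta>"
    using dense by (metis min_less_iff_conj)
  then have \<psi>0: "0 < \<psi>" using pi_gt_zero by linarith
  have \<theta>\<psi>: "\<theta> * \<psi> < pi" using \<psi> \<theta> by (simp add: field_simps)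
  define \<kappa> where "\<kappa> = - cos \<psi>"
  have \<kappa>: "0 < \<kappa>"
    using \<psi> cos_monotone_0_pi[of "pi/2" \<psi>] by (simp add: \<kappa>_def)
  define c where "c = sqrt (1 - max 0 (- cos (\<theta> * \<psi>)))"
  have c: "0 < c"
    using norm_add_ge_sector(3)[of 0 "\<theta> * \<psi>" 0 1] \<theta> \<psi>0 \<theta>\<psi> by (simp add: c_def)
  define D where "D = (3 / \<kappa>) ^ 3"
  have D: "0 < D" using \<kappa> by (simp add: D_def)
  \<comment> \<open>The sector of holomorphy, which is a strip in the logarithmic variable: convex,
    so that \<open>F\<close> has a primitive there.\<close>
  define S where "S = {z. - (pi / \<theta>) < Im z \<and> Im z < pi / \<theta>}"
  have openS: "open S"
    unfolding S_def by (intro open_Collect_conj open_Collect_less continuous_intros)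
  have convS: "convex S"
    unfolding S_def Collect_conj_eq
    by (intro convex_Int) (auto simp: convex_halfspace_Im_gt convex_halfspace_Im_lt)
  have inS: "Complex x v \<in> S" if "0 \<le> v" "v \<le> \<psi>" for x v
    using that \<psi> \<theta> by (auto simp: S_def intro: order_less_le_trans[of _ 0])
  show ?thesis
  \<comment> \<open>On the ray, \<open>1 / \<theta>\<close> is the contribution of abscissas below 0
    and \<open>D\<close> that of abscissas above 0; \<open>c\<close> comes from the sector bound and
    pi from the normalization of Hankel's integral.\<close>
  proof (rule exI[of _ "(1 / \<theta> + D) / (c * pi)"], intro allI impI)
    fix l :: real assume l: "0 < l"
    \<comment> \<open>The integrand of the inverse Laplace transform at time 1, with the factor s of
      ds = s dz absorbed.\<close>
    define F where "F z = exp (exp z) * exp (of_real \<theta> * z) / (exp (of_real \<theta> * z) + of_real l)" for z :: complex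
    have nz: "exp (of_real \<theta> * z) + of_real l \<noteq> 0" if "z \<in> S" for z
    proof
      assume 0: "exp (of_real \<theta> * z) + of_real l = 0"
      then have "Im (exp (of_real \<theta> * z)) = 0"
        by (metis Im_complex_of_real add_0_right plus_complex.simps(2) zero_complex.simps(2))
      then have "sin (\<theta> * Im z) = 0" by (simp add: Im_exp)
      moreover have "- pi < \<theta> * Im z" "\<theta> * Im z < pi"
        using that \<theta> by (auto simp: S_def field_simps)
      ultimately have "\<theta> * Im z = 0"
        using sin_eq_0_pi by blast
      then have "exp (of_real \<theta> * z) = of_real (exp (\<theta> * Re z))"
        by (simp only: exp_eq_polar times_complex.simps Re_complex_of_real Im_complex_of_real
            mult_zero_left add_0_right diff_zero cis_zero mult_1_right exp_of_real)
      then have "of_real (exp (\<theta> * Re z) + l) = (0 :: complex)"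
        using 0 by simp
      then have "exp (\<theta> * Re z) + l = 0"
        by (simp only: of_real_eq_0_iff)
      then show False
        using l exp_gt_zero[of "\<theta> * Re z"] by linarith
    qed
    have "F holomorphic_on S"
      unfolding F_def using nz by (intro holomorphic_intros) auto
    then obtain Q where Q: "(Q has_field_derivative F z) (at z)" if "z \<in> S" for z
      using holomorphic_convex_primitive'[OF convS openS] openS by (metis at_within_open)
    \<comment> \<open>The first bound carries \<open>1 / l\<close> and decays to the left, as needed
      for the contour through the origin. The second has no factor \<open>1 / l\<close> and serves
      for the remainder of the series.\<close>
    have Fnorm: "cmod (F (Complex x v)) \<le> exp (exp x * cos v) * exp (\<theta> * x) / (c * l)"
      "cmod (F (Complex x v)) \<le> exp (exp x * cos v) / c"
      if v: "0 \<le> v" "v \<le> \<psi>" for x v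
    proof -
      have e: "exp (of_real \<theta> * Complex x v) = of_real (exp (\<theta> * x)) * cis (\<theta> * v)"
        by (simp add: exp_eq_polar)
      have "0 \<le> \<theta> * v" "\<theta> * v \<le> \<theta> * \<psi>"
        using v \<theta> by auto
      note b = norm_add_ge_sector[OF this \<theta>\<psi> _ l refl, of "exp (\<theta> * x)", folded c_def e]
      have F: "cmod (F (Complex x v)) =
          exp (exp x * cos v) * exp (\<theta> * x) / cmod (exp (of_real \<theta> * Complex x v) + of_real l)"
        by (simp add: F_def norm_mult norm_divide Re_exp)
      show "cmod (F (Complex x v)) \<le> exp (exp x * cos v) * exp (\<theta> * x) / (c * l)"
        unfolding F using b(1) c l by (intro divide_left_mono) (auto intro!: mult_pos_pos elim: order_less_le_trans[rotated])
      have "cmod (F (Complex x v)) \<le> exp (exp x * cos v) * exp (\<theta> * x) / (c * exp (\<theta> * x))"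
        unfolding F using b(2) c by (intro divide_left_mono) (auto intro!: mult_pos_pos elim: order_less_le_trans[rotated])
      then show "cmod (F (Complex x v)) \<le> exp (exp x * cos v) / c" by simp
    qed
    have Fray: "exp (exp x * cos \<psi>) = exp (- \<kappa> * exp x)" for x
      by (simp add: \<kappa>_def mult.commute)
    have Freal: "Im (F (Complex x 0)) = 0" for x
    proof -
      have "Complex x 0 = of_real x" by (simp add: complex_eq_iff)
      then have "F (Complex x 0) = of_real (exp (exp x) * exp (\<theta> * x) / (exp (\<theta> * x) + l))"
        by (simp add: F_def exp_of_real flip: of_real_mult)
      then show ?thesis by simp
    qed
    have Qreal: "Im (Q (Complex a 0)) = Im (Q (Complex b 0))" for a b
      by (rule horizontal_Im_const[of _ F]) (use Q inS \<psi>0 Freal in auto)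
    \<comment> \<open>From abscissa \<open>a\<close> on, the ratio
      \<open>- l * exp (- \<theta> * z)\<close> of the geometric expansion of \<open>F\<close> has
      modulus at most 1/2.\<close>
    define a where "a = max 0 (ln (2 * l) / \<theta>)"
    have a: "0 \<le> a" "l * exp (- \<theta> * x) \<le> 1 / 2" if "a \<le> x" for x
    proof -
      show "0 \<le> a" by (simp add: a_def)
      have "ln (2 * l) / \<theta> \<le> x" using that by (simp add: a_def)
      then have "ln (2 * l) \<le> \<theta> * x" using \<theta> by (simp add: field_simps)
      then have "2 * l \<le> exp (\<theta> * x)" using l exp_le_cancel_iff[of "ln (2 * l)" "\<theta> * x"] by simp
      then show "l * exp (- \<theta> * x) \<le> 1 / 2" by (simp add: exp_minus field_simps)
    qed
    show "\<exists>E. (\<lambda>j. (- l) ^ j / Gamma (\<theta> * real j + 1)) sums E \<and> \<bar>E\<bar> \<le> (1 / \<theta> + D) / (c * pi) / l"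
    proof (rule sums_of_uniform_approximation)
      define H where "H j = hankel_prim (\<theta> * real j + 1)" for j
      \<comment> \<open>\<open>X j\<close> are the truncated Hankel integrals of the terms of that
        expansion, and \<open>Y\<close> are those of \<open>F\<close> itself.\<close>
      define X where "X j n = (- l) ^ j * Im (H j (Complex (real n) \<psi>) - H j (Complex a 0)) / pi" for j n
      define Y where "Y n = Im (Q (Complex (real n) \<psi>) - Q (Complex a 0)) / pi" for n
      define K where "K = (1 / (c * \<kappa>) + exp (exp a) / c * \<psi>) / pi"
      show "(\<lambda>n. X j n) \<longlonglongrightarrow> (- l) ^ j / Gamma (\<theta> * real j + 1)" for j
      proof -
        have "(\<lambda>n. (- l) ^ j * Im (H j (Complex (real n) \<psi>) - H j (Complex a 0)) / pi) \<longlonglongrightarrow>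
            (- l) ^ j * (pi / Gamma (\<theta> * real j + 1)) / pi"
          unfolding H_def by (intro tendsto_intros hankel_limit) (use \<theta> \<psi> in \<open>auto intro: add_nonneg_pos\<close>)
        then show ?thesis by (simp add: X_def)
      qed
      \<comment> \<open>Path: inward along the ray to abscissa \<open>- m\<close>, down to the real
        axis, and back along it at no cost. Letting \<open>m\<close> grow removes the short vertical
        edge.\<close>
      show "\<bar>Y n\<bar> \<le> (1 / \<theta> + D) / (c * pi) / l" for n
      proof -
        have 1: "cmod (Q (Complex (real n) \<psi>) - Q (Complex 0 \<psi>)) \<le> - D / (c * l) * exp (- real n) - (- D / (c * l) * exp (- 0))"
        proof (rule horizontal_increment_bound[where G = F])
          fix x :: real assume x: "0 \<le> x" "x \<le> real n"
          show "(Q has_field_derivative F (Complex x \<psi>)) (at (Complex x \<psi>))"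
            using Q inS \<psi>0 by auto
          show "((\<lambda>x. - D / (c * l) * exp (- x)) has_real_derivative D * exp (- x) / (c * l)) (at x)"
            using c l by (auto intro!: derivative_eq_intros)
          have "cmod (F (Complex x \<psi>)) \<le> exp (- \<kappa> * exp x) * exp (\<theta> * x) / (c * l)"
            using Fnorm(1)[of \<psi> x] \<psi>0 unfolding Fray by simp
          also have "\<dots> \<le> D * exp (- x) / (c * l)"
            unfolding D_def using exp_power_le_exp_neg[OF \<kappa> \<theta>(2) x(1)] c l by (intro divide_right_mono) auto
          finally show "cmod (F (Complex x \<psi>)) \<le> D * exp (- x) / (c * l)" .
        qed simp
        also have "\<dots> \<le> D / (c * l)"
          using D c l by (simp add: field_simps)
        finally have 1: "cmod (Q (Complex (real n) \<psi>) - Q (Complex 0 \<psi>)) \<le> D / (c * l)" .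
        have 2: "cmod (Q (Complex 0 \<psi>) - Q (Complex (- real m) \<psi>)) \<le> 1 / \<theta> / (c * l)" for m
        proof -
          have "cmod (Q (Complex 0 \<psi>) - Q (Complex (- real m) \<psi>)) \<le>
              exp (\<theta> * 0) / \<theta> / (c * l) - exp (\<theta> * (- real m)) / \<theta> / (c * l)"
          proof (rule horizontal_increment_bound[where G = F])
            fix x :: real assume x: "- real m \<le> x" "x \<le> 0"
            show "(Q has_field_derivative F (Complex x \<psi>)) (at (Complex x \<psi>))"
              using Q inS \<psi>0 by auto
            show "((\<lambda>x. exp (\<theta> * x) / \<theta> / (c * l)) has_real_derivative exp (\<theta> * x) / (c * l)) (at x)"
              using \<theta> c l by (auto intro!: derivative_eq_intros)
            have "cmod (F (Complex x \<psi>)) \<le> exp (- \<kappa> * exp x) * exp (\<theta> * x) / (c * l)"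
              using Fnorm(1)[of \<psi> x] \<psi>0 unfolding Fray by simp
            also have "\<dots> \<le> 1 * exp (\<theta> * x) / (c * l)"
              using \<kappa> c l by (intro divide_right_mono mult_right_mono) auto
            finally show "cmod (F (Complex x \<psi>)) \<le> exp (\<theta> * x) / (c * l)" by simp
          qed simp
          also have "\<dots> \<le> 1 / \<theta> / (c * l)"
            using \<theta> c l by simp
          finally show ?thesis .
        qed
        have 3: "(\<lambda>m. Q (Complex (- real m) \<psi>) - Q (Complex (- real m) 0)) \<longlonglongrightarrow> 0"
        proof (rule Lim_null_comparison)
          show "\<forall>\<^sub>F m in sequentially. cmod (Q (Complex (- real m) \<psi>) - Q (Complex (- real m) 0))
              \<le> exp 1 * exp (- (\<theta> * real m)) / (c * l) * (\<psi> - 0)"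
          proof (intro always_eventually allI vertical_increment_bound[where G = F])
            fix m :: nat and y :: real assume y: "0 \<le> y" "y \<le> \<psi>"
            show "(Q has_field_derivative F (Complex (- real m) y)) (at (Complex (- real m) y))"
              using Q inS y by auto
            have "exp (- real m) * cos y \<le> exp (- real m) * 1"
              by (intro mult_left_mono) auto
            also have "\<dots> \<le> 1" by simp
            finally have *: "exp (- real m) * cos y \<le> 1" .
            have "cmod (F (Complex (- real m) y)) \<le> exp (exp (- real m) * cos y) * exp (\<theta> * (- real m)) / (c * l)"
              by (rule Fnorm(1)[OF y])
            also have "\<dots> \<le> exp 1 * exp (\<theta> * (- real m)) / (c * l)"
              using * c l by (intro divide_right_mono mult_right_mono) auto
            finally show "cmod (F (Complex (- real m) y)) \<le> exp 1 * exp (- (\<theta> * real m)) / (c * l)" by simp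
          qed (use \<psi>0 in auto)
          show "(\<lambda>m. exp 1 * exp (- (\<theta> * real m)) / (c * l) * (\<psi> - 0)) \<longlonglongrightarrow> 0"
          proof -
            have "(\<lambda>m. exp (- (\<theta> * real m))) \<longlonglongrightarrow> 0"
              using \<theta> by real_asymp
            from tendsto_mult_left_zero[OF this, of "exp 1 / (c * l) * \<psi>"] show ?thesis
              by (simp add: mult_ac)
          qed
        qed
        have "\<bar>Im (Q (Complex (real n) \<psi>) - Q (Complex a 0))\<bar> \<le>
            D / (c * l) + 1 / \<theta> / (c * l) + cmod (Q (Complex (- real m) \<psi>) - Q (Complex (- real m) 0))" for m
        proof -
          have "Im (Q (Complex (real n) \<psi>) - Q (Complex a 0)) =
              Im (Q (Complex (real n) \<psi>) - Q (Complex 0 \<psi>)) + Im (Q (Complex 0 \<psi>) - Q (Complex (- real m) \<psi>))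
              + Im (Q (Complex (- real m) \<psi>) - Q (Complex (- real m) 0))"
            using Qreal[of a "- real m"] by simp
          moreover note 1 2[of m]
          ultimately show ?thesis
            by (smt (verit) abs_Im_le_cmod)
        qed
        then have "\<bar>Im (Q (Complex (real n) \<psi>) - Q (Complex a 0))\<bar> \<le> D / (c * l) + 1 / \<theta> / (c * l) + 0"
          by (intro tendsto_lowerbound[OF tendsto_add[OF tendsto_const tendsto_norm_zero[OF 3]]]) auto
        also have "\<dots> = (1 / \<theta> + D) / (c * l)"
          using c l by (simp add: field_simps)
        finally show ?thesis
          using c l by (simp add: Y_def field_simps)
      qed
      show "\<forall>\<^sub>F n in sequentially. \<bar>Y n - (\<Sum>j<m. X j n)\<bar> \<le> K * (1/2) ^ m" for m
      proof -
        \<comment> \<open>A primitive of \<open>G\<close>, the remainder of the geometric sum after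
          \<open>m\<close> terms, that is, \<open>F\<close> times the \<open>m\<close>-th power of
          the ratio.\<close>
        define R where "R z = Q z - (\<Sum>j<m. of_real ((- l) ^ j) * H j z)" for z
        define G where "G z = of_real ((- l) ^ m) * exp (- of_real (\<theta> * real m) * z) * F z" for z
        have R: "(R has_field_derivative G z) (at z)" if "z \<in> S" for z
        proof -
          define q where "q = - of_real l * exp (- of_real \<theta> * z)"
          have q: "q ^ j = of_real ((- l) ^ j) * exp (- of_real (\<theta> * real j) * z)" for j
          proof -
            have "q ^ j = (- of_real l) ^ j * exp (of_nat j * (- of_real \<theta> * z))"
              unfolding q_def power_mult_distrib exp_of_nat_mult ..
            also have "of_nat j * (- of_real \<theta> * z) = - of_real (\<theta> * real j) * z"
              by simp
            finally show ?thesis by simp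
          qed
          have "1 - q = (exp (of_real \<theta> * z) + of_real l) / exp (of_real \<theta> * z)"
            by (simp add: q_def exp_minus field_simps)
          then have F: "F z = exp (exp z) / (1 - q)" and q1: "q \<noteq> 1"
            using nz[OF that] by (auto simp: F_def)
          have "of_real ((- l) ^ j) * hankel_fun (\<theta> * real j + 1) z = exp (exp z) * q ^ j" for j
            unfolding q hankel_fun_def by (simp add: exp_diff exp_minus divide_inverse)
          then have "(\<Sum>j<m. of_real ((- l) ^ j) * hankel_fun (\<theta> * real j + 1) z) = exp (exp z) * (\<Sum>j<m. q ^ j)"
            by (simp add: sum_distrib_left)
          also have "\<dots> = F z - q ^ m * F z"
            using q1 by (simp add: F sum_gp_strict diff_divide_distrib algebra_simps)
          finally have "F z - (\<Sum>j<m. of_real ((- l) ^ j) * hankel_fun (\<theta> * real j + 1) z) = G z"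
            by (simp add: G_def q)
          moreover have "(R has_field_derivative F z - (\<Sum>j<m. of_real ((- l) ^ j) * hankel_fun (\<theta> * real j + 1) z)) (at z)"
            unfolding R_def H_def
            by (intro DERIV_diff Q that DERIV_sum DERIV_cmult hankel_prim_deriv)
          ultimately show ?thesis by simp
        qed
        have Gnorm: "cmod (G (Complex x v)) \<le> (1/2) ^ m * cmod (F (Complex x v))" if "a \<le> x" for x v
        proof -
          have "cmod (of_real ((- l) ^ m) * exp (- of_real (\<theta> * real m) * Complex x v)) = (l * exp (- \<theta> * x)) ^ m"
          proof -
            have "exp (- \<theta> * x) ^ m = exp (- (\<theta> * real m) * x)"
              unfolding exp_of_nat_mult[symmetric] by (simp add: mult_ac)
            then show ?thesis
              using l by (simp add: norm_mult norm_power power_mult_distrib)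
          qed
          also have "\<dots> \<le> (1/2) ^ m"
            using a(2)[OF that] l by (intro power_mono) auto
          finally show ?thesis
            unfolding G_def norm_mult[of _ "F _"] by (intro mult_right_mono) auto
        qed
        show ?thesis
        proof (rule eventually_mono[OF eventually_ge_at_top[of "nat \<lceil>a\<rceil>"]])
          fix n assume "nat \<lceil>a\<rceil> \<le> n"
          then have an: "a \<le> real n" by linarith
          \<comment> \<open>This path, up at abscissa \<open>a\<close> and then out along the ray,
            never enters abscissas below \<open>a\<close>, so the factor \<open>(1/2) ^ m\<close>
            can be taken out everywhere.\<close>
          have "cmod (R (Complex (real n) \<psi>) - R (Complex a \<psi>)) \<le>
              - ((1/2) ^ m / (c * \<kappa>)) * exp (- \<kappa> * real n) - (- ((1/2) ^ m / (c * \<kappa>)) * exp (- \<kappa> * a))"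
          proof (rule horizontal_increment_bound[where G = G])
            fix x assume x: "a \<le> x" "x \<le> real n"
            show "(R has_field_derivative G (Complex x \<psi>)) (at (Complex x \<psi>))"
              using R inS \<psi>0 by auto
            show "((\<lambda>x. - ((1/2) ^ m / (c * \<kappa>)) * exp (- \<kappa> * x)) has_real_derivative (1/2) ^ m * (exp (- \<kappa> * x) / c)) (at x)"
              using \<kappa> c by (auto intro!: derivative_eq_intros)
            have "cmod (F (Complex x \<psi>)) \<le> exp (- \<kappa> * exp x) / c"
              using Fnorm(2)[of \<psi> x] \<psi>0 unfolding Fray by simp
            \<comment> \<open>Replacing \<open>exp x\<close> by the smaller \<open>x\<close> gives a
              majorant with an explicit antiderivative.\<close>
            also have "\<dots> \<le> exp (- \<kappa> * x) / c"
              using \<kappa> c less_imp_le[OF exp_gt_self[of x]]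
              by (intro divide_right_mono) (auto intro!: mult_left_mono)
            finally have *: "cmod (F (Complex x \<psi>)) \<le> exp (- \<kappa> * x) / c" .
            show "cmod (G (Complex x \<psi>)) \<le> (1/2) ^ m * (exp (- \<kappa> * x) / c)"
              by (rule order_trans[OF Gnorm[OF x(1)]]) (use * in \<open>intro mult_left_mono, auto\<close>)
          qed (rule an)
          also have "\<dots> \<le> (1/2) ^ m * (1 / (c * \<kappa>))"
          proof -
            have "exp (- \<kappa> * a) \<le> 1" using \<kappa> a(1)[of a] by simp
            then have "(1/2) ^ m / (c * \<kappa>) * exp (- \<kappa> * a) \<le> (1/2) ^ m / (c * \<kappa>) * 1"
              using c \<kappa> by (intro mult_left_mono) auto
            moreover have "0 \<le> (1/2) ^ m / (c * \<kappa>) * exp (- \<kappa> * real n)"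
              using c \<kappa> by auto
            ultimately show ?thesis by simp
          qed
          finally have 1: "cmod (R (Complex (real n) \<psi>) - R (Complex a \<psi>)) \<le> (1/2) ^ m * (1 / (c * \<kappa>))" .
          have 2: "cmod (R (Complex a \<psi>) - R (Complex a 0)) \<le> (1/2) ^ m * (exp (exp a) / c) * (\<psi> - 0)"
          proof (rule vertical_increment_bound[where G = G])
            fix y assume y: "0 \<le> y" "y \<le> \<psi>"
            show "(R has_field_derivative G (Complex a y)) (at (Complex a y))"
              using R inS y by auto
            have "cmod (F (Complex a y)) \<le> exp (exp a * cos y) / c"
              by (rule Fnorm(2)[OF y])
            also have "\<dots> \<le> exp (exp a) / c"
              using c by (intro divide_right_mono) (auto intro!: mult_left_le)
            finally have "cmod (F (Complex a y)) \<le> exp (exp a) / c" .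
            then show "cmod (G (Complex a y)) \<le> (1/2) ^ m * (exp (exp a) / c)"
              by (intro order_trans[OF Gnorm[OF order_refl]] mult_left_mono) auto
          qed (use \<psi>0 in simp)
          have "Y n - (\<Sum>j<m. X j n) = Im (R (Complex (real n) \<psi>) - R (Complex a 0)) / pi"
          proof -
            have "(\<Sum>j<m. X j n) = Im ((\<Sum>j<m. of_real ((- l) ^ j) * (H j (Complex (real n) \<psi>) - H j (Complex a 0)))) / pi"
              unfolding X_def sum_divide_distrib[symmetric] Im_sum by simp
            then show ?thesis
              unfolding R_def Y_def by (simp only: diff_divide_distrib[symmetric] minus_complex.simps[symmetric] right_diff_distrib sum_subtractf) (simp add: algebra_simps)
          qed
          also have "R (Complex (real n) \<psi>) - R (Complex a 0) =
              (R (Complex (real n) \<psi>) - R (Complex a \<psi>)) + (R (Complex a \<psi>) - R (Complex a 0))"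
            by simp
          finally have "\<bar>Y n - (\<Sum>j<m. X j n)\<bar> \<le>
              cmod ((R (Complex (real n) \<psi>) - R (Complex a \<psi>)) + (R (Complex a \<psi>) - R (Complex a 0))) / pi"
            by (simp only: abs_divide abs_of_pos[OF pi_gt_zero]) (intro divide_right_mono abs_Im_le_cmod, simp)
          also have "\<dots> \<le> ((1/2) ^ m * (1 / (c * \<kappa>)) + (1/2) ^ m * (exp (exp a) / c) * (\<psi> - 0)) / pi"
            by (intro divide_right_mono order_trans[OF norm_triangle_ineq] add_mono 1 2) auto
          also have "\<dots> = K * (1/2) ^ m"
            by (simp add: K_def algebra_simps add_divide_distrib)
          finally show "\<bar>Y n - (\<Sum>j<m. X j n)\<bar> \<le> K * (1/2) ^ m" .
        qed
      qed
    qed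
  qed
qed

text \<open>The second parameter is 1: with g the FAR filter, whose second parameter is \<theta> +
  1, the value at \<open>- (\<alpha> * t powr \<theta>)\<close> is the residual function 1 -
  \<alpha> g(t, \<alpha>).\<close>

definition mittag_leffler :: "real \<Rightarrow> real \<Rightarrow> real" where
  "mittag_leffler \<theta> z = (\<Sum>j. z ^ j / Gamma (\<theta> * real j + 1))"

text \<open>For \<open>l \<le> 1\<close> the series is compared with its coefficient sum
  \<open>S\<close>, for \<open>l > 1\<close> the decay \<open>C / l\<close> is used;
  \<open>S + C\<close> serves all three estimates.\<close>

lemma mittag_leffler_bounds:
  fixes \<theta> :: real
  assumes \<theta>: "0 < \<theta>" "\<theta> < 2"
  shows "\<exists>C\<ge>0. \<forall>l\<ge>0.
    (\<lambda>j. (- l) ^ j / Gamma (\<theta> * real j + 1)) sums mittag_leffler \<theta> (- l) \<and>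
    \<bar>mittag_leffler \<theta> (- l)\<bar> \<le> C \<and> l * \<bar>mittag_leffler \<theta> (- l)\<bar> \<le> C \<and> \<bar>1 - mittag_leffler \<theta> (- l)\<bar> \<le> C * l"
proof -
  obtain C where C: "\<exists>E. (\<lambda>j. (- l) ^ j / Gamma (\<theta> * real j + 1)) sums E \<and> \<bar>E\<bar> \<le> C / l" if "0 < l" for l
    using mittag_leffler_decay[OF \<theta>] by auto
  define b where "b j = 1 / Gamma (\<theta> * real j + 1)" for j
  have b: "0 < b j" for j
  proof -
    have "0 < \<theta> * real j + 1" using \<theta> by (simp add: add_nonneg_pos)
    then show ?thesis by (simp add: b_def Gamma_real_pos)
  qed
  have b0: "b 0 = 1" by (simp add: b_def)
  have large: "(\<lambda>j. (- l) ^ j / Gamma (\<theta> * real j + 1)) sums mittag_leffler \<theta> (- l)"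
    "\<bar>mittag_leffler \<theta> (- l)\<bar> \<le> C / l" if "0 < l" for l
    using C[OF that] by (auto simp: mittag_leffler_def sums_iff)
  have "C / 1 \<ge> \<bar>mittag_leffler \<theta> (- 1)\<bar>"
    by (rule large(2)) simp
  then have C0: "0 \<le> C" by linarith
  \<comment> \<open>No growth estimate for \<open>Gamma\<close> is made: convergence of the series
    at \<open>l = 2\<close> bounds its terms there, hence
    \<open>b j \<le> M * (1/2) ^ j\<close>.\<close>
  have sum_b: "summable b"
  proof -
    have lim: "(\<lambda>j. (- 2) ^ j * b j) \<longlonglongrightarrow> 0"
      using summable_LIMSEQ_zero[OF sums_summable[OF large(1)[of 2]]] by (simp add: b_def)
    obtain M where M: "\<And>j. \<bar>(- 2) ^ j * b j\<bar> \<le> M"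
      using convergent_imp_Bseq[OF convergentI[OF lim]] by (auto simp: Bseq_def)
    have "b j \<le> M * (1/2) ^ j" for j
      using M[of j] b[of j] by (simp add: abs_mult power_abs field_simps)
    then show ?thesis
      by (intro summable_comparison_test[OF _ summable_mult[OF summable_geometric[of "1/2 :: real"], of M]])
        (use b in \<open>auto simp: less_imp_le\<close>)
  qed
  define S where "S = suminf b"
  have S: "1 \<le> S"
    using sum_le_suminf[OF sum_b, of "{0}"] b b0 by (auto simp: S_def less_imp_le)
  have small: "\<bar>mittag_leffler \<theta> (- l)\<bar> \<le> S" "\<bar>1 - mittag_leffler \<theta> (- l)\<bar> \<le> S * l" if l: "0 < l" "l \<le> 1" for l
  proof -
    have s: "(\<lambda>j. (- l) ^ j * b j) sums mittag_leffler \<theta> (- l)"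
      using large(1)[OF l(1)] by (simp add: b_def)
    have "\<bar>(- l) ^ j * b j\<bar> \<le> b j" for j
      using l b[of j] by (simp add: abs_mult power_abs power_le_one mult_left_le_one_le)
    then show "\<bar>mittag_leffler \<theta> (- l)\<bar> \<le> S"
      using norm_suminf_le[of "\<lambda>j. (- l) ^ j * b j" b] sum_b sums_unique[OF s] by (simp add: S_def)
    have s': "(\<lambda>j. (- l) ^ Suc j * b (Suc j)) sums (mittag_leffler \<theta> (- l) - 1)"
      using s b0 by (subst sums_Suc_iff) simp
    have le: "\<bar>(- l) ^ Suc j * b (Suc j)\<bar> \<le> l * b (Suc j)" for j
      using l b[of "Suc j"] by (simp add: abs_mult power_abs power_le_one mult_le_one mult_left_le)
    have sum_b': "summable (\<lambda>j. l * b (Suc j))"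
      using sum_b by (intro summable_mult) (simp add: summable_Suc_iff)
    have "\<bar>mittag_leffler \<theta> (- l) - 1\<bar> \<le> (\<Sum>j. l * b (Suc j))"
      using norm_suminf_le[of "\<lambda>j. (- l) ^ Suc j * b (Suc j)" "\<lambda>j. l * b (Suc j)"] le sum_b' sums_unique[OF s']
      by simp
    also have "\<dots> = l * (S - b 0)"
      using sum_b suminf_split_head[OF sum_b] by (simp add: S_def suminf_mult summable_Suc_iff)
    also have "\<dots> \<le> S * l"
      using l b0 by (simp add: algebra_simps)
    finally show "\<bar>1 - mittag_leffler \<theta> (- l)\<bar> \<le> S * l" by linarith
  qed
  have zero: "(\<lambda>j. (- 0) ^ j / Gamma (\<theta> * real j + 1)) sums 1"
  proof -
    have "(\<lambda>j. (- 0) ^ j / Gamma (\<theta> * real j + 1)) = (\<lambda>j. if j = 0 then 1 else 0)"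
      by (auto simp: power_0_left)
    then show ?thesis
      using sums_single[of 0 "\<lambda>j. 1 :: real"] by (simp only:)
  qed
  then have m0: "mittag_leffler \<theta> 0 = 1"
    by (simp add: mittag_leffler_def sums_iff)
  show ?thesis
  proof (intro exI[of _ "S + C"] conjI allI impI)
    show "0 \<le> S + C" using S C0 by linarith
    fix l :: real assume l: "0 \<le> l"
    show "(\<lambda>j. (- l) ^ j / Gamma (\<theta> * real j + 1)) sums mittag_leffler \<theta> (- l)"
      using zero m0 large(1)[of l] l by (cases "l = 0") auto
    show "\<bar>mittag_leffler \<theta> (- l)\<bar> \<le> S + C"
    proof (cases "l = 0 \<or> l > 1")
      case True
      then show ?thesis
      proof
        assume "l > 1"
        then have "C / l \<le> C" using C0 mult_left_mono[of 1 l C] by (simp add: divide_le_eq)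
        then show ?thesis using large(2)[of l] \<open>l > 1\<close> S by linarith
      qed (use m0 S C0 in simp)
    next
      case False
      then show ?thesis using small(1)[of l] l C0 by linarith
    qed
    show "l * \<bar>mittag_leffler \<theta> (- l)\<bar> \<le> S + C"
    proof (cases "l = 0")
      case False
      then have "l * \<bar>mittag_leffler \<theta> (- l)\<bar> \<le> l * (C / l)"
        using l large(2)[of l] by (intro mult_left_mono) auto
      then show ?thesis using False S by simp
    qed (use S C0 in simp)
    show "\<bar>1 - mittag_leffler \<theta> (- l)\<bar> \<le> (S + C) * l"
    proof (cases "l = 0 \<or> l > 1")
      case True
      then show ?thesis
      proof
        assume l1: "l > 1"
        then have "C / l \<le> C" using C0 mult_left_mono[of 1 l C] by (simp add: divide_le_eq)
        then have "\<bar>1 - mittag_leffler \<theta> (- l)\<bar> \<le> S + C"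
          using large(2)[of l] l1 S by linarith
        also have "\<dots> \<le> (S + C) * l"
          using l1 S C0 mult_left_mono[of 1 l "S + C"] by simp
        finally show ?thesis .
      qed (use m0 in simp)
    next
      case False
      then have "\<bar>1 - mittag_leffler \<theta> (- l)\<bar> \<le> S * l" using small(2)[of l] l by linarith
      also have "\<dots> \<le> (S + C) * l" using C0 l by (intro mult_right_mono) auto
      finally show ?thesis .
    qed
  qed
qed

section \<open>Caputo equations as Volterra equations\<close>

text \<open>The Riemann-Liouville kernel: convolution with it is integration of order \<beta>. As
  \<open>0 powr 0 = 0\<close>, the kernel of order 1 equals 1 only off the origin, which is why open
  intervals are used below.\<close>

definition frac_kernel :: "real \<Rightarrow> real \<Rightarrow> real" where
  "frac_kernel \<beta> t = t powr (\<beta> - 1) / Gamma \<beta>"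

lemma frac_kernel_nonneg: "0 < \<beta> \<Longrightarrow> 0 \<le> frac_kernel \<beta> t"
  by (simp add: frac_kernel_def less_imp_le[OF Gamma_real_pos])

lemma frac_kernel_1: "0 < t \<Longrightarrow> frac_kernel 1 t = 1"
  by (simp add: frac_kernel_def)

lemma frac_kernel_2: "0 \<le> t \<Longrightarrow> frac_kernel 2 t = t"
  by (cases "t = 0") (simp_all add: frac_kernel_def Gamma_numeral)

lemma frac_kernel_measurable [measurable]: "frac_kernel \<beta> \<in> borel_measurable borel"
  unfolding frac_kernel_def by measurable

text \<open>The affine map of \<open>{s..t}\<close> onto the unit interval turns the left side into
  a Beta integral, and its Gamma factors cancel those of the kernels.\<close>

lemma frac_kernel_convolution:
  assumes a: "0 < a" and b: "0 < b" and "s < t"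
  shows "((\<lambda>\<tau>. frac_kernel a (t - \<tau>) * frac_kernel b (\<tau> - s)) has_integral frac_kernel (a + b) (t - s)) {s..t}"
proof -
  define m where "m = 1 / (t - s)"
  have m: "0 < m" using assms by (simp add: m_def)
  let ?f = "\<lambda>x. x powr (b - 1) * (1 - x) powr (a - 1)"
  have "((\<lambda>x. ?f (m *\<^sub>R x + (- s * m))) has_integral (1 / \<bar>m\<bar> ^ DIM(real)) *\<^sub>R Beta b a)
      ((\<lambda>x. (1 / m) *\<^sub>R x + -((1 / m) *\<^sub>R (- s * m))) ` cbox 0 1)"
    using has_integral_affinity[OF has_integral_Beta_real[OF b a, folded cbox_interval], of m "- s * m"] m by simp
  moreover have "(\<lambda>x. (1 / m) *\<^sub>R x + -((1 / m) *\<^sub>R (- s * m))) ` cbox 0 1 = {s..t}"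
  proof -
    have eq: "(\<lambda>x. (1 / m) *\<^sub>R x + -((1 / m) *\<^sub>R (- s * m))) = (\<lambda>x. (t - s) * x + s)"
      using m by (simp add: m_def)
    show ?thesis
      unfolding eq using \<open>s < t\<close> by (simp add: image_affinity_atLeastAtMost)
  qed
  ultimately have "((\<lambda>x. ?f (m * x - s * m)) has_integral ((t - s) * Beta b a)) {s..t}"
    using m \<open>s < t\<close> by (simp add: m_def)
  from has_integral_mult_right[OF this, of "m powr (2 - a - b) / (Gamma a * Gamma b)"]
  have "((\<lambda>x. m powr (2 - a - b) / (Gamma a * Gamma b) * ?f (m * x - s * m)) has_integral
      (m powr (2 - a - b) / (Gamma a * Gamma b) * ((t - s) * Beta b a))) {s..t}" .
  moreover have "m powr (2 - a - b) / (Gamma a * Gamma b) * ?f (m * x - s * m) =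
      frac_kernel a (t - x) * frac_kernel b (x - s)" if "x \<in> {s..t}" for x
  proof -
    have 1: "m * x - s * m = m * (x - s)" "1 - m * (x - s) = m * (t - x)"
    proof -
      have "m * (t - s) = 1" using \<open>s < t\<close> by (simp add: m_def)
      then show "m * x - s * m = m * (x - s)" "1 - m * (x - s) = m * (t - x)"
        by (simp_all add: algebra_simps)
    qed
    have "m powr (2 - a - b) * m powr (b - 1) * m powr (a - 1) = 1"
      using m by (simp flip: powr_add)
    then have "m powr (2 - a - b) * (m * (x - s)) powr (b - 1) * (m * (t - x)) powr (a - 1) =
        (x - s) powr (b - 1) * (t - x) powr (a - 1)"
      using that m by (simp add: powr_mult mult_ac)
    then show ?thesis
      unfolding 1 frac_kernel_def by (simp add: mult_ac)
  qed
  moreover have "m powr (2 - a - b) / (Gamma a * Gamma b) * ((t - s) * Beta b a) = frac_kernel (a + b) (t - s)"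
  proof -
    have "m powr (2 - a - b) = (t - s) powr - (2 - a - b)"
      unfolding m_def powr_minus_divide using \<open>s < t\<close> by (simp add: powr_divide)
    also have "\<dots> * (t - s) = (t - s) powr (a + b - 1)"
      using \<open>s < t\<close> powr_add[of "t - s" "- (2 - a - b)" 1] by (simp add: algebra_simps)
    finally have *: "m powr (2 - a - b) * (t - s) = (t - s) powr (a + b - 1)" .
    have "Gamma a \<noteq> 0" "Gamma b \<noteq> 0"
      using Gamma_real_pos[OF a] Gamma_real_pos[OF b] by auto
    then have "m powr (2 - a - b) / (Gamma a * Gamma b) * ((t - s) * Beta b a) =
        m powr (2 - a - b) * (t - s) / Gamma (a + b)"
      by (simp add: Beta_def add.commute)
    then show ?thesis
      unfolding * frac_kernel_def .
  qed
  ultimately show ?thesis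
    by (metis (no_types, lifting) has_integral_eq)
qed

lemma has_bochner_integral_lborel_nonneg:
  fixes f :: "real \<Rightarrow> real"
  assumes "f \<in> borel_measurable borel" "\<And>x. 0 \<le> f x" "(f has_integral I) UNIV"
  shows "has_bochner_integral lborel f I"
  using assms nn_integral_has_integral_lborel[OF assms] has_integral_nonneg[OF assms(3)]
  by (intro has_bochner_integral_nn_integral) auto

text \<open>Fubini's theorem on the triangle \<open>0 < s < \<tau> < t\<close>, with the Beta integral inside.\<close>

lemma fractional_integral_semigroup:
  fixes f w :: "real \<Rightarrow> real"
  assumes a: "0 < a" and c: "0 < c" and ac: "1 \<le> a + c" and t: "0 < t"
    and cont: "continuous_on {0<..<t} f"
    and int: "(\<lambda>s. \<bar>f s\<bar>) integrable_on {0..t}"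
    and w: "\<And>\<tau>. 0 < \<tau> \<Longrightarrow> \<tau> < t \<Longrightarrow> ((\<lambda>s. frac_kernel c (\<tau> - s) * f s) has_integral w \<tau>) {0..\<tau>}"
    and J: "((\<lambda>s. frac_kernel (a + c) (t - s) * f s) has_integral J) {0..t}"
  shows "((\<lambda>\<tau>. frac_kernel a (t - \<tau>) * w \<tau>) has_integral J) {0..t}"
proof -
  \<comment> \<open>Zero extension from the open interval is Borel, whatever \<open>f\<close> does
    at the endpoints.\<close>
  define f0 where "f0 s = indicator {0<..<t} s *\<^sub>R f s" for s
  have f0m [measurable]: "f0 \<in> borel_measurable borel"
    unfolding f0_def by (rule borel_measurable_continuous_on_indicator[OF _ cont]) simp
  define T where "T = {p :: real \<times> real. 0 < fst p \<and> fst p < snd p \<and> snd p < t}"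
  have Tm [measurable]: "T \<in> sets borel"
    unfolding T_def by (intro borel_open open_Collect_conj open_Collect_less continuous_intros)
  define g where "g s \<tau> = indicator T (s, \<tau>) * (frac_kernel a (t - \<tau>) * (frac_kernel c (\<tau> - s) * f0 s))" for s \<tau>
  have gm [measurable]: "(\<lambda>(s, \<tau>). g s \<tau>) \<in> borel_measurable (lborel \<Otimes>\<^sub>M lborel)"
    unfolding g_def split_beta' by measurable
  have inner: "integrable lborel (\<lambda>\<tau>. g s \<tau>) \<and> integral\<^sup>L lborel (\<lambda>\<tau>. g s \<tau>) = frac_kernel (a + c) (t - s) * f0 s
      \<and> integral\<^sup>L lborel (\<lambda>\<tau>. norm (g s \<tau>)) = frac_kernel (a + c) (t - s) * \<bar>f0 s\<bar>" for s
  proof (cases "0 < s \<and> s < t")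
    case True
    let ?k = "\<lambda>\<tau>. indicator {s<..<t} \<tau> * (frac_kernel a (t - \<tau>) * frac_kernel c (\<tau> - s))"
    have "((\<lambda>\<tau>. frac_kernel a (t - \<tau>) * frac_kernel c (\<tau> - s)) has_integral frac_kernel (a + c) (t - s)) {s<..<t}"
      using frac_kernel_convolution[OF a c, of s t] True by (simp add: has_integral_Icc_iff_Ioo)
    then have hi: "(?k has_integral frac_kernel (a + c) (t - s)) UNIV"
      by (subst (asm) has_integral_restrict_UNIV[symmetric])
        (auto elim!: has_integral_eq[rotated] simp: indicator_def)
    have hb: "has_bochner_integral lborel ?k (frac_kernel (a + c) (t - s))"
      by (rule has_bochner_integral_lborel_nonneg[OF _ _ hi]) (use a c in \<open>auto intro!: frac_kernel_nonneg mult_nonneg_nonneg\<close>)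
    have g: "g s = (\<lambda>\<tau>. ?k \<tau> * f0 s)"
      using True by (auto simp: g_def T_def fun_eq_iff indicator_def)
    have "(\<lambda>\<tau>. norm (g s \<tau>)) = (\<lambda>\<tau>. ?k \<tau> * \<bar>f0 s\<bar>)"
      unfolding g using a c by (auto simp: fun_eq_iff abs_mult abs_of_nonneg frac_kernel_nonneg)
    then show ?thesis
      using has_bochner_integral_mult_left[OF hb, of "f0 s"] has_bochner_integral_mult_left[OF hb, of "\<bar>f0 s\<bar>"]
      unfolding g by (auto simp: has_bochner_integral_iff)
  next
    case False
    then show ?thesis by (auto simp: g_def f0_def T_def)
  qed
  have f0_int: "integrable lborel (\<lambda>s. \<bar>f0 s\<bar>)"
  proof -
    have "(\<lambda>s. \<bar>f s\<bar>) integrable_on {0<..<t}"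
      using int by (simp add: integrable_on_Icc_iff_Ioo)
    then have "(\<lambda>s. if s \<in> {0<..<t} then \<bar>f s\<bar> else 0) integrable_on UNIV"
      by (simp only: integrable_restrict_UNIV)
    also have "(\<lambda>s. if s \<in> {0<..<t} then \<bar>f s\<bar> else 0) = (\<lambda>s. \<bar>f0 s\<bar>)"
      by (auto simp: f0_def)
    finally obtain I where "((\<lambda>s. \<bar>f0 s\<bar>) has_integral I) UNIV"
      by (auto simp: integrable_on_def)
    then have "has_bochner_integral lborel (\<lambda>s. \<bar>f0 s\<bar>) I"
      by (intro has_bochner_integral_lborel_nonneg) auto
    then show ?thesis by (simp add: has_bochner_integral_iff)
  qed
  \<comment> \<open>By \<open>1 \<le> a + c\<close> the composed kernel is bounded by its value at
    \<open>t\<close>, so absolute integrability of \<open>f\<close> is enough.\<close>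
  have outer: "integrable lborel (\<lambda>s. frac_kernel (a + c) (t - s) * \<bar>f0 s\<bar>)"
  proof (rule Bochner_Integration.integrable_bound)
    show "integrable lborel (\<lambda>s. frac_kernel (a + c) t * \<bar>f0 s\<bar>)"
      using f0_int by simp
    have "norm (frac_kernel (a + c) (t - s) * \<bar>f0 s\<bar>) \<le> norm (frac_kernel (a + c) t * \<bar>f0 s\<bar>)" for s
    proof (cases "0 < s \<and> s < t")
      case True
      then have "(t - s) powr (a + c - 1) \<le> t powr (a + c - 1)"
        using ac by (intro powr_mono2) auto
      then have "frac_kernel (a + c) (t - s) \<le> frac_kernel (a + c) t"
        unfolding frac_kernel_def using a c by (intro divide_right_mono less_imp_le[OF Gamma_real_pos]) auto
      then show ?thesis
        using a c by (simp add: abs_mult abs_of_nonneg frac_kernel_nonneg mult_right_mono)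
    qed (auto simp: f0_def)
    then show "AE s in lborel. norm (frac_kernel (a + c) (t - s) * \<bar>f0 s\<bar>) \<le> norm (frac_kernel (a + c) t * \<bar>f0 s\<bar>)"
      by simp
  qed simp
  have prod: "integrable (lborel \<Otimes>\<^sub>M lborel) (\<lambda>(s, \<tau>). g s \<tau>)"
  proof (rule lborel_pair.Fubini_integrable)
    show "integrable lborel (\<lambda>s. LBINT \<tau>. norm (case (s, \<tau>) of (s, \<tau>) \<Rightarrow> g s \<tau>))"
      using outer inner by simp
    show "AE s in lborel. integrable lborel (\<lambda>\<tau>. case (s, \<tau>) of (s, \<tau>) \<Rightarrow> g s \<tau>)"
      using inner by simp
  qed (rule gm)
  define H where "H \<tau> = (LBINT s. g s \<tau>)" for \<tau>
  have Hint: "integrable lborel H"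
    unfolding H_def by (rule lborel_pair.integrable_snd[OF prod])
  have "integral\<^sup>L lborel H = (LBINT s. frac_kernel (a + c) (t - s) * f0 s)"
    unfolding H_def lborel_pair.Fubini_integral[OF prod] using inner by simp
  also have "\<dots> = J"
  proof -
    have "integrable lborel (\<lambda>s. norm (frac_kernel (a + c) (t - s) * f0 s))"
      using outer a c by (simp add: abs_mult abs_of_nonneg frac_kernel_nonneg)
    then have "integrable lborel (\<lambda>s. frac_kernel (a + c) (t - s) * f0 s)"
      by (subst (asm) integrable_norm_iff) auto
    from has_integral_integral_lborel[OF this]
    have "((\<lambda>s. frac_kernel (a + c) (t - s) * f0 s) has_integral
        (LBINT s. frac_kernel (a + c) (t - s) * f0 s)) UNIV" .
    moreover have "((\<lambda>s. frac_kernel (a + c) (t - s) * f0 s) has_integral J) UNIV"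
    proof -
      have "((\<lambda>s. if s \<in> {0<..<t} then frac_kernel (a + c) (t - s) * f s else 0) has_integral J) UNIV"
        using J by (simp only: has_integral_restrict_UNIV has_integral_Icc_iff_Ioo)
      also have "(\<lambda>s. if s \<in> {0<..<t} then frac_kernel (a + c) (t - s) * f s else 0) =
          (\<lambda>s. frac_kernel (a + c) (t - s) * f0 s)"
        by (auto simp: f0_def)
      finally show ?thesis .
    qed
    ultimately show ?thesis by (rule has_integral_unique)
  qed
  finally have HJ: "(H has_integral J) UNIV"
    using has_integral_integral_lborel[OF Hint] by simp
  \<comment> \<open>Sections are integrable, and so comparable with the gauge integral
    \<open>w \<tau>\<close>, only for almost every \<tau>; the null set \<open>N\<close> does not
    affect the outer integral.\<close>
  have "AE \<tau> in lborel. integrable lborel (\<lambda>s. g s \<tau>)"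
    by (rule lborel_pair.AE_integrable_snd[OF prod])
  then obtain N where N: "{\<tau> \<in> space lborel. \<not> integrable lborel (\<lambda>s. g s \<tau>)} \<subseteq> N" "N \<in> null_sets lborel"
    by (auto simp: eventually_ae_filter)
  have "((\<lambda>\<tau>. if \<tau> \<in> {0<..<t} then frac_kernel a (t - \<tau>) * w \<tau> else 0) has_integral J) UNIV"
  proof (rule has_integral_spike[OF _ _ HJ])
    show "negligible N"
      using N(2) by (simp add: negligible_iff_null_sets null_sets_completionI)
    fix \<tau> :: real assume "\<tau> \<in> UNIV - N"
    then have i: "integrable lborel (\<lambda>s. g s \<tau>)" using N(1) by auto
    show "(if \<tau> \<in> {0<..<t} then frac_kernel a (t - \<tau>) * w \<tau> else 0) = H \<tau>"
    proof (cases "\<tau> \<in> {0<..<t}")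
      case True
      then have "((\<lambda>s. frac_kernel c (\<tau> - s) * f s) has_integral w \<tau>) {0<..<\<tau>}"
        using w[of \<tau>] by (simp add: has_integral_Icc_iff_Ioo)
      then have "((\<lambda>s. if s \<in> {0<..<\<tau>} then frac_kernel c (\<tau> - s) * f s else 0) has_integral w \<tau>) UNIV"
        by (simp only: has_integral_restrict_UNIV)
      from has_integral_mult_right[OF this, of "frac_kernel a (t - \<tau>)"]
      have "((\<lambda>s. g s \<tau>) has_integral (frac_kernel a (t - \<tau>) * w \<tau>)) UNIV"
        by (rule has_integral_eq[rotated]) (use True in \<open>auto simp: g_def T_def f0_def\<close>)
      then have "frac_kernel a (t - \<tau>) * w \<tau> = H \<tau>"
        unfolding H_def using has_integral_integral_lborel[OF i] by (rule has_integral_unique)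
      then show ?thesis using True by simp
    next
      case False
      then have "(\<lambda>s. g s \<tau>) = (\<lambda>s. 0)" by (auto simp: g_def T_def)
      then show ?thesis using False by (auto simp: H_def)
    qed
  qed
  then show ?thesis
    by (simp only: has_integral_restrict_UNIV has_integral_Icc_iff_Ioo)
qed


section \<open>From the Caputo derivative to an integral equation\<close>

lemma vderiv_Suc: "vderiv (Suc k) x t = vector_derivative (vderiv k x) (at t)"
  by (simp add: vderiv_def)

lemma vderiv_0 [simp]: "vderiv 0 x = x"
  by (simp add: vderiv_def)

lemma vderiv_has_vector_derivative:
  assumes "caputo_regular n x" "k < n" "0 < t"
  shows "(vderiv k x has_vector_derivative vderiv (Suc k) x t) (at t)"
  using assms by (simp add: caputo_regular_def vderiv_Suc vector_derivative_works[symmetric])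

lemma frac_kernel_1_has_integral_iff:
  fixes f :: "real \<Rightarrow> real"
  shows "((\<lambda>s. frac_kernel 1 (t - s) * f s) has_integral I) {0..t} \<longleftrightarrow> (f has_integral I) {0..t}"
  unfolding has_integral_Icc_iff_Ioo
  by (intro has_integral_cong) (simp add: frac_kernel_1)

lemma continuous_on_zero_extension:
  fixes F :: "real \<Rightarrow> 'a::real_normed_vector"
  assumes "(F \<longlongrightarrow> 0) (at_right 0)" "F 0 = 0" "\<And>s. 0 < s \<Longrightarrow> isCont F s"
  shows "continuous_on {0..} F"
proof (rule continuous_on_eq_continuous_within[THEN iffD2], rule ballI)
  fix s :: real assume "s \<in> {0..}"
  show "continuous (at s within {0..}) F"
  proof (cases "s = 0")
    case True
    have "(F \<longlongrightarrow> F 0) (at 0 within {0..})"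
      using assms(1,2) by (simp add: at_within_Ici_at_right)
    then show ?thesis by (simp add: True continuous_within)
  next
    case False
    then have "0 < s" using \<open>s \<in> {0..}\<close> by simp
    from continuous_at_imp_continuous_within[OF assms(3)[OF this]] show ?thesis .
  qed
qed

text \<open>The vanishing initial data enter only here.\<close>

lemma iterated_integral_1:
  fixes u :: "real \<Rightarrow> real"
  assumes "caputo_regular n u" "1 \<le> n" "u 0 = 0" "(u \<longlongrightarrow> 0) (at_right 0)" "0 < t"
  shows "((\<lambda>s. vderiv 1 u s) has_integral u t) {0..t}"
proof -
  have d: "(u has_vector_derivative vderiv 1 u s) (at s)" if "0 < s" for s
    using vderiv_has_vector_derivative[OF assms(1), of 0 s] assms(2) that by simp
  have "continuous_on {0..} u"
    by (rule continuous_on_zero_extension[OF assms(4,3)]) (rule has_vector_derivative_continuous[OF d])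
  then have "continuous_on {0..t} u"
    by (rule continuous_on_subset) auto
  from fundamental_theorem_of_calculus_interior[OF _ this, of "vderiv 1 u"] d assms show ?thesis
    by auto
qed

text \<open>Integration by parts: \<open>(t - s) * u' + u\<close> is an antiderivative of
  \<open>(t - s) * u''\<close>, equals \<open>u t\<close> at \<open>s = t\<close>, and tends to 0 at
  the origin by both initial conditions.\<close>

lemma iterated_integral_2:
  fixes u :: "real \<Rightarrow> real"
  assumes "caputo_regular n u" "2 \<le> n" "u 0 = 0" "(u \<longlongrightarrow> 0) (at_right 0)"
    and lim1: "(vderiv 1 u \<longlongrightarrow> 0) (at_right 0)" and t: "0 < t"
  shows "((\<lambda>s. frac_kernel 2 (t - s) * vderiv 2 u s) has_integral u t) {0..t}"
proof -
  have d: "(u has_vector_derivative vderiv 1 u s) (at s)" if "0 < s" for s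
    using vderiv_has_vector_derivative[OF assms(1), of 0 s] assms(2) that by simp
  have d2: "(vderiv 1 u has_vector_derivative vderiv 2 u s) (at s)" if "0 < s" for s
    using vderiv_has_vector_derivative[OF assms(1), of 1 s] assms(2) that by (simp add: numeral_2_eq_2)
  \<comment> \<open>The value at 0 is prescribed because \<open>vderiv 1 u 0\<close> is a two-sided
    derivative about which nothing is known.\<close>
  define G where "G s = (if s = 0 then 0 else (t - s) * vderiv 1 u s + u s)" for s
  have dG: "(G has_vector_derivative (t - s) * vderiv 2 u s) (at s)" if s: "0 < s" for s
  proof -
    have "((\<lambda>s. (t - s) * vderiv 1 u s + u s) has_vector_derivative (t - s) * vderiv 2 u s) (at s)"
      using d[OF s] d2[OF s]
      by (auto intro!: derivative_eq_intros simp: has_real_derivative_iff_has_vector_derivative[symmetric])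
    then show ?thesis
      by (rule has_vector_derivative_transform_within_open[of _ _ _ "{0<..}"]) (use s in \<open>auto simp: G_def\<close>)
  qed
  have "((\<lambda>s. (t - s) * vderiv 1 u s + u s) \<longlongrightarrow> (t - 0) * 0 + 0) (at_right 0)"
    by (intro tendsto_intros lim1 assms)
  then have "(G \<longlongrightarrow> (t - 0) * 0 + 0) (at_right 0)"
    by (rule Lim_transform_eventually)
      (rule eventually_mono[OF eventually_at_right_less], simp add: G_def)
  then have "(G \<longlongrightarrow> 0) (at_right 0)"
    by simp
  then have "continuous_on {0..} G"
    by (rule continuous_on_zero_extension) (auto simp: G_def intro!: has_vector_derivative_continuous[OF dG])
  then have "continuous_on {0..t} G"
    by (rule continuous_on_subset) auto
  from fundamental_theorem_of_calculus_interior[OF _ this, of "\<lambda>s. (t - s) * vderiv 2 u s"] dG t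
  have "((\<lambda>s. (t - s) * vderiv 2 u s) has_integral u t) {0..t}"
    by (auto simp: G_def)
  then show ?thesis
    by (rule has_integral_eq[rotated]) (simp add: frac_kernel_2)
qed

text \<open>Fractional integration of order \<theta> completes the Caputo integral of order
  \<open>n - \<theta>\<close> to an \<open>n\<close>-fold integral of the \<open>n\<close>-th
  derivative, which is \<open>u\<close>. Order 1 is separate, since there the derivative is ordinary
  and no complementary kernel exists.\<close>

lemma caputo_imp_volterra:
  fixes u :: "real \<Rightarrow> real"
  assumes \<theta>: "0 < \<theta>" "\<theta> < 2" and reg: "caputo_regular (nat \<lceil>\<theta>\<rceil>) u"
    and u0: "u 0 = 0" "(u \<longlongrightarrow> 0) (at_right 0)"
    and u1: "1 < \<theta> \<Longrightarrow> (vderiv 1 u \<longlongrightarrow> 0) (at_right 0)"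
    and eq: "\<And>t. 0 < t \<Longrightarrow> has_caputo_derivative \<theta> u (w t) t"
    and t: "0 < t"
  shows "((\<lambda>\<tau>. frac_kernel \<theta> (t - \<tau>) * w \<tau>) has_integral u t) {0..t}"
proof (cases "\<theta> = 1")
  case True
  have "(u has_vector_derivative w s) (at s)" if "0 < s" for s
    using eq[OF that] True by (simp add: has_caputo_derivative_def)
  then have "vderiv 1 u s = w s" if "0 < s" for s
    unfolding One_nat_def vderiv_Suc vderiv_0 using that by (intro vector_derivative_at)
  moreover have "(vderiv 1 u has_integral u t) {0..t}"
    using iterated_integral_1[OF reg _ u0 t] True by simp
  ultimately have "(w has_integral u t) {0<..<t}"
    unfolding has_integral_Icc_iff_Ioo by (auto elim: has_integral_eq[rotated])
  then show ?thesis
    unfolding True frac_kernel_1_has_integral_iff by (simp add: has_integral_Icc_iff_Ioo)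
next
  case False
  define n where "n = nat \<lceil>\<theta>\<rceil>"
  have n: "\<theta> < real n" "\<theta> \<noteq> real n" "n = 1 \<or> n = 2" "n = 2 \<Longrightarrow> 1 < \<theta>"
  proof -
    have "\<lceil>\<theta>\<rceil> = 1 \<and> \<theta> < 1 \<or> \<lceil>\<theta>\<rceil> = 2 \<and> 1 < \<theta>"
    proof (cases "\<theta> < 1")
      case True
      then have "\<lceil>\<theta>\<rceil> = 1" using \<theta> by linarith
      with True show ?thesis by simp
    next
      case False
      then have "1 < \<theta>" using \<open>\<theta> \<noteq> 1\<close> by simp
      then have "\<lceil>\<theta>\<rceil> = 2" using \<theta> by linarith
      with \<open>1 < \<theta>\<close> show ?thesis by simp
    qed
    then show "\<theta> < real n" "\<theta> \<noteq> real n" "n = 1 \<or> n = 2" "n = 2 \<Longrightarrow> 1 < \<theta>"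
      using \<theta> by (auto simp: n_def)
  qed
  have J: "((\<lambda>s. frac_kernel (\<theta> + (real n - \<theta>)) (t - s) * vderiv n u s) has_integral u t) {0..t}"
    using n(3)
  proof
    assume "n = 1"
    then show ?thesis
      using iterated_integral_1[OF reg _ u0 t] by (simp add: frac_kernel_1_has_integral_iff n_def)
  next
    assume "n = 2"
    then show ?thesis
      using iterated_integral_2[OF reg _ u0 u1 t] n(4) by (simp add: n_def)
  qed
  show ?thesis
  proof (rule fractional_integral_semigroup[OF \<theta>(1) _ _ t _ _ _ J])
    show "0 < real n - \<theta>" "1 \<le> \<theta> + (real n - \<theta>)" using n by auto
    show "continuous_on {0<..<t} (vderiv n u)"
      using reg unfolding caputo_regular_def n_def by (auto elim: continuous_on_subset)
    show "(\<lambda>s. \<bar>vderiv n u s\<bar>) integrable_on {0..t}"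
      using reg t unfolding caputo_regular_def n_def by simp
    fix \<tau> :: real assume "0 < \<tau>" "\<tau> < t"
    then show "((\<lambda>s. frac_kernel (real n - \<theta>) (\<tau> - s) * vderiv n u s) has_integral w \<tau>) {0..\<tau>}"
      using eq[of \<tau>] n(2) unfolding has_caputo_derivative_def n_def[symmetric] Let_def
      by (simp add: frac_kernel_def)
  qed
qed


text \<open>
  Iterating the Volterra equation \<open>v = b - \<alpha> (k\<^sub>\<theta> * v)\<close> produces the partial sums of the
  Mittag-Leffler series together with a remainder that is a multiple of its general term.
\<close>

lemma volterra_iteration_bound:
  fixes v :: "real \<Rightarrow> real"
  assumes \<theta>: "0 < \<theta>" and \<alpha>: "0 \<le> \<alpha>"
    and v: "\<And>t. 0 < t \<Longrightarrow> t \<le> T \<Longrightarrow> ((\<lambda>\<tau>. frac_kernel \<theta> (t - \<tau>) * (\<alpha> * v \<tau>)) has_integral (b - v t)) {0..t}"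
    and M: "\<And>t. 0 < t \<Longrightarrow> t \<le> T \<Longrightarrow> \<bar>v t\<bar> \<le> M"
    and t: "0 < t" "t \<le> T"
  shows "\<bar>v t - b * (\<Sum>j<m. (- \<alpha>) ^ j * frac_kernel (\<theta> * real j + 1) t)\<bar> \<le>
    M * \<alpha> ^ m * frac_kernel (\<theta> * real m + 1) t"
  using t
proof (induction m arbitrary: t)
  case 0
  then show ?case using M by (simp add: frac_kernel_1)
next
  case (Suc m)
  \<comment> \<open>\<open>D\<close> is the error of the \<open>m\<close>-th partial sum.
    Convolution with the kernel and multiplication by \<open>- \<alpha>\<close> maps it to the next
    error, while the same kernel raises the order of the bounding kernel by \<theta>.\<close>
  define D where "D t = v t - b * (\<Sum>j<m. (- \<alpha>) ^ j * frac_kernel (\<theta> * real j + 1) t)" for t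
  have conv: "((\<lambda>\<tau>. frac_kernel \<theta> (t - \<tau>) * frac_kernel (\<theta> * real j + 1) \<tau>) has_integral
      frac_kernel (\<theta> * real (Suc j) + 1) t) {0..t}" for j
  proof -
    have "0 < \<theta> * real j + 1" using \<theta> by (simp add: add_nonneg_pos)
    from frac_kernel_convolution[OF \<theta> this Suc.prems(1)] show ?thesis
      by (simp add: algebra_simps)
  qed
  have "((\<lambda>\<tau>. frac_kernel \<theta> (t - \<tau>) * (\<alpha> * v \<tau>) -
      \<alpha> * (b * (\<Sum>j<m. (- \<alpha>) ^ j * (frac_kernel \<theta> (t - \<tau>) * frac_kernel (\<theta> * real j + 1) \<tau>)))) has_integral
      (b - v t) - \<alpha> * (b * (\<Sum>j<m. (- \<alpha>) ^ j * frac_kernel (\<theta> * real (Suc j) + 1) t))) {0..t}"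
    by (intro has_integral_diff has_integral_mult_right has_integral_sum v conv Suc.prems) auto
  also have "(\<lambda>\<tau>. frac_kernel \<theta> (t - \<tau>) * (\<alpha> * v \<tau>) -
      \<alpha> * (b * (\<Sum>j<m. (- \<alpha>) ^ j * (frac_kernel \<theta> (t - \<tau>) * frac_kernel (\<theta> * real j + 1) \<tau>)))) =
      (\<lambda>\<tau>. \<alpha> * (frac_kernel \<theta> (t - \<tau>) * D \<tau>))"
    by (simp add: D_def algebra_simps sum_distrib_left)
  also have "(b - v t) - \<alpha> * (b * (\<Sum>j<m. (- \<alpha>) ^ j * frac_kernel (\<theta> * real (Suc j) + 1) t)) =
      - (v t - b * (\<Sum>j<Suc m. (- \<alpha>) ^ j * frac_kernel (\<theta> * real j + 1) t))"
    unfolding sum.lessThan_Suc_shift using frac_kernel_1[OF Suc.prems(1)]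
    by (simp add: algebra_simps sum_distrib_left sum_negf)
  finally have D: "((\<lambda>\<tau>. \<alpha> * (frac_kernel \<theta> (t - \<tau>) * D \<tau>)) has_integral
      - (v t - b * (\<Sum>j<Suc m. (- \<alpha>) ^ j * frac_kernel (\<theta> * real j + 1) t))) {0<..<t}"
    by (simp only: has_integral_Icc_iff_Ioo)
  have U: "((\<lambda>\<tau>. M * \<alpha> ^ Suc m * (frac_kernel \<theta> (t - \<tau>) * frac_kernel (\<theta> * real m + 1) \<tau>)) has_integral
      (M * \<alpha> ^ Suc m * frac_kernel (\<theta> * real (Suc m) + 1) t)) {0<..<t}"
    using has_integral_mult_right[OF conv] by (simp only: has_integral_Icc_iff_Ioo)
  have le: "\<bar>\<alpha> * (frac_kernel \<theta> (t - \<tau>) * D \<tau>)\<bar> \<le>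
      M * \<alpha> ^ Suc m * (frac_kernel \<theta> (t - \<tau>) * frac_kernel (\<theta> * real m + 1) \<tau>)"
    if "\<tau> \<in> {0<..<t}" for \<tau>
  proof -
    have "\<bar>D \<tau>\<bar> \<le> M * \<alpha> ^ m * frac_kernel (\<theta> * real m + 1) \<tau>"
      unfolding D_def using that Suc.prems by (intro Suc.IH) auto
    then have "\<alpha> * frac_kernel \<theta> (t - \<tau>) * \<bar>D \<tau>\<bar> \<le>
        \<alpha> * frac_kernel \<theta> (t - \<tau>) * (M * \<alpha> ^ m * frac_kernel (\<theta> * real m + 1) \<tau>)"
      using \<alpha> \<theta> by (intro mult_left_mono mult_nonneg_nonneg frac_kernel_nonneg)
    then show ?thesis
      using \<alpha> \<theta> by (simp add: abs_mult abs_of_nonneg frac_kernel_nonneg mult_ac)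
  qed
  have "- (v t - b * (\<Sum>j<Suc m. (- \<alpha>) ^ j * frac_kernel (\<theta> * real j + 1) t)) \<le>
      M * \<alpha> ^ Suc m * frac_kernel (\<theta> * real (Suc m) + 1) t"
    by (rule has_integral_le[OF D U]) (use le in \<open>auto dest: abs_le_D1\<close>)
  moreover have "v t - b * (\<Sum>j<Suc m. (- \<alpha>) ^ j * frac_kernel (\<theta> * real j + 1) t) \<le>
      M * \<alpha> ^ Suc m * frac_kernel (\<theta> * real (Suc m) + 1) t"
    by (rule has_integral_le[OF has_integral_neg[OF D, simplified minus_minus] U])
      (use le in \<open>auto dest: abs_le_D2\<close>)
  ultimately show ?case by linarith
qed

text \<open>\<open>v = b - \<alpha> * u\<close> is continuous up to 0, hence bounded on
  \<open>{0..t}\<close>, and the iteration remainder tends to 0 as the general term of a convergent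
  series. The second claim covers \<alpha> = 0, where the first says nothing about
  \<open>u\<close>.\<close>

lemma caputo_relaxation:
  fixes u :: "real \<Rightarrow> real"
  assumes \<theta>: "0 < \<theta>" "\<theta> < 2" and \<alpha>: "0 \<le> \<alpha>" and reg: "caputo_regular (nat \<lceil>\<theta>\<rceil>) u"
    and u0: "u 0 = 0" "(u \<longlongrightarrow> 0) (at_right 0)"
    and u1: "1 < \<theta> \<Longrightarrow> (vderiv 1 u \<longlongrightarrow> 0) (at_right 0)"
    and eq: "\<And>t. 0 < t \<Longrightarrow> has_caputo_derivative \<theta> u (b - \<alpha> * u t) t"
    and t: "0 < t"
  shows "b - \<alpha> * u t = b * mittag_leffler \<theta> (- (\<alpha> * t powr \<theta>))"
    and "b = 0 \<Longrightarrow> \<alpha> = 0 \<Longrightarrow> u t = 0"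
proof -
  note volterra = caputo_imp_volterra[OF \<theta> reg u0 u1 eq]
  show "u t = 0" if "b = 0" "\<alpha> = 0"
    using volterra[OF _ _ t] that by (simp add: has_integral_0_eq)
  define v where "v s = b - \<alpha> * u s" for s
  have v: "((\<lambda>\<tau>. frac_kernel \<theta> (s - \<tau>) * (\<alpha> * v \<tau>)) has_integral (b - v s)) {0..s}" if "0 < s" for s
    using has_integral_mult_right[OF volterra[OF _ _ that], of \<alpha>] by (simp add: v_def mult_ac)
  have "continuous_on {0..} u"
  proof (rule continuous_on_zero_extension[OF u0(2,1)])
    fix s :: real assume "0 < s"
    have "(vderiv 0 u has_vector_derivative vderiv (Suc 0) u s) (at s)"
      by (rule vderiv_has_vector_derivative[OF reg]) (use \<theta> \<open>0 < s\<close> in auto)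
    then show "isCont u s"
      by (auto intro: has_vector_derivative_continuous)
  qed
  then have "continuous_on {0..t} v"
    unfolding v_def by (intro continuous_intros) (auto elim: continuous_on_subset)
  then have "bounded (v ` {0..t})"
    by (intro compact_imp_bounded compact_continuous_image) auto
  then obtain M where "\<forall>s\<in>{0..t}. \<bar>v s\<bar> \<le> M"
    by (auto simp: bounded_iff)
  then have M: "\<bar>v s\<bar> \<le> M" if "0 \<le> s" "s \<le> t" for s
    using that by simp
  obtain C where sums: "\<And>l. 0 \<le> l \<Longrightarrow> (\<lambda>j. (- l) ^ j / Gamma (\<theta> * real j + 1)) sums mittag_leffler \<theta> (- l)"
    using mittag_leffler_bounds[OF \<theta>] by auto
  define l where "l = \<alpha> * t powr \<theta>"
  have l: "0 \<le> l" using \<alpha> by (simp add: l_def)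
  have kernel: "frac_kernel (\<theta> * real j + 1) t = (t powr \<theta>) ^ j / Gamma (\<theta> * real j + 1)" for j
    using t by (simp add: frac_kernel_def powr_powr[symmetric] powr_realpow)
  let ?c = "\<lambda>j. (- l) ^ j / Gamma (\<theta> * real j + 1)"
  have bound: "\<bar>v t - b * (\<Sum>j<m. ?c j)\<bar> \<le> M * \<bar>?c m\<bar>" for m
  proof -
    have "\<bar>v t - b * (\<Sum>j<m. (- \<alpha>) ^ j * frac_kernel (\<theta> * real j + 1) t)\<bar> \<le>
        M * \<alpha> ^ m * frac_kernel (\<theta> * real m + 1) t"
      using v M t by (intro volterra_iteration_bound[where T = t] \<theta> \<alpha>) auto
    moreover have "(- \<alpha>) ^ j * frac_kernel (\<theta> * real j + 1) t = ?c j" for j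
      unfolding kernel l_def by (simp flip: power_mult_distrib)
    moreover have "\<alpha> ^ m * frac_kernel (\<theta> * real m + 1) t = \<bar>?c m\<bar>"
    proof -
      have "0 < Gamma (\<theta> * real m + 1)"
        using \<theta> by (intro Gamma_real_pos) (simp add: add_nonneg_pos)
      then show ?thesis
        using \<alpha> unfolding kernel l_def by (simp add: abs_mult power_abs power_mult_distrib)
    qed
    ultimately show ?thesis by (simp add: mult.assoc)
  qed
  have "(\<lambda>m. \<bar>v t - b * (\<Sum>j<m. ?c j)\<bar>) \<longlonglongrightarrow> \<bar>v t - b * mittag_leffler \<theta> (- l)\<bar>"
    using sums[OF l] unfolding sums_def by (intro tendsto_intros)
  moreover have "(\<lambda>m. M * \<bar>?c m\<bar>) \<longlonglongrightarrow> M * \<bar>0\<bar>"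
    using summable_LIMSEQ_zero[OF sums_summable[OF sums[OF l]]] by (intro tendsto_intros)
  ultimately have "\<bar>v t - b * mittag_leffler \<theta> (- l)\<bar> \<le> M * \<bar>0\<bar>"
    by (rule LIMSEQ_le) (use bound in blast)
  then show "b - \<alpha> * u t = b * mittag_leffler \<theta> (- (\<alpha> * t powr \<theta>))"
    by (simp add: v_def l_def)
qed

section \<open>Scalar components of a vector-valued solution\<close>

lemma vderiv_inner:
  fixes x :: "real \<Rightarrow> 'a::real_inner"
  assumes "caputo_regular n x" "k \<le> n" "0 < t"
  shows "vderiv k (\<lambda>t. x t \<bullet> v) t = vderiv k x t \<bullet> v"
  using assms(2,3)
proof (induction k arbitrary: t)
  case (Suc k)
  have "(vderiv k x has_vector_derivative vderiv (Suc k) x t) (at t)"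
    using Suc.prems by (intro vderiv_has_vector_derivative[OF assms(1)]) auto
  from bounded_linear.has_vector_derivative[OF bounded_linear_inner_left this, of v]
  have "(vderiv k (\<lambda>t. x t \<bullet> v) has_vector_derivative vderiv (Suc k) x t \<bullet> v) (at t)"
    by (rule has_vector_derivative_transform_within_open[of _ _ _ "{0<..}"])
      (use Suc in auto)
  then show ?case
    by (simp add: vderiv_Suc vector_derivative_at)
qed simp

lemma vderiv_inner_has_vector_derivative:
  fixes x :: "real \<Rightarrow> 'a::real_inner"
  assumes "caputo_regular n x" "k \<le> n" "0 < t" "(vderiv k x has_vector_derivative d) (at t)"
  shows "(vderiv k (\<lambda>t. x t \<bullet> v) has_vector_derivative d \<bullet> v) (at t)"
  using bounded_linear.has_vector_derivative[OF bounded_linear_inner_left assms(4), of v]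
  by (rule has_vector_derivative_transform_within_open[of _ _ _ "{0<..}"])
    (use assms vderiv_inner[OF assms(1,2)] in auto)

lemma caputo_regular_inner:
  fixes x :: "real \<Rightarrow> 'a::real_inner"
  assumes reg: "caputo_regular n x"
  shows "caputo_regular n (\<lambda>t. x t \<bullet> v)"
  unfolding caputo_regular_def
proof (intro conjI allI impI)
  fix k and t :: real assume "k < n" "0 < t"
  then show "vderiv k (\<lambda>t. x t \<bullet> v) differentiable at t"
    using vderiv_inner_has_vector_derivative[OF reg, of k t] vderiv_has_vector_derivative[OF reg, of k t]
    by (auto simp: differentiable_def has_vector_derivative_def)
next
  have "continuous_on {0<..} (\<lambda>t. vderiv n x t \<bullet> v)"
    using reg unfolding caputo_regular_def by (intro continuous_intros) auto
  then show cont: "continuous_on {0<..} (vderiv n (\<lambda>t. x t \<bullet> v))"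
    by (rule continuous_on_eq) (simp add: vderiv_inner[OF reg])
  fix t :: real assume t: "0 < t"
  \<comment> \<open>Cauchy-Schwarz dominates the component by the integrable norm; measurability
    comes from continuity on the open interval.\<close>
  have "(\<lambda>s. vderiv n (\<lambda>t. x t \<bullet> v) s) absolutely_integrable_on {0<..<t}"
  proof (rule measurable_bounded_by_integrable_imp_absolutely_integrable)
    show "vderiv n (\<lambda>t. x t \<bullet> v) \<in> borel_measurable (lebesgue_on {0<..<t})"
      by (intro continuous_imp_measurable_on_sets_lebesgue continuous_on_subset[OF cont]) auto
    have "(\<lambda>s. norm (vderiv n x s)) integrable_on {0<..<t}"
      using reg t by (simp add: caputo_regular_def flip: integrable_on_Icc_iff_Ioo)
    then show "(\<lambda>s. norm (vderiv n x s) * norm v) integrable_on {0<..<t}"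
      by (rule integrable_on_mult_left)
    fix s assume "s \<in> {0<..<t}"
    then show "norm (vderiv n (\<lambda>t. x t \<bullet> v) s) \<le> norm (vderiv n x s) * norm v"
      using vderiv_inner[OF reg, of n s v] Cauchy_Schwarz_ineq2[of "vderiv n x s" v] by simp
  qed auto
  then show "(\<lambda>s. norm (vderiv n (\<lambda>t. x t \<bullet> v) s)) integrable_on {0..t}"
    by (simp add: absolutely_integrable_on_def integrable_on_Icc_iff_Ioo)
qed

lemma has_caputo_derivative_inner:
  fixes x :: "real \<Rightarrow> 'a::real_inner"
  assumes reg: "caputo_regular (nat \<lceil>\<theta>\<rceil>) x" and t: "0 < t" and d: "has_caputo_derivative \<theta> x d t"
  shows "has_caputo_derivative \<theta> (\<lambda>t. x t \<bullet> v) (d \<bullet> v) t"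
proof -
  define n where "n = nat \<lceil>\<theta>\<rceil>"
  show ?thesis
  proof (cases "\<theta> = real n")
    case True
    then show ?thesis
      using d vderiv_inner_has_vector_derivative[OF reg, of "n - 1" t d v] t
      by (simp add: has_caputo_derivative_def n_def[symmetric])
  next
    case False
    let ?k = "\<lambda>s. (t - s) powr (real n - \<theta> - 1) / Gamma (real n - \<theta>)"
    have "((\<lambda>s. ?k s *\<^sub>R vderiv n x s) has_integral d) {0..t}"
      using d False by (simp add: has_caputo_derivative_def n_def[symmetric])
    from has_integral_linear[OF this bounded_linear_inner_left, of v]
    have "((\<lambda>s. ?k s *\<^sub>R (vderiv n x s \<bullet> v)) has_integral d \<bullet> v) {0<..<t}"
      by (simp add: o_def has_integral_Icc_iff_Ioo)
    then have "((\<lambda>s. ?k s *\<^sub>R vderiv n (\<lambda>t. x t \<bullet> v) s) has_integral d \<bullet> v) {0<..<t}"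
      by (rule has_integral_eq[rotated]) (use vderiv_inner[OF reg, of n] in \<open>auto simp: n_def\<close>)
    then show ?thesis
      using False by (simp add: has_caputo_derivative_def n_def[symmetric] has_integral_Icc_iff_Ioo)
  qed
qed

text \<open>Pairing the equation with \<open>v\<close> moves \<open>adjoint A \<circ> A\<close> onto
  \<open>v\<close>, where it is multiplication by \<alpha>, and leaves a scalar relaxation equation
  with right-hand side \<open>z \<bullet> A v\<close>.\<close>

lemma FAR_solution_eigenvector:
  fixes A :: "'a::real_inner \<Rightarrow> 'b::real_inner"
  assumes \<theta>: "0 < \<theta>" "\<theta> < 2" and sol: "FAR_solution \<theta> A z x"
    and adj: "\<And>x y. adjoint A y \<bullet> x = y \<bullet> A x"
    and v: "adjoint A (A v) = \<alpha> *\<^sub>R v" and \<alpha>: "0 \<le> \<alpha>" and t: "0 < t"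
  shows "\<alpha> * (x t \<bullet> v) = (1 - mittag_leffler \<theta> (- (\<alpha> * t powr \<theta>))) * (z \<bullet> A v)"
    and "z \<bullet> A v = 0 \<Longrightarrow> \<alpha> = 0 \<Longrightarrow> x t \<bullet> v = 0"
proof -
  let ?u = "\<lambda>t. x t \<bullet> v"
  have reg: "caputo_regular (nat \<lceil>\<theta>\<rceil>) x" and x0: "x 0 = 0" "(x \<longlongrightarrow> 0) (at_right 0)"
    and x1: "1 < \<theta> \<Longrightarrow> (vderiv 1 x \<longlongrightarrow> 0) (at_right 0)"
    and eq: "\<And>t. 0 < t \<Longrightarrow> \<exists>d. has_caputo_derivative \<theta> x d t \<and> d + adjoint A (A (x t)) = adjoint A z"
    using sol by (auto simp: FAR_solution_def)
  have u0: "?u 0 = 0" "(?u \<longlongrightarrow> 0) (at_right 0)"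
    using x0 tendsto_inner[OF x0(2) tendsto_const, of v] by simp_all
  have u1: "(vderiv 1 ?u \<longlongrightarrow> 0) (at_right 0)" if "1 < \<theta>"
  proof -
    have "((\<lambda>s. vderiv 1 x s \<bullet> v) \<longlongrightarrow> 0) (at_right 0)"
      using tendsto_inner[OF x1[OF that] tendsto_const, of v] by simp
    moreover have "vderiv 1 x s \<bullet> v = vderiv 1 ?u s" if "0 < s" for s
      using vderiv_inner[OF reg _ that, of 1 v] \<open>0 < \<theta>\<close> by (simp add: Suc_le_eq)
    ultimately show ?thesis
      by (rule Lim_transform_eventually[OF _ eventually_mono[OF eventually_at_right_less]])
  qed
  have "has_caputo_derivative \<theta> ?u (z \<bullet> A v - \<alpha> * ?u t) t" if t: "0 < t" for t
  proof -
    obtain d where d: "has_caputo_derivative \<theta> x d t" "d + adjoint A (A (x t)) = adjoint A z"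
      using eq[OF t] by blast
    have "adjoint A (A (x t)) \<bullet> v = \<alpha> * ?u t"
      using adj[of "A (x t)" v] adj[of "A v" "x t"] v by (simp add: inner_commute)
    then have "d \<bullet> v = z \<bullet> A v - \<alpha> * ?u t"
      using arg_cong[OF d(2), of "\<lambda>y. y \<bullet> v"] adj[of z v] by (simp add: inner_add_left)
    then show ?thesis
      using has_caputo_derivative_inner[OF reg t d(1), of v] by simp
  qed
  note r = caputo_relaxation[OF \<theta> \<alpha> caputo_regular_inner[OF reg] u0 u1 this t]
  show "\<alpha> * (x t \<bullet> v) = (1 - mittag_leffler \<theta> (- (\<alpha> * t powr \<theta>))) * (z \<bullet> A v)"
    using r(1) by (simp add: algebra_simps)
  show "x t \<bullet> v = 0" if "z \<bullet> A v = 0" "\<alpha> = 0"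
    using r(2) that by simp
qed

section \<open>Error of fractional asymptotical regularization\<close>

lemma inner_sum_orthogonal:
  fixes s :: "'i \<Rightarrow> 'a::real_inner"
  assumes "finite F" "\<And>i j. i \<in> F \<Longrightarrow> j \<in> F \<Longrightarrow> i \<noteq> j \<Longrightarrow> s i \<bullet> s j = 0"
  shows "(\<Sum>i\<in>F. a i *\<^sub>R s i) \<bullet> (\<Sum>i\<in>F. b i *\<^sub>R s i) = (\<Sum>i\<in>F. a i * b i * (norm (s i))\<^sup>2)"
proof -
  have "(\<Sum>i\<in>F. a i *\<^sub>R s i) \<bullet> (\<Sum>i\<in>F. b i *\<^sub>R s i) =
      (\<Sum>i\<in>F. \<Sum>j\<in>F. if i = j then a i * b j * (s i \<bullet> s j) else 0)"
    unfolding inner_sum_left inner_sum_right using assms(2)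
    by (intro sum.cong refl) (auto simp: mult_ac)
  also have "\<dots> = (\<Sum>i\<in>F. a i * b i * (norm (s i))\<^sup>2)"
    using assms(1) by (simp add: power2_norm_eq_inner)
  finally show ?thesis .
qed

text \<open>
  Duality: it suffices to test the error against finite sums \<open>q\<close> of eigenvectors. There the noise
  contributes \<open>\<zeta> \<bullet> A q'\<close> with \<open>\<parallel>A q'\<parallel> \<le> (1 + C) t\<^bsup>\<theta>/2\<^esup> \<parallel>q\<parallel>\<close>, because
  \<open>(1 - E\<^sub>\<theta>(-\<lambda>))\<^sup>2 \<le> (1 + C)\<^sup>2 \<lambda>\<close>.
\<close>

lemma FAR_error_bound:
  fixes A :: "'a::{real_inner, complete_space} \<Rightarrow> 'b::real_inner"
  assumes A: "compact_operator A" and \<theta>: "0 < \<theta>" "\<theta> < 2"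
    and C: "0 \<le> C"
      "\<And>l. 0 \<le> l \<Longrightarrow> \<bar>mittag_leffler \<theta> (- l)\<bar> \<le> C"
      "\<And>l. 0 \<le> l \<Longrightarrow> \<bar>1 - mittag_leffler \<theta> (- l)\<bar> \<le> C * l"
    and sol: "FAR_solution \<theta> A z x" and noise: "norm (z - A xd) \<le> \<delta>"
    and source: "\<And>\<beta> v. v \<in> eigenspace (adjoint A \<circ> A) \<beta> \<Longrightarrow> xd \<bullet> v = \<phi> \<beta> * (w \<bullet> v)"
    and L: "\<And>v. norm (A v) \<le> L * norm v"
    and t: "0 < t"
    and B: "0 \<le> B" "\<And>\<alpha>. 0 \<le> \<alpha> \<Longrightarrow> \<alpha> \<le> L\<^sup>2 \<Longrightarrow> \<bar>mittag_leffler \<theta> (- (\<alpha> * t powr \<theta>)) * \<phi> \<alpha>\<bar> \<le> B"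
  shows "norm (x t - xd) \<le> (1 + C) * sqrt (t powr \<theta>) * \<delta> + B * norm w"
proof -
  have bl: "bounded_linear A" using A by (simp add: compact_operator_def)
  interpret A: bounded_linear A by (rule bl)
  interpret A': bounded_linear "adjoint A" by (rule bounded_linear_adjoint[OF bl])
  note adj = inner_adjoint[OF bl]
  define e where "e = x t - xd"
  define \<zeta> where "\<zeta> = z - A xd"
  define m where "m \<alpha> = mittag_leffler \<theta> (- (\<alpha> * t powr \<theta>))" for \<alpha>
  define K where "K = (1 + C) * sqrt (t powr \<theta>) * \<delta> + B * norm w"
  let ?E = "eigenspace (adjoint A \<circ> A)"
  have "0 \<le> \<delta>" using noise norm_ge_zero order_trans by blast
  then have K0: "0 \<le> K" using C B by (simp add: K_def)
  have sym: "(adjoint A \<circ> A) u \<bullet> v = u \<bullet> (adjoint A \<circ> A) v" for u v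
    using adj[of "A u" v] adj[of "A v" u] by (simp add: inner_commute)
  have Tbl: "bounded_linear (adjoint A \<circ> A)"
    unfolding o_def by (rule bounded_linear_compose[OF A'.bounded_linear_axioms A.bounded_linear_axioms])
  have eigen: "0 \<le> \<alpha>" "\<alpha> \<le> L\<^sup>2" if "v \<in> ?E \<alpha>" "v \<noteq> 0" for \<alpha> v
  proof -
    have n: "\<alpha> * (norm v)\<^sup>2 = (norm (A v))\<^sup>2"
      using that(1) adj[of "A v" v] by (simp add: eigenspace_def power2_norm_eq_inner)
    also have "\<dots> \<le> L\<^sup>2 * (norm v)\<^sup>2"
      using power_mono[OF L norm_ge_zero, of v 2] by (simp add: power_mult_distrib)
    finally show "\<alpha> \<le> L\<^sup>2" using that(2) by simp
    have "\<alpha> = (norm (A v))\<^sup>2 / (norm v)\<^sup>2" using n that(2) by (simp add: field_simps)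
    then show "0 \<le> \<alpha>" by simp
  qed
  \<comment> \<open>For \<open>l \<le> 1\<close> square \<open>C * l\<close> and use
    \<open>l^2 \<le> l\<close>; for \<open>l > 1\<close> boundedness by \<open>1 + C\<close> is
    enough. This interpolation produces the half power in the noise term.\<close>
  have m_sq: "(1 - m \<alpha>)\<^sup>2 \<le> (1 + C)\<^sup>2 * (\<alpha> * t powr \<theta>)" if "0 \<le> \<alpha>" for \<alpha>
  proof -
    define l where "l = \<alpha> * t powr \<theta>"
    have l: "0 \<le> l" using that by (simp add: l_def)
    have "\<bar>1 - m \<alpha>\<bar> \<le> C * l" "\<bar>m \<alpha>\<bar> \<le> C"
      using C(2,3)[OF l] by (simp_all add: m_def l_def)
    show ?thesis
    proof (cases "l \<le> 1")
      case True
      have "(1 - m \<alpha>)\<^sup>2 \<le> (C * l)\<^sup>2"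
        using \<open>\<bar>1 - m \<alpha>\<bar> \<le> C * l\<close> by (simp add: abs_le_square_iff[symmetric])
      also have "\<dots> \<le> (1 + C)\<^sup>2 * l"
        unfolding power_mult_distrib using C(1) l True
        by (intro mult_mono power_mono) (auto simp: power2_eq_square mult_left_le)
      finally show ?thesis by (simp add: l_def)
    next
      case False
      have "\<bar>1 - m \<alpha>\<bar> \<le> \<bar>1 + C\<bar>"
        using \<open>\<bar>m \<alpha>\<bar> \<le> C\<close> by linarith
      then have "(1 - m \<alpha>)\<^sup>2 \<le> (1 + C)\<^sup>2" by (simp only: abs_le_square_iff)
      also have "\<dots> \<le> (1 + C)\<^sup>2 * l"
        using False by (simp add: mult_le_cancel_left1)
      finally show ?thesis by (simp add: l_def)
    qed
  qed
  \<comment> \<open>The formula also holds at \<alpha> = 0: division by zero yields 0, which fits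
    \<open>A v = 0\<close>, and \<open>m 0 = 1\<close> leaves only the component of
    \<open>xd\<close>.\<close>
  have coeff: "e \<bullet> v = (1 - m \<alpha>) / \<alpha> * (\<zeta> \<bullet> A v) - m \<alpha> * \<phi> \<alpha> * (w \<bullet> v)"
    if v: "v \<in> ?E \<alpha>" "v \<noteq> 0" for v \<alpha>
  proof (cases "\<alpha> = 0")
    case True
    then have "(norm (A v))\<^sup>2 = 0"
      using v(1) adj[of "A v" v] by (simp add: eigenspace_def power2_norm_eq_inner)
    then have "A v = 0" by simp
    moreover have "m 0 = 1" using C(3)[of 0] by (simp add: m_def)
    moreover have "x t \<bullet> v = 0"
      using FAR_solution_eigenvector(2)[OF \<theta> sol adj _ _ t, of v \<alpha>] v True \<open>A v = 0\<close>
      by (simp add: eigenspace_def)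
    ultimately show ?thesis
      using source[OF v(1)] True by (simp add: e_def inner_diff_left)
  next
    case False
    have Tv: "adjoint A (A v) = \<alpha> *\<^sub>R v" using v(1) by (simp add: eigenspace_def)
    have "\<alpha> * (x t \<bullet> v) = (1 - m \<alpha>) * (z \<bullet> A v)"
      using FAR_solution_eigenvector(1)[OF \<theta> sol adj Tv eigen(1)[OF v] t] by (simp add: m_def)
    moreover have "\<alpha> * (xd \<bullet> v) = A xd \<bullet> A v"
      using adj[of "A v" xd] Tv by (simp add: inner_commute)
    ultimately have "\<alpha> * (e \<bullet> v) = (1 - m \<alpha>) * (\<zeta> \<bullet> A v) - m \<alpha> * (\<alpha> * (xd \<bullet> v))"
      by (simp add: e_def \<zeta>_def inner_diff_left algebra_simps)
    then show ?thesis
      using False source[OF v(1)] by (simp add: field_simps)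
  qed
  have test: "e \<bullet> q \<le> K * norm q" if q: "q \<in> span (\<Union>\<alpha>. ?E \<alpha>)" for q
  proof -
    obtain F0 s where F0: "finite F0" and s: "\<And>\<alpha>. s \<alpha> \<in> ?E \<alpha>" and q0: "q = (\<Sum>\<alpha>\<in>F0. s \<alpha>)"
      using span_Union_subspaces[OF closed_subspace_eigenspace(2)[OF Tbl] q] by blast
    \<comment> \<open>Zero summands are dropped, because the zero vector lies in
      \<open>?E \<alpha>\<close> for every real \<alpha> and would give no bounds on it.\<close>
    define F where "F = {\<alpha>\<in>F0. s \<alpha> \<noteq> 0}"
    have F: "finite F" using F0 by (simp add: F_def)
    have sF: "s \<alpha> \<noteq> 0" "0 \<le> \<alpha>" "\<alpha> \<le> L\<^sup>2" if "\<alpha> \<in> F" for \<alpha>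
      using that eigen[OF s] by (auto simp: F_def)
    have qF: "q = (\<Sum>\<alpha>\<in>F. 1 *\<^sub>R s \<alpha>)"
      unfolding q0 F_def using F0 by (auto intro!: sum.mono_neutral_right)
    have orth: "(\<Sum>\<alpha>\<in>F. a \<alpha> *\<^sub>R s \<alpha>) \<bullet> (\<Sum>\<alpha>\<in>F. b \<alpha> *\<^sub>R s \<alpha>) = (\<Sum>\<alpha>\<in>F. a \<alpha> * b \<alpha> * (norm (s \<alpha>))\<^sup>2)"
      for a b
      by (rule inner_sum_orthogonal[OF F]) (rule eigenspaces_orthogonal[OF sym s s])
    have nq: "(norm q)\<^sup>2 = (\<Sum>\<alpha>\<in>F. (norm (s \<alpha>))\<^sup>2)"
    proof -
      have "q \<bullet> q = (\<Sum>\<alpha>\<in>F. 1 * 1 * (norm (s \<alpha>))\<^sup>2)"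
        unfolding qF by (rule orth)
      then show ?thesis by (simp add: power2_norm_eq_inner[of q])
    qed
    have weighted: "norm (\<Sum>\<alpha>\<in>F. d \<alpha> *\<^sub>R s \<alpha>) \<le> B * norm q" if "\<And>\<alpha>. \<alpha> \<in> F \<Longrightarrow> \<bar>d \<alpha>\<bar> \<le> B" for d
    proof (rule power2_le_imp_le)
      have "(norm (\<Sum>\<alpha>\<in>F. d \<alpha> *\<^sub>R s \<alpha>))\<^sup>2 = (\<Sum>\<alpha>\<in>F. d \<alpha> * d \<alpha> * (norm (s \<alpha>))\<^sup>2)"
        unfolding power2_norm_eq_inner[of "\<Sum>\<alpha>\<in>F. d \<alpha> *\<^sub>R s \<alpha>"] orth ..
      also have "\<dots> \<le> (\<Sum>\<alpha>\<in>F. B\<^sup>2 * (norm (s \<alpha>))\<^sup>2)"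
        using that B(1) by (intro sum_mono mult_right_mono)
          (auto simp: power2_eq_square[symmetric] abs_le_square_iff[symmetric])
      finally show "(norm (\<Sum>\<alpha>\<in>F. d \<alpha> *\<^sub>R s \<alpha>))\<^sup>2 \<le> (B * norm q)\<^sup>2"
        by (simp add: power_mult_distrib nq sum_distrib_left)
    qed (use B(1) in simp)
    \<comment> \<open>For \<alpha> > 0 this is the FAR filter at time \<open>t\<close>;
      \<open>w1\<close> and \<open>w2\<close> carry filter and residual over to the test
      vector.\<close>
    define c where "c \<alpha> = (1 - m \<alpha>) / \<alpha>" for \<alpha>
    define w1 where "w1 = (\<Sum>\<alpha>\<in>F. c \<alpha> *\<^sub>R s \<alpha>)"
    define w2 where "w2 = (\<Sum>\<alpha>\<in>F. (m \<alpha> * \<phi> \<alpha>) *\<^sub>R s \<alpha>)"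
    have "norm (A w1) \<le> (1 + C) * sqrt (t powr \<theta>) * norm q"
    proof (rule power2_le_imp_le)
      \<comment> \<open>Writing the squared norm as an inner product of
        \<open>adjoint A (A w1)\<close> with \<open>w1\<close> makes it a diagonal sum with entries
        \<open>(1 - m \<alpha>)^2 / \<alpha>\<close>, to which \<open>m_sq\<close> applies.\<close>
      have "adjoint A (A w1) = (\<Sum>\<alpha>\<in>F. (c \<alpha> * \<alpha>) *\<^sub>R s \<alpha>)"
        using s by (simp add: w1_def A.sum A'.sum A.scale A'.scale eigenspace_def)
      then have "(norm (A w1))\<^sup>2 = (\<Sum>\<alpha>\<in>F. (c \<alpha> * \<alpha>) *\<^sub>R s \<alpha>) \<bullet> (\<Sum>\<alpha>\<in>F. c \<alpha> *\<^sub>R s \<alpha>)"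
        using adj[of "A w1" w1] by (simp add: power2_norm_eq_inner w1_def)
      also have "\<dots> = (\<Sum>\<alpha>\<in>F. c \<alpha> * \<alpha> * c \<alpha> * (norm (s \<alpha>))\<^sup>2)"
        by (rule orth)
      also have "\<dots> \<le> (\<Sum>\<alpha>\<in>F. ((1 + C)\<^sup>2 * t powr \<theta>) * (norm (s \<alpha>))\<^sup>2)"
      proof (intro sum_mono mult_right_mono)
        fix \<alpha> assume "\<alpha> \<in> F"
        show "c \<alpha> * \<alpha> * c \<alpha> \<le> (1 + C)\<^sup>2 * t powr \<theta>"
        proof (cases "\<alpha> = 0")
          case False
          then have "0 < \<alpha>" using sF(2)[OF \<open>\<alpha> \<in> F\<close>] by simp
          then have "c \<alpha> * \<alpha> * c \<alpha> = (1 - m \<alpha>)\<^sup>2 / \<alpha>"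
            by (simp add: c_def power2_eq_square)
          also have "\<dots> \<le> (1 + C)\<^sup>2 * t powr \<theta>"
            using m_sq[of \<alpha>] \<open>0 < \<alpha>\<close> by (simp add: pos_divide_le_eq mult_ac)
          finally show ?thesis .
        qed (simp add: c_def)
      qed simp
      finally show "(norm (A w1))\<^sup>2 \<le> ((1 + C) * sqrt (t powr \<theta>) * norm q)\<^sup>2"
        by (simp add: power_mult_distrib nq sum_distrib_left)
    qed (use C(1) in simp)
    then have 1: "\<zeta> \<bullet> A w1 \<le> \<delta> * ((1 + C) * sqrt (t powr \<theta>) * norm q)"
      using noise \<open>0 \<le> \<delta>\<close> C(1)
      by (intro order_trans[OF norm_cauchy_schwarz] mult_mono) (auto simp: \<zeta>_def)
    have "norm w2 \<le> B * norm q"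
      unfolding w2_def using sF B(2) by (intro weighted) (auto simp: m_def)
    then have "norm (- w) * norm w2 \<le> norm w * (B * norm q)"
      by (simp add: mult_left_mono)
    then have 2: "(- w) \<bullet> w2 \<le> norm w * (B * norm q)"
      by (rule order_trans[OF norm_cauchy_schwarz])
    have "e \<bullet> q = (\<Sum>\<alpha>\<in>F. e \<bullet> s \<alpha>)"
      unfolding qF by (simp add: inner_sum_right)
    also have "\<dots> = (\<Sum>\<alpha>\<in>F. c \<alpha> * (\<zeta> \<bullet> A (s \<alpha>)) - m \<alpha> * \<phi> \<alpha> * (w \<bullet> s \<alpha>))"
      using coeff[OF s] sF by (intro sum.cong) (auto simp: c_def)
    also have "\<dots> = \<zeta> \<bullet> A w1 + (- w) \<bullet> w2"
      by (simp add: w1_def w2_def A.sum A.scale inner_sum_right sum_subtractf sum_negf)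
    finally show ?thesis
      using 1 2 by (simp add: K_def algebra_simps)
  qed
  have "e \<in> closure (span (\<Union>\<alpha>. ?E \<alpha>))"
    using eigenvectors_dense[OF A] by simp
  then obtain q where q: "\<And>n. q n \<in> span (\<Union>\<alpha>. ?E \<alpha>)" "q \<longlonglongrightarrow> e"
    by (auto simp: closure_sequential)
  \<comment> \<open>Density lets the error itself serve as test vector in the limit.\<close>
  have "e \<bullet> e \<le> K * norm e"
  proof (rule LIMSEQ_le)
    show "(\<lambda>n. e \<bullet> q n) \<longlonglongrightarrow> e \<bullet> e" "(\<lambda>n. K * norm (q n)) \<longlonglongrightarrow> K * norm e"
      by (intro tendsto_intros q(2))+
  qed (use test[OF q(1)] in auto)
  then have "norm e * norm e \<le> K * norm e"
    by (simp add: power2_norm_eq_inner[symmetric] power2_eq_square)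
  then show ?thesis
    using K0 by (cases "e = 0") (auto simp: K_def e_def)
qed

section \<open>The logarithmic rate\<close>

lemma powr_bigo_log:
  assumes "0 < a"
  shows "(\<lambda>\<delta>::real. \<delta> powr a) \<in> O[at_right 0](\<lambda>\<delta>. ln (1 / \<delta>) powr (- \<mu>))"
  using assms by real_asymp


text \<open>
  Splitting the spectrum at \<open>\<delta>\<^bsup>\<kappa>/4\<^esup>\<close>: below, \<open>\<phi>\<close> is small; above, the Mittag-Leffler factor is,
  since \<open>\<delta>\<^bsup>\<kappa>/4\<^esup> s \<ge> \<delta>\<^bsup>-\<kappa>/4\<^esup>\<close>.
\<close>

lemma residual_times_index_function_le:
  fixes s \<delta> \<kappa> :: real
  assumes \<phi>: "log_index_function \<mu> \<phi>" and E0: "0 \<le> C" "\<And>l. 0 \<le> l \<Longrightarrow> \<bar>E l\<bar> \<le> C"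
    and E1: "\<And>l. 0 \<le> l \<Longrightarrow> l * \<bar>E l\<bar> \<le> C"
    and \<delta>: "0 < \<delta>" "\<delta> powr (\<kappa> / 4) \<le> exp (- \<mu> - 1)" and s: "\<delta> powr (- \<kappa> / 2) \<le> s"
    and \<alpha>: "0 \<le> \<alpha>" "\<alpha> \<le> L"
  shows "\<bar>E (\<alpha> * s) * \<phi> \<alpha>\<bar> \<le> C * ((\<kappa> / 4 * ln (1 / \<delta>)) powr (- \<mu>) + \<phi> L * \<delta> powr (\<kappa> / 4))"
proof -
  have mono: "\<phi> a \<le> \<phi> b" if "0 \<le> a" "a \<le> b" for a b
    using \<phi> that unfolding log_index_function_def index_function_def
    by (metis atLeast_iff le_less order_trans strict_mono_onD)
  have nn: "0 \<le> \<phi> a" if "0 \<le> a" for a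
    using \<phi> that by (simp add: log_index_function_def index_function_def)
  define r where "r = \<delta> powr (\<kappa> / 4)"
  have r: "0 < r" using \<delta> by (simp add: r_def)
  have rs: "1 / r \<le> r * s"
  proof -
    have "1 / r = r * \<delta> powr (- \<kappa> / 2)"
      using \<delta>(1) by (simp add: r_def powr_minus_divide[symmetric] flip: powr_add)
    also have "\<dots> \<le> r * s" using r s by (intro mult_left_mono) auto
    finally show ?thesis .
  qed
  have s0: "0 < s" by (rule less_le_trans[OF _ s]) (use \<delta>(1) in simp)
  have \<phi>r: "\<phi> r = (\<kappa> / 4 * ln (1 / \<delta>)) powr (- \<mu>)"
  proof -
    have "\<phi> r = ln (1 / r) powr (- \<mu>)"
      using \<phi> r \<delta>(2) by (simp add: log_index_function_def r_def)
    also have "ln (1 / r) = \<kappa> / 4 * ln (1 / \<delta>)"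
      using \<delta>(1) by (simp add: r_def ln_div ln_powr)
    finally show ?thesis .
  qed
  have L0: "0 \<le> L" using \<alpha> by simp
  have "\<bar>E (\<alpha> * s)\<bar> * \<phi> \<alpha> \<le> C * \<phi> r + C * (\<phi> L * r)"
  proof (cases "\<alpha> \<le> r")
    case True
    then have "\<bar>E (\<alpha> * s)\<bar> * \<phi> \<alpha> \<le> C * \<phi> r"
      using \<alpha> s0 nn E0 by (intro mult_mono mono) auto
    moreover have "0 \<le> C * (\<phi> L * r)" using E0(1) nn[OF L0] r by simp
    ultimately show ?thesis by linarith
  next
    case False
    have "1 / r * \<bar>E (\<alpha> * s)\<bar> \<le> \<alpha> * s * \<bar>E (\<alpha> * s)\<bar>"
      using rs False s0 by (intro mult_right_mono order_trans[OF rs]) auto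
    also have "\<dots> \<le> C" using \<alpha> s0 by (intro E1) auto
    finally have "\<bar>E (\<alpha> * s)\<bar> \<le> C * r"
      using r by (simp add: field_simps)
    then have "\<bar>E (\<alpha> * s)\<bar> * \<phi> \<alpha> \<le> C * r * \<phi> L"
      using \<alpha> nn E0(1) r by (intro mult_mono mono) auto
    moreover have "0 \<le> C * \<phi> r" using E0(1) nn r by simp
    ultimately show ?thesis by (simp add: mult_ac)
  qed
  then show ?thesis
    using nn[OF \<alpha>(1)] by (simp add: abs_mult \<phi>r r_def[symmetric] distrib_left)
qed

theorem theorem4p1:
  fixes A :: "'x::{real_inner, complete_space} \<Rightarrow> 'y::{real_inner, complete_space}"
    and y :: 'y and xdag :: 'x
    and \<theta> \<mu> \<kappa> :: real and \<phi> :: "real \<Rightarrow> real"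
    and y\<delta> :: "real \<Rightarrow> 'y" and x\<delta> :: "real \<Rightarrow> real \<Rightarrow> 'x" and Tstar :: "real \<Rightarrow> real"
  assumes "\<not> finite_dim (UNIV :: 'x set)" and "\<not> finite_dim (UNIV :: 'y set)"
    and "compact_operator A" and "\<not> finite_dim (range A)"
    and "y \<in> range A" and "min_norm_solution A y xdag"
    and "0 < \<theta>" and "\<theta> < 2" and "0 < \<mu>"
    and "log_index_function \<mu> \<phi>"
    and "xdag \<in> range (operator_fun \<phi> (adjoint A \<circ> A))"
    and "\<And>\<delta>. \<delta> > 0 \<Longrightarrow> norm (y\<delta> \<delta> - y) \<le> \<delta>"
    and "\<And>\<delta>. \<delta> > 0 \<Longrightarrow> FAR_solution \<theta> A (y\<delta> \<delta>) (x\<delta> \<delta>)"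
    and "0 < \<kappa>" and "\<kappa> < 2"
    and "same_order_at_0 Tstar (\<lambda>\<delta>. \<delta> powr (- \<kappa> / \<theta>))"
  shows "(\<lambda>\<delta>. norm (x\<delta> \<delta> (Tstar \<delta>) - xdag)) \<in> O[at_right 0](\<lambda>\<delta>. ln (1 / \<delta>) powr (- \<mu>))"
proof -
  note cpt = \<open>compact_operator A\<close> and \<theta> = \<open>0 < \<theta>\<close> \<open>\<theta> < 2\<close> and \<kappa> = \<open>0 < \<kappa>\<close> \<open>\<kappa> < 2\<close> and \<phi> = \<open>log_index_function \<mu> \<phi>\<close>
  have bl: "bounded_linear A" using cpt by (simp add: compact_operator_def)
  have Axd: "A xdag = y" using \<open>min_norm_solution A y xdag\<close> by (simp add: min_norm_solution_def)
  obtain L where L: "\<And>v. norm (A v) \<le> L * norm v"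
    using bounded_linear.bounded[OF bl] by (metis mult.commute)
  obtain C where C: "0 \<le> C" "\<And>l. 0 \<le> l \<Longrightarrow> \<bar>mittag_leffler \<theta> (- l)\<bar> \<le> C"
    "\<And>l. 0 \<le> l \<Longrightarrow> l * \<bar>mittag_leffler \<theta> (- l)\<bar> \<le> C"
    "\<And>l. 0 \<le> l \<Longrightarrow> \<bar>1 - mittag_leffler \<theta> (- l)\<bar> \<le> C * l"
    using mittag_leffler_bounds[OF \<theta>] by auto
  obtain w where w: "xdag \<bullet> v = \<phi> \<beta> * (w \<bullet> v)" if "v \<in> eigenspace (adjoint A \<circ> A) \<beta>" for \<beta> v
  proof -
    obtain w0 where "xdag = operator_fun \<phi> (adjoint A \<circ> A) w0"
      using \<open>xdag \<in> range (operator_fun \<phi> (adjoint A \<circ> A))\<close> by blast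
    moreover have "bounded_linear (adjoint A \<circ> A)"
      unfolding o_def by (rule bounded_linear_compose[OF bounded_linear_adjoint[OF bl] bl])
    moreover have "(adjoint A \<circ> A) u \<bullet> v = u \<bullet> (adjoint A \<circ> A) v" for u v
      using inner_adjoint[OF bl, of "A u" v] inner_adjoint[OF bl, of "A v" u] by (simp add: inner_commute)
    ultimately show ?thesis
      using inner_operator_fun[of "adjoint A \<circ> A" \<phi> w0] that by blast
  qed
  obtain c D where cD: "0 < c" "0 < D"
    and T: "\<forall>\<^sub>F \<delta> in at_right 0. c \<le> Tstar \<delta> / \<delta> powr (- \<kappa> / \<theta>) \<and> Tstar \<delta> / \<delta> powr (- \<kappa> / \<theta>) \<le> D"
    using \<open>same_order_at_0 Tstar (\<lambda>\<delta>. \<delta> powr (- \<kappa> / \<theta>))\<close> by (auto simp: same_order_at_0_def)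
  \<comment> \<open>The noise term with the terminating time at its upper bound, plus the bias with
    the spectrum contained in the interval from 0 to \<open>L^2\<close>.\<close>
  define g where "g \<delta> = (1 + C) * sqrt (D powr \<theta>) * \<delta> powr (1 - \<kappa> / 2)
      + C * ((\<kappa> / 4 * ln (1 / \<delta>)) powr (- \<mu>) + \<phi> (L\<^sup>2) * \<delta> powr (\<kappa> / 4)) * norm w" for \<delta>
  \<comment> \<open>Puts the cut of the spectrum into the range where \<phi> is the logarithmic
    function.\<close>
  have ev1: "\<forall>\<^sub>F \<delta> in at_right 0. \<delta> powr (\<kappa> / 4) \<le> exp (- \<mu> - 1)"
  proof -
    have "((\<lambda>\<delta>. \<delta> powr (\<kappa> / 4)) \<longlongrightarrow> 0) (at_right 0)" using \<kappa> by real_asymp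
    from order_tendstoD(2)[OF this, of "exp (- \<mu> - 1)"] show ?thesis
      by (auto elim: eventually_mono)
  qed
  \<comment> \<open>Half of the exponent \<kappa> is sacrificed to absorb the unknown constant
    \<open>c\<close>, so that \<open>t powr \<theta>\<close> eventually dominates
    \<open>\<delta> powr (- \<kappa> / 2)\<close> with constant 1.\<close>
  have ev2: "\<forall>\<^sub>F \<delta> in at_right 0. 1 \<le> c powr \<theta> * \<delta> powr (- \<kappa> / 2)"
  proof -
    have "filterlim (\<lambda>\<delta>. \<delta> powr (- \<kappa> / 2)) at_top (at_right 0)" using \<kappa> by real_asymp
    then have "\<forall>\<^sub>F \<delta> in at_right 0. 1 / c powr \<theta> \<le> \<delta> powr (- \<kappa> / 2)"
      by (simp add: filterlim_at_top)
    then show ?thesis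
      by (rule eventually_mono) (use cD in \<open>simp add: field_simps\<close>)
  qed
  have "\<forall>\<^sub>F \<delta> in at_right 0. norm (norm (x\<delta> \<delta> (Tstar \<delta>) - xdag)) \<le> norm (g \<delta>)"
    using T ev1 ev2 eventually_at_right_less[of "0 :: real"]
  proof eventually_elim
    case (elim \<delta>)
    define t where "t = Tstar \<delta>"
    have \<delta>: "0 < \<delta>" by (rule elim)
    have p: "0 < \<delta> powr (- \<kappa> / \<theta>)" using \<delta> by simp
    have t: "c * \<delta> powr (- \<kappa> / \<theta>) \<le> t" "t \<le> D * \<delta> powr (- \<kappa> / \<theta>)"
      using elim(1) p by (simp_all add: t_def pos_le_divide_eq pos_divide_le_eq)
    have t0: "0 < t" using t(1) cD(1) p by (meson less_le_trans mult_pos_pos)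
    have pw: "(a * \<delta> powr (- \<kappa> / \<theta>)) powr \<theta> = a powr \<theta> * \<delta> powr (- \<kappa>)" if "0 < a" for a
      using that \<theta> \<delta> by (simp add: powr_mult powr_powr)
    have s1: "\<delta> powr (- \<kappa> / 2) \<le> t powr \<theta>"
    proof -
      have "1 * \<delta> powr (- \<kappa> / 2) \<le> (c powr \<theta> * \<delta> powr (- \<kappa> / 2)) * \<delta> powr (- \<kappa> / 2)"
        by (intro mult_right_mono elim) auto
      also have "\<dots> = c powr \<theta> * \<delta> powr (- \<kappa>)"
        by (simp add: mult.assoc flip: powr_add)
      also have "\<dots> \<le> t powr \<theta>"
        unfolding pw[OF cD(1), symmetric] using t(1) cD p \<theta> by (intro powr_mono2) auto
      finally show ?thesis by simp
    qed
    have s2: "sqrt (t powr \<theta>) * \<delta> \<le> sqrt (D powr \<theta>) * \<delta> powr (1 - \<kappa> / 2)"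
    proof -
      have "t powr \<theta> \<le> D powr \<theta> * \<delta> powr (- \<kappa>)"
        unfolding pw[OF cD(2), symmetric] using t t0 \<theta> by (intro powr_mono2) auto
      then have "sqrt (t powr \<theta>) \<le> sqrt (D powr \<theta>) * sqrt (\<delta> powr (- \<kappa>))"
        by (simp flip: real_sqrt_mult)
      also have "sqrt (\<delta> powr (- \<kappa>)) = \<delta> powr (- \<kappa> / 2)"
        using \<delta> by (simp add: powr_half_sqrt[symmetric] powr_powr)
      finally have "sqrt (t powr \<theta>) * \<delta> \<le> sqrt (D powr \<theta>) * \<delta> powr (- \<kappa> / 2) * \<delta>"
        using \<delta> by (intro mult_right_mono) auto
      also have "\<dots> = sqrt (D powr \<theta>) * \<delta> powr (1 - \<kappa> / 2)"
        using \<delta> powr_add[of \<delta> "- \<kappa> / 2" 1] by (simp add: algebra_simps)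
      finally show ?thesis .
    qed
    have L2: "0 \<le> \<phi> (L\<^sup>2)" using \<phi> by (simp add: log_index_function_def index_function_def)
    have "norm (x\<delta> \<delta> t - xdag) \<le> (1 + C) * sqrt (t powr \<theta>) * \<delta>
        + C * ((\<kappa> / 4 * ln (1 / \<delta>)) powr (- \<mu>) + \<phi> (L\<^sup>2) * \<delta> powr (\<kappa> / 4)) * norm w"
    proof (rule FAR_error_bound[OF cpt \<theta> C(1,2,4) _ _ w L t0])
      show "FAR_solution \<theta> A (y\<delta> \<delta>) (x\<delta> \<delta>)" using assms(13)[OF \<delta>] .
      show "norm (y\<delta> \<delta> - A xdag) \<le> \<delta>" using assms(12)[OF \<delta>] by (simp add: Axd)
      show "0 \<le> C * ((\<kappa> / 4 * ln (1 / \<delta>)) powr (- \<mu>) + \<phi> (L\<^sup>2) * \<delta> powr (\<kappa> / 4))"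
        using C(1) L2 by simp
      show "\<bar>mittag_leffler \<theta> (- (\<alpha> * t powr \<theta>)) * \<phi> \<alpha>\<bar> \<le>
          C * ((\<kappa> / 4 * ln (1 / \<delta>)) powr (- \<mu>) + \<phi> (L\<^sup>2) * \<delta> powr (\<kappa> / 4))"
        if "0 \<le> \<alpha>" "\<alpha> \<le> L\<^sup>2" for \<alpha>
        by (rule residual_times_index_function_le[OF \<phi> C(1), of "\<lambda>l. mittag_leffler \<theta> (- l)"])
          (use C elim s1 that \<delta> in auto)
    qed
    also have "\<dots> \<le> g \<delta>"
      using mult_left_mono[OF s2, of "1 + C"] C(1) by (simp add: g_def mult.assoc)
    finally show ?case by (simp add: t_def)
  qed
  then have "(\<lambda>\<delta>. norm (x\<delta> \<delta> (Tstar \<delta>) - xdag)) \<in> O[at_right 0](g)"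
    by (rule landau_o.big_mono)
  also have "g \<in> O[at_right 0](\<lambda>\<delta>. ln (1 / \<delta>) powr (- \<mu>))"
  proof -
    have log: "(\<lambda>\<delta>. (\<kappa> / 4 * ln (1 / \<delta>)) powr (- \<mu>)) \<in> O[at_right 0](\<lambda>\<delta>. ln (1 / \<delta>) powr (- \<mu>))"
      using \<kappa> by real_asymp
    have scale: "(\<lambda>\<delta>. a * f \<delta>) \<in> O[at_right 0](h)" "(\<lambda>\<delta>. f \<delta> * a) \<in> O[at_right 0](h)"
      if "f \<in> O[at_right 0](h)" for a :: real and f h :: "real \<Rightarrow> real"
      using that by (cases "a = 0"; simp)+
    show ?thesis
      unfolding g_def using \<kappa> by (intro sum_in_bigo scale log powr_bigo_log) auto
  qed
  finally show ?thesis .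
qed

end
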